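(* Let $p$ be a prime, let $d \ge 2$ be an integer, let $(t_n)_{n=1}^{\infty}$ be a sequence of nonnegative integers such that $dt_n \le n$ for all $n$, and let $X_n \in \mathrm{M}_n(\mathbb{Z}_p)$ be the Haar-random matrix supported on $\Sigma_n = (\sigma_{n,1},\ldots,\sigma_{n,n})$, where $$\sigma_{n,i} = \begin{cases} [n-d(t_n-i+1)] & \text{if } 1 \le i \le t_n, \\ [n] & \text{if } t_n+1 \le i \le n-t_n, \\ [n] \setminus [d(i-n+t_n)] & \text{if } n-t_n+1 \le i \le n. \end{cases}$$ Then $\mathrm{cok}(X_n)$ converges to CL if and only if $$\lim_{n\to\infty} \mathbb{P}(\det(\overline{X_n}) \neq 0) = \prod_{i=1}^{\infty}(1-p^{-i}).$$
   Context: $[k] = \{1,\ldots,k\}$ (with $[0]=\varnothing$); $\mathbb{Z}_p$ is the ring of $p$-adic integers, $\mathbb{F}_p$ the field with $p$ elements; $\mathrm{cok}(A) = \mathbb{Z}_p^n / A\mathbb{Z}_p^n$ and $\overline{A} \in \mathrm{M}_n(\mathbb{F}_p)$ is the reduction of $A$ modulo $p$, for $A \in \mathrm{M}_n(\mathbb{Z}_p)$. A $\mathbb{Z}_p$-valued random variable is Haar-random if it is distributed according to the Haar probability measure on $\mathbb{Z}_p$. For subsets $\sigma_{n,1},\ldots,\sigma_{n,n}$ of $[n]$ and $\Sigma_n = (\sigma_{n,1},\ldots,\sigma_{n,n})$, the Haar-random matrix supported on $\Sigma_n$ is the random matrix $X_n \in \mathrm{M}_n(\mathbb{Z}_p)$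 whose entries $(X_n)_{i,j}$ (row $i$, column $j$) with $i \in \sigma_{n,j}$ are Haar-random and independent, and $(X_n)_{i,j} = 0$ whenever $i \notin \sigma_{n,j}$. For a finite abelian $p$-group $G$ put $\mathrm{CL}(G) = \frac{1}{\#\mathrm{Aut}(G)} \prod_{i=1}^{\infty}(1-p^{-i})$. A sequence $(Y_n)_{n\ge1}$ of random finitely generated $\mathbb{Z}_p$-modules converges to CL if $\lim_{n\to\infty}\mathbb{P}(Y_n \cong G) = \mathrm{CL}(G)$ for every finite abelian $p$-group $G$. *)

theory Defs
  imports
    "HOL-Probability.Probability"
    "HOL-Algebra.Bij"
    "HOL-Algebra.Coset"
    "Jordan_Normal_Form.Determinant"
    "Berlekamp_Zassenhaus.Finite_Field"
begin

section \<open>The ring of p-adic integers\<close>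

text \<open>
  As for the type \<open>'p mod_ring\<close> of residues modulo \<open>p\<close>, the prime \<open>p\<close> is the cardinality of the
  type argument \<open>'p\<close>.  A p-adic integer is an element of the inverse limit of the rings of integers
  modulo \<open>p ^ k\<close>, each residue class being represented by its least nonnegative element.
\<close>

typedef (overloaded) ('p :: prime_card) padic_int =
  "{f :: nat \<Rightarrow> int. \<forall>k. f k \<in> {0 ..< int CARD('p) ^ k} \<and>
      f (Suc k) mod int CARD('p) ^ k = f k}"
  morphisms residue Abs_padic_int
  by (rule exI[of _ "\<lambda>_. 0"]) (simp add: prime_card prime_gt_0_nat)

setup_lifting type_definition_padic_int

lemma inverse_system_mod:
  fixes g :: "nat \<Rightarrow> int"
  assumes "g (Suc k) mod int CARD('p :: prime_card) ^ k = g k mod int CARD('p) ^ k"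
  shows "g k mod int CARD('p) ^ k \<in> {0 ..< int CARD('p) ^ k} \<and>
      g (Suc k) mod int CARD('p) ^ Suc k mod int CARD('p) ^ k = g k mod int CARD('p) ^ k"
proof -
  have "int CARD('p) ^ k dvd int CARD('p) ^ Suc k" by simp
  then have "g (Suc k) mod int CARD('p) ^ Suc k mod int CARD('p) ^ k = g (Suc k) mod int CARD('p) ^ k"
    by (rule mod_mod_cancel)
  moreover have "int CARD('p) ^ k > 0"
    by (simp add: prime_card prime_gt_0_nat)
  ultimately show ?thesis
    using assms by simp
qed

instantiation padic_int :: (prime_card) comm_ring_1
begin

lift_definition zero_padic_int :: "'a padic_int" is "\<lambda>k. 0 mod int CARD('a) ^ k"
  by (rule inverse_system_mod[of "\<lambda>_. 0"]) simp

lift_definition one_padic_int :: "'a padic_int" is "\<lambda>k. 1 mod int CARD('a) ^ k"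
  by (rule inverse_system_mod[of "\<lambda>_. 1"]) simp

lift_definition plus_padic_int :: "'a padic_int \<Rightarrow> 'a padic_int \<Rightarrow> 'a padic_int"
  is "\<lambda>f g k. (f k + g k) mod int CARD('a) ^ k"
  subgoal premises prems for f g k
    by (rule inverse_system_mod[of "\<lambda>k. f k + g k"]) (metis prems mod_add_eq)
  done

lift_definition minus_padic_int :: "'a padic_int \<Rightarrow> 'a padic_int \<Rightarrow> 'a padic_int"
  is "\<lambda>f g k. (f k - g k) mod int CARD('a) ^ k"
  subgoal premises prems for f g k
    by (rule inverse_system_mod[of "\<lambda>k. f k - g k"]) (metis prems mod_diff_eq)
  done

lift_definition uminus_padic_int :: "'a padic_int \<Rightarrow> 'a padic_int"
  is "\<lambda>f k. (- f k) mod int CARD('a) ^ k"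
  subgoal premises prems for f k
    by (rule inverse_system_mod[of "\<lambda>k. - f k"]) (metis prems mod_minus_eq)
  done

lift_definition times_padic_int :: "'a padic_int \<Rightarrow> 'a padic_int \<Rightarrow> 'a padic_int"
  is "\<lambda>f g k. (f k * g k) mod int CARD('a) ^ k"
  subgoal premises prems for f g k
    by (rule inverse_system_mod[of "\<lambda>k. f k * g k"]) (metis prems mod_mult_eq)
  done

instance
proof
  fix a b c :: "'a padic_int"
  show "a * b * c = a * (b * c)"
    by transfer (auto simp: mod_simps algebra_simps)
  show "a * b = b * a"
    by transfer (auto simp: mod_simps algebra_simps)
  show "1 * a = a"
    by transfer (auto simp: mod_simps fun_eq_iff)
  show "a + b + c = a + (b + c)"
    by transfer (auto simp: mod_simps algebra_simps)
  show "a + b = b + a"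
    by transfer (auto simp: mod_simps algebra_simps)
  show "0 + a = a"
    by transfer (auto simp: mod_simps fun_eq_iff)
  show "- a + a = 0"
    by transfer (auto simp: mod_simps)
  show "a - b = a + - b"
    by transfer (auto simp: mod_simps)
  show "(a + b) * c = a * c + b * c"
    by transfer (auto simp: mod_simps algebra_simps)
  show "(0 :: 'a padic_int) \<noteq> 1"
  proof transfer
    have "int CARD('a) > 1"
      using prime_gt_1_nat[OF prime_card[where 'a='a]] by simp
    then show "(\<lambda>k. 0 mod int CARD('a) ^ k) \<noteq> (\<lambda>k. 1 mod int CARD('a) ^ k)"
      by (auto simp: fun_eq_iff intro!: exI[of _ 1])
  qed
qed

end

text \<open>The p-adic (inverse limit) topology: the residue discs form a basis.\<close>

instantiation padic_int :: (prime_card) topological_space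
begin

definition open_padic_int :: "'a padic_int set \<Rightarrow> bool" where
  "open_padic_int U \<longleftrightarrow> (\<forall>x\<in>U. \<exists>k. \<forall>y. residue y k = residue x k \<longrightarrow> y \<in> U)"

instance
proof
  show "open (UNIV :: 'a padic_int set)"
    by (simp add: open_padic_int_def)
next
  fix S T :: "'a padic_int set"
  assume S: "open S" and T: "open T"
  have down: "residue y k = residue x k"
    if "residue y (k + j) = residue x (k + j)" for x y :: "'a padic_int" and k j
    using that
  proof (induction j)
    case (Suc j)
    have "residue z (Suc (k + j)) mod int CARD('a) ^ (k + j) = residue z (k + j)" for z :: "'a padic_int"
      using residue[of z] by blast
    then show ?case using Suc by (metis add_Suc_right)
  qed simp
  show "open (S \<inter> T)"
    unfolding open_padic_int_def
  proof
    fix x assume x: "x \<in> S \<inter> T"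
    obtain k where k: "\<forall>y. residue y k = residue x k \<longrightarrow> y \<in> S"
      using S x unfolding open_padic_int_def by blast
    obtain l where l: "\<forall>y. residue y l = residue x l \<longrightarrow> y \<in> T"
      using T x unfolding open_padic_int_def by blast
    have "\<forall>y. residue y (k + l) = residue x (k + l) \<longrightarrow> y \<in> S \<inter> T"
      using k l down by (metis IntI add.commute)
    then show "\<exists>m. \<forall>y. residue y m = residue x m \<longrightarrow> y \<in> S \<inter> T" ..
  qed
next
  fix K :: "'a padic_int set set"
  assume "\<forall>S\<in>K. open S"
  then show "open (\<Union>K)"
    unfolding open_padic_int_def by (meson Union_iff)
qed

end

text \<open>Reduction modulo \<open>p\<close>, as a map onto the field with \<open>p\<close> elements.\<close>

definition reduce :: "'p :: prime_card padic_int \<Rightarrow> 'p mod_ring" where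
  "reduce x = of_int_mod_ring (residue x 1)"


section \<open>Haar-random matrices\<close>

text \<open>The Haar probability measure is the unique measure with this property.\<close>

definition is_haar_prob :: "'p :: prime_card padic_int measure \<Rightarrow> bool" where
  "is_haar_prob N \<longleftrightarrow> prob_space N \<and> sets N = sets borel \<and>
     (\<forall>a. \<forall>A\<in>sets borel. emeasure N ((+) a ` A) = emeasure N A)"

definition haar_random :: "'w measure \<Rightarrow> ('w \<Rightarrow> 'p :: prime_card padic_int) \<Rightarrow> bool" where
  "haar_random M x \<longleftrightarrow> x \<in> borel_measurable M \<and> is_haar_prob (distr M borel x)"

text \<open>
  The support \<open>\<sigma> 1, \<dots>, \<sigma> n\<close> uses row and column indices starting at 1, whereas matrix entries
  \<open>A $$ (i, j)\<close> are indexed from 0.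
\<close>

definition haar_matrix_supported ::
  "'w measure \<Rightarrow> nat \<Rightarrow> (nat \<Rightarrow> nat set) \<Rightarrow> ('w \<Rightarrow> 'p :: prime_card padic_int mat) \<Rightarrow> bool" where
  "haar_matrix_supported M n \<sigma> X \<longleftrightarrow>
     (\<forall>\<omega>\<in>space M. X \<omega> \<in> carrier_mat n n) \<and>
     (\<forall>i\<in>{1..n}. \<forall>j\<in>{1..n}. i \<in> \<sigma> j \<longrightarrow> haar_random M (\<lambda>\<omega>. X \<omega> $$ (i - 1, j - 1))) \<and>
     prob_space.indep_vars M (\<lambda>_. borel) (\<lambda>(i, j) \<omega>. X \<omega> $$ (i - 1, j - 1))
       {(i, j). i \<in> {1..n} \<and> j \<in> {1..n} \<and> i \<in> \<sigma> j} \<and>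
     (\<forall>i\<in>{1..n}. \<forall>j\<in>{1..n}. i \<notin> \<sigma> j \<longrightarrow> (\<forall>\<omega>\<in>space M. X \<omega> $$ (i - 1, j - 1) = 0))"


section \<open>Cokernels and the Cohen-Lenstra distribution\<close>

text \<open>
  Only the additive group of the cokernel is recorded.  For a finite abelian p-group \<open>G\<close>, every
  group homomorphism from a finitely generated module over the p-adic integers to \<open>G\<close> is linear,
  so being isomorphic to \<open>G\<close> has the same meaning for groups and for modules.
\<close>

definition cok :: "'a :: comm_ring_1 mat \<Rightarrow> 'a vec set monoid" where
  "cok A = monoid_vec TYPE('a) (dim_row A) Mod ((\<lambda>v. A *\<^sub>v v) ` carrier_vec (dim_col A))"

definition finite_abelian_p_group :: "nat \<Rightarrow> ('a, 'b) monoid_scheme \<Rightarrow> bool" where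
  "finite_abelian_p_group p G \<longleftrightarrow> comm_group G \<and> finite (carrier G) \<and> (\<exists>k. order G = p ^ k)"

definition CL :: "nat \<Rightarrow> ('a, 'b) monoid_scheme \<Rightarrow> real" where
  "CL p G = 1 / real (card (auto G)) * (\<Prod>i. 1 - 1 / real p ^ Suc i)"

text \<open>
  Every finite group is isomorphic to one whose elements are natural numbers, so letting \<open>G\<close> range
  over groups of this kind is no restriction.
\<close>

definition converges_to_CL ::
  "nat \<Rightarrow> (nat \<Rightarrow> 'w measure) \<Rightarrow> (nat \<Rightarrow> 'w \<Rightarrow> ('a, 'b) monoid_scheme) \<Rightarrow> bool" where
  "converges_to_CL p M Y \<longleftrightarrow>
     (\<forall>G :: nat monoid. finite_abelian_p_group p G \<longrightarrow>
        (\<lambda>n. measure (M n) {\<omega> \<in> space (M n). Y n \<omega> \<cong> G}) \<longlonglongrightarrow> CL p G)"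

end

theory Submission
  imports Defs "HOL-Algebra.Generated_Groups" "HOL-Algebra.Elementary_Groups" "HOL-Algebra.Product_Groups"
begin

text \<open>
  Fix \<open>n\<close> and put \<open>r = n - d t\<close>.  Besides the \<open>2 t\<close> sparse columns, the shortest of which have \<open>r\<close> entries,
  there are \<open>m = n - 2 t \<ge> r\<close> columns with full support.  Both sides of the equivalence hold exactly
  when \<open>p\<^sup>-\<^sup>r\<close> tends to \<open>0\<close>.

  The determinant of \<open>X\<close> modulo \<open>p\<close> is nonzero if and only if the cokernel is trivial, so convergence to CL implies
  convergence of the probabilities of a nonzero determinant.  Conversely, suppose that these converge to the infinite
  product.  If \<open>t > 0\<close>, the first column vanishes modulo \<open>p\<close> with probability \<open>p\<^sup>-\<^sup>r\<close>, and every other column, given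
  those before it, falls into their span at least as often as a full random column would.  So the probability of a
  nonzero determinant is at most \<open>1 - p\<^sup>-\<^sup>r\<close> times the product of the \<open>1 - p\<^sup>-\<^sup>i\<close> over \<open>0 < i < n\<close>
  (\<open>prob_cok_trivial_le\<close>), and this bound forces \<open>p\<^sup>-\<^sup>r\<close> to tend to \<open>0\<close>.

  Once \<open>p\<^sup>-\<^sup>r\<close> is small, the sparse columns are linearly independent modulo \<open>p\<close> with high probability: every
  nontrivial combination of them is uniform on the rows that it uses, and a union bound over all combinations gives a
  failure probability of order \<open>p\<^sup>-\<^sup>r\<close> (\<open>stairs_dependency_sum\<close>, \<open>card_dependent_le\<close>).  If they are independent,
  then they form part of a basis, and the cokernel of \<open>X\<close> is distributed exactly like that of a full \<open>m \<times> m\<close>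
  Haar-random matrix, whatever their values (\<open>card_extensions_with_quotient\<close>).  The latter distribution is explicit
  and tends to CL, because \<open>m \<ge> r\<close> tends to infinity (\<open>haar_cok_prob_limit\<close>).

  All probabilities are computed by counting in finite groups.  For a group \<open>G\<close> of order \<open>p\<^sup>e\<close>, whether the cokernel
  is isomorphic to \<open>G\<close> depends only on the entries modulo \<open>p\<^sup>e\<^sup>+\<^sup>1\<close> (\<open>cok_iso_iff_residue_quotient\<close>), and the matrix of
  these residues is uniformly distributed (\<open>prob_residue_cols\<close>).  The exact count rests on epimorphisms \<open>F\<close> from
  \<open>V = (\<int>/p\<^sup>e\<^sup>+\<^sup>1)\<^sup>n\<close> onto \<open>G\<close>: the kernel \<open>K\<close> of \<open>F\<close> contains the \<open>p\<close>-torsion of \<open>V\<close>, hence \<open>K/pK\<close> has order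
  \<open>p\<^sup>n\<close> just as \<open>V/pV\<close> has, and the number of ways to complete the sparse columns to generators of \<open>K\<close> depends only on
  the order of \<open>K\<close>.
\<close>

section \<open>Subgroups generated by words in an abelian group\<close>

abbreviation powers :: "('a, 'c) monoid_scheme \<Rightarrow> nat \<Rightarrow> 'a set \<Rightarrow> 'a set" where
  "powers G m H \<equiv> (\<lambda>x. x [^]\<^bsub>G\<^esub> m) ` H"

abbreviation torsion :: "('a, 'c) monoid_scheme \<Rightarrow> nat \<Rightarrow> 'a set" where
  "torsion G m \<equiv> {x \<in> carrier G. x [^]\<^bsub>G\<^esub> m = \<one>\<^bsub>G\<^esub>}"

definition word :: "('a, 'c) monoid_scheme \<Rightarrow> ('b \<Rightarrow> 'a) \<Rightarrow> 'b set \<Rightarrow> ('b \<Rightarrow> nat) \<Rightarrow> 'a" where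
  "word G x J c = finprod G (\<lambda>j. x j [^]\<^bsub>G\<^esub> c j) J"

text \<open>
  If \<open>M\<close> is a prime and \<open>H\<close> contains the \<open>M\<close>-th powers, this is linear independence of the classes of the \<open>x j\<close> in the
  vector space \<open>G/H\<close> over the field with \<open>M\<close> elements.
\<close>

definition indep_mod :: "('a, 'c) monoid_scheme \<Rightarrow> nat \<Rightarrow> 'a set \<Rightarrow> ('b \<Rightarrow> 'a) \<Rightarrow> 'b set \<Rightarrow> bool" where
  "indep_mod G M H x J \<longleftrightarrow> (\<forall>c \<in> \<Pi>\<^sub>E j\<in>J. {..<M}. word G x J c \<in> H \<longrightarrow> (\<forall>j\<in>J. c j = 0))"

context comm_group
begin

lemma subgroup_cancel:
  assumes "subgroup H G" "a \<in> H" "a \<otimes> b \<in> H" "b \<in> carrier G"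
  shows "b \<in> H"
proof -
  have "a \<in> carrier G" using assms subgroup.mem_carrier by metis
  then have "b = inv a \<otimes> (a \<otimes> b)" using assms(4) by (simp add: m_assoc[symmetric])
  then show ?thesis using assms by (metis subgroup.m_closed subgroup.m_inv_closed)
qed

lemma mult_exchange:
  "\<lbrakk>a \<in> carrier G; b \<in> carrier G; c \<in> carrier G; d \<in> carrier G; e \<in> carrier G\<rbrakk>
    \<Longrightarrow> (a \<otimes> b) \<otimes> (c \<otimes> d \<otimes> e) = (a \<otimes> c) \<otimes> (d \<otimes> (b \<otimes> e))"
  by (simp add: m_ac)

lemma word_closed: "x \<in> J \<rightarrow> carrier G \<Longrightarrow> word G x J c \<in> carrier G"
  unfolding word_def by (intro finprod_closed) auto

lemma word_add:
  assumes "x \<in> J \<rightarrow> carrier G"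
  shows "word G x J (\<lambda>j. a j + b j) = word G x J a \<otimes> word G x J b"
proof -
  have "word G x J (\<lambda>j. a j + b j) = (\<Otimes>j\<in>J. x j [^] a j \<otimes> x j [^] b j)"
    unfolding word_def using assms by (intro finprod_cong') (auto simp: nat_pow_mult Pi_iff)
  also have "\<dots> = word G x J a \<otimes> word G x J b"
    unfolding word_def using assms by (intro finprod_multf) auto
  finally show ?thesis .
qed

lemma word_cong:
  assumes "x \<in> J \<rightarrow> carrier G" "\<And>j. j \<in> J \<Longrightarrow> a j = b j"
  shows "word G x J a = word G x J b"
  unfolding word_def using assms by (intro finprod_cong') auto

lemma word_zero: "x \<in> J \<rightarrow> carrier G \<Longrightarrow> (\<And>j. j \<in> J \<Longrightarrow> c j = 0) \<Longrightarrow> word G x J c = \<one>"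
  unfolding word_def by (intro finprod_one_eqI) simp

lemma word_in_subgroup:
  assumes "subgroup H G" "\<And>j. j \<in> J \<Longrightarrow> x j [^] c j \<in> H"
  shows "word G x J c \<in> H"
proof (cases "finite J")
  case True
  have sub: "H \<subseteq> carrier G" using assms(1) by (rule subgroup.subset)
  have "finprod G (\<lambda>j. x j [^] c j) J' \<in> H" if "J' \<subseteq> J" for J'
    using finite_subset[OF that True] that
  proof (induction J' rule: finite_induct)
    case empty
    then show ?case using subgroup.one_closed[OF assms(1)] by simp
  next
    case (insert j J')
    have "finprod G (\<lambda>j. x j [^] c j) (insert j J') = x j [^] c j \<otimes> finprod G (\<lambda>j. x j [^] c j) J'"
      using insert assms(2) sub by (intro finprod_insert) auto
    then show ?case using insert assms subgroup.m_closed[OF assms(1)] by auto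
  qed
  then show ?thesis unfolding word_def by simp
next
  case False
  then show ?thesis unfolding word_def using subgroup.one_closed[OF assms(1)] by simp
qed

lemma pow_in_subgroup:
  assumes "subgroup H G" "y \<in> H" shows "y [^] (n::nat) \<in> H"
  by (induction n) (use assms subgroup.one_closed subgroup.m_closed in \<open>auto\<close>)

lemma word_multiple_in_subgroup:
  assumes "subgroup H G" "x \<in> J \<rightarrow> carrier G" "\<forall>j\<in>J. x j [^] (M::nat) \<in> H"
  shows "word G x J (\<lambda>j. M * c j) \<in> H"
proof (rule word_in_subgroup[OF assms(1)])
  fix j assume j: "j \<in> J"
  have "x j [^] (M * c j) = (x j [^] M) [^] c j" using assms(2) j by (subst nat_pow_pow) auto
  then show "x j [^] (M * c j) \<in> H" using pow_in_subgroup[OF assms(1)] assms(3) j by simp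
qed

lemma word_single:
  assumes "finite J" "j \<in> J" "x \<in> J \<rightarrow> carrier G"
  shows "word G x J (\<lambda>i. if i = j then 1 else 0) = x j"
proof -
  have "word G x J (\<lambda>i. if i = j then 1 else 0) = (\<Otimes>i\<in>J. if j = i then x i else \<one>)"
    unfolding word_def using assms(2,3) by (intro finprod_cong') (auto simp: Pi_iff)
  also have "\<dots> = x j" using assms by (intro finprod_singleton) auto
  finally show ?thesis .
qed

lemma word_mod:
  assumes "subgroup H G" "x \<in> J \<rightarrow> carrier G" "\<forall>j\<in>J. x j [^] (M::nat) \<in> H"
  shows "\<exists>h\<in>H. word G x J c = h \<otimes> word G x J (\<lambda>j. c j mod M)"
proof -
  have "word G x J c = word G x J (\<lambda>j. M * (c j div M) + c j mod M)" by simp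
  also have "\<dots> = word G x J (\<lambda>j. M * (c j div M)) \<otimes> word G x J (\<lambda>j. c j mod M)"
    by (rule word_add[OF assms(2)])
  finally show ?thesis using word_multiple_in_subgroup[OF assms, of "\<lambda>j. c j div M"] by blast
qed

text \<open>
  The products of an element of \<open>H\<close> with a word in \<open>x\<close> form a subgroup.  As \<open>M\<close>-th powers of the \<open>x j\<close> can be moved into
  \<open>H\<close>, exponents below \<open>M\<close> suffice.
\<close>

lemma generate_Un_eq_words:
  assumes H: "subgroup H G" and J: "finite J" and x: "x \<in> J \<rightarrow> carrier G"
    and M: "0 < (M::nat)" and xM: "\<forall>j\<in>J. x j [^] M \<in> H"
  shows "generate G (H \<union> x ` J) = (\<lambda>(h, c). h \<otimes> word G x J c) ` (H \<times> (\<Pi>\<^sub>E j\<in>J. {..<M}))"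
    (is "?L = ?f ` ?D")
proof
  have Hc: "H \<subseteq> carrier G" using H by (rule subgroup.subset)
  have wc: "word G x J c \<in> carrier G" for c using x by (rule word_closed)
  let ?S = "{h \<otimes> word G x J c | h c. h \<in> H}"
  have "subgroup ?S G"
  proof (rule subgroup.intro)
    show "?S \<subseteq> carrier G" using Hc wc by auto
    show "\<one> \<in> ?S"
      using word_zero[OF x, of "\<lambda>_. 0"] subgroup.one_closed[OF H]
      by (intro CollectI exI[of _ "\<one>"] exI[of _ "\<lambda>_. 0"]) auto
    fix y z assume "y \<in> ?S" "z \<in> ?S"
    then obtain h c h' c' where yz: "y = h \<otimes> word G x J c" "z = h' \<otimes> word G x J c'" "h \<in> H" "h' \<in> H"
      by auto
    have "y \<otimes> z = (h \<otimes> h') \<otimes> (word G x J c \<otimes> word G x J c')"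
      using yz Hc wc by (simp add: m_ac subset_iff)
    then have "y \<otimes> z = (h \<otimes> h') \<otimes> word G x J (\<lambda>j. c j + c' j)"
      using word_add[OF x] by simp
    then show "y \<otimes> z \<in> ?S" using yz subgroup.m_closed[OF H] by blast
  next
    fix y assume "y \<in> ?S"
    then obtain h c where y: "y = h \<otimes> word G x J c" "h \<in> H" by auto
    \<comment> \<open>The inverse of a word is the word with exponents \<open>(M - 1) c\<close>, up to the element \<open>?u\<close> of \<open>H\<close>.\<close>
    let ?u = "word G x J (\<lambda>j. M * c j)" and ?v = "word G x J (\<lambda>j. (M - 1) * c j)"
    have u: "?u \<in> H" by (rule word_multiple_in_subgroup[OF H x xM])
    have "word G x J c \<otimes> ?v = ?u"
    proof -
      have "(\<lambda>j. c j + (M - 1) * c j) = (\<lambda>j. M * c j)"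
        using M by (metis Suc_pred' mult_Suc)
      then show ?thesis using word_add[OF x, of c "\<lambda>j. (M - 1) * c j"] by simp
    qed
    then have wv: "word G x J c \<otimes> ?v = ?u" .
    have hu: "h \<in> carrier G" "?u \<in> carrier G" using y u Hc by auto
    have "y \<otimes> (inv h \<otimes> inv ?u \<otimes> ?v) = (h \<otimes> inv h) \<otimes> (inv ?u \<otimes> (word G x J c \<otimes> ?v))"
      using hu wc unfolding y(1) by (intro mult_exchange) auto
    also have "\<dots> = \<one>" using hu unfolding wv by simp
    finally have "y \<otimes> (inv h \<otimes> inv ?u \<otimes> ?v) = \<one>" .
    moreover have "y \<in> carrier G" "inv h \<otimes> inv ?u \<otimes> ?v \<in> carrier G"
      using y(1) hu wc by auto
    ultimately have "inv y = inv h \<otimes> inv ?u \<otimes> ?v"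
      using m_comm[of y] by (intro inv_equality) auto
    moreover have "inv h \<otimes> inv ?u \<in> H"
      using y u H by (simp add: subgroup.m_closed subgroup.m_inv_closed)
    ultimately show "inv y \<in> ?S" by blast
  qed
  moreover have "H \<union> x ` J \<subseteq> ?S"
  proof
    fix y assume "y \<in> H \<union> x ` J"
    then consider "y \<in> H" | j where "j \<in> J" "y = x j" by auto
    then show "y \<in> ?S"
    proof cases
      case 1
      then show ?thesis using word_zero[OF x, of "\<lambda>_. 0"] Hc
        by (intro CollectI exI[of _ y] exI[of _ "\<lambda>_. 0"]) auto
    next
      case 2
      then show ?thesis using word_single[OF J _ x, of j] funcset_mem[OF x, of j] subgroup.one_closed[OF H]
        by (intro CollectI exI[of _ \<one>] exI[of _ "\<lambda>i. if i = j then 1 else 0"]) auto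
    qed
  qed
  ultimately have "?L \<subseteq> ?S" by (intro generate_subgroup_incl)
  also have "?S \<subseteq> ?f ` ?D"
  proof
    fix y assume "y \<in> ?S"
    then obtain h c where y: "y = h \<otimes> word G x J c" "h \<in> H" by auto
    obtain h' where h': "h' \<in> H" "word G x J c = h' \<otimes> word G x J (\<lambda>j. c j mod M)"
      using word_mod[OF H x xM] by blast
    let ?c = "\<lambda>j\<in>J. c j mod M"
    have "word G x J (\<lambda>j. c j mod M) = word G x J ?c" by (rule word_cong[OF x]) auto
    then have "y = (h \<otimes> h') \<otimes> word G x J ?c" using y h' Hc wc by (simp add: m_assoc subset_iff)
    moreover have "(h \<otimes> h', ?c) \<in> ?D" using M y h' subgroup.m_closed[OF H] by auto
    ultimately show "y \<in> ?f ` ?D" by (intro image_eqI[of _ _ "(h \<otimes> h', ?c)"]) auto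
  qed
  finally show "?L \<subseteq> ?f ` ?D" .
  show "?f ` ?D \<subseteq> ?L"
  proof
    fix y assume "y \<in> ?f ` ?D"
    then obtain h c where y: "y = h \<otimes> word G x J c" "h \<in> H" by auto
    have "subgroup ?L G" using Hc x by (intro generate_is_subgroup) auto
    then have "word G x J c \<in> ?L"
      by (intro word_in_subgroup pow_in_subgroup) (auto intro: generate.incl)
    then show "y \<in> ?L" using y by (auto intro: generate.eng generate.incl)
  qed
qed

lemma card_generate_Un_le:
  assumes H: "subgroup H G" and J: "finite J" and x: "x \<in> J \<rightarrow> carrier G"
    and M: "0 < (M::nat)" and xM: "\<forall>j\<in>J. x j [^] M \<in> H" and fin: "finite H"
  shows "card (generate G (H \<union> x ` J)) \<le> M ^ card J * card H"
proof -
  have "card (generate G (H \<union> x ` J)) \<le> card (H \<times> (\<Pi>\<^sub>E j\<in>J. {..<M}))"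
    unfolding generate_Un_eq_words[OF H J x M xM]
    using fin J by (intro card_image_le finite_cartesian_product finite_PiE) auto
  also have "\<dots> = M ^ card J * card H" using J by (simp add: card_cartesian_product card_PiE)
  finally show ?thesis .
qed

text \<open>
  Independence makes the representation of an element as a product of an element of \<open>H\<close> and a reduced word unique.
\<close>

lemma card_generate_Un_eq:
  assumes H: "subgroup H G" and J: "finite J" and x: "x \<in> J \<rightarrow> carrier G"
    and M: "0 < (M::nat)" and xM: "\<forall>j\<in>J. x j [^] M \<in> H"
    and indep: "indep_mod G M H x J"
  shows "card (generate G (H \<union> x ` J)) = M ^ card J * card H"
proof -
  have Hc: "H \<subseteq> carrier G" using H by (rule subgroup.subset)
  have wc: "word G x J c \<in> carrier G" for c using x by (rule word_closed)
  have "inj_on (\<lambda>(h, c). h \<otimes> word G x J c) (H \<times> (\<Pi>\<^sub>E j\<in>J. {..<M}))"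
  proof (rule inj_onI, clarify)
    fix h c h' c'
    assume h: "h \<in> H" "h' \<in> H" and c: "c \<in> (\<Pi>\<^sub>E j\<in>J. {..<M})" "c' \<in> (\<Pi>\<^sub>E j\<in>J. {..<M})"
      and eq: "h \<otimes> word G x J c = h' \<otimes> word G x J c'"
    \<comment> \<open>The exponents \<open>?m\<close> are those of the inverse of the word with exponents \<open>c'\<close>, modulo \<open>H\<close>.\<close>
    let ?m = "\<lambda>j. M - c' j"
    let ?e = "\<lambda>j\<in>J. (c j + ?m j) mod M"
    have hc: "h \<in> carrier G" "h' \<in> carrier G" using h Hc by auto
    have "word G x J c' \<otimes> word G x J ?m = word G x J (\<lambda>j. M * 1)"
      unfolding word_add[OF x, symmetric] using c by (intro word_cong[OF x]) (auto simp: PiE_iff)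
    also have "\<dots> \<in> H" using xM by (intro word_multiple_in_subgroup[OF H x])
    finally have u: "word G x J c' \<otimes> word G x J ?m \<in> H" (is "?u \<in> H") .
    obtain k where k: "k \<in> H" "word G x J (\<lambda>j. c j + ?m j) = k \<otimes> word G x J (\<lambda>j. (c j + ?m j) mod M)"
      using word_mod[OF H x xM] by blast
    have "word G x J (\<lambda>j. (c j + ?m j) mod M) = word G x J ?e" by (rule word_cong[OF x]) auto
    with k have k': "word G x J c \<otimes> word G x J ?m = k \<otimes> word G x J ?e" using word_add[OF x] by simp
    have "h \<otimes> (k \<otimes> word G x J ?e) = h' \<otimes> ?u"
    proof -
      have "h \<otimes> (k \<otimes> word G x J ?e) = (h \<otimes> word G x J c) \<otimes> word G x J ?m"
        unfolding k'[symmetric] using hc wc by (simp add: m_assoc)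
      also have "\<dots> = h' \<otimes> ?u" unfolding eq using hc wc by (simp add: m_assoc)
      finally show ?thesis .
    qed
    then have "h \<otimes> (k \<otimes> word G x J ?e) \<in> H" using h u subgroup.m_closed[OF H] by simp
    then have "word G x J ?e \<in> H"
      using h k Hc wc by (meson H m_closed subgroup_cancel subsetD)
    moreover have "?e \<in> (\<Pi>\<^sub>E j\<in>J. {..<M})" using M by auto
    ultimately have "\<forall>j\<in>J. ?e j = 0" using indep unfolding indep_mod_def by blast
    then have e0: "\<forall>j\<in>J. (c j + ?m j) mod M = 0" by simp
    have "c j = c' j" if "j \<in> J" for j
    proof -
      have "M dvd c j + (M - c' j)" using e0 that by auto
      then obtain q where q: "c j + (M - c' j) = M * q" by auto
      have lt: "c j < M" "c' j < M" using c that by auto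
      then have "0 < M * q" "M * q < M * 2" using q by linarith+
      then have "q = 1" using M by simp
      then show ?thesis using q lt by simp
    qed
    then have cc: "c = c'" using c by (intro PiE_ext) auto
    then show "h = h' \<and> c = c'" using eq hc wc[of c'] by simp
  qed
  then have "card (generate G (H \<union> x ` J)) = card (H \<times> (\<Pi>\<^sub>E j\<in>J. {..<M}))"
    unfolding generate_Un_eq_words[OF H J x M xM] by (rule card_image)
  also have "\<dots> = M ^ card J * card H" using J by (simp add: card_cartesian_product card_PiE)
  finally show ?thesis .
qed

text \<open>
  If \<open>y\<^sup>c\<close> lies in \<open>H\<close> for some \<open>c\<close> prime to \<open>p\<close>, then so does \<open>y\<close>, by Bezout.  Hence a single element outside \<open>H\<close> is
  independent modulo \<open>H\<close>.
\<close>

lemma card_generate_insert_prime: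
  assumes H: "subgroup H G" and y: "y \<in> carrier G" "y \<notin> H" and p: "prime p" "y [^] (p::nat) \<in> H"
  shows "card (generate G (insert y H)) = p * card H"
proof -
  have "indep_mod G p H (\<lambda>_::unit. y) {()}"
    unfolding indep_mod_def
  proof (intro ballI impI)
    fix c and j :: unit assume c: "c \<in> (\<Pi>\<^sub>E j\<in>{()}. {..<p})" "word G (\<lambda>_. y) {()} c \<in> H"
    have yc: "y [^] c () \<in> H" using c(2) y by (simp add: word_def)
    show "c j = 0"
    proof (rule ccontr)
      assume "c j \<noteq> 0"
      then have c0: "c () \<noteq> 0" by simp
      have "c () < p" using c(1) by auto
      with c0 have "coprime (c ()) p" using p(1)
        by (metis coprime_commute nat_dvd_not_less not_gr_zero prime_imp_coprime_nat)
      then obtain a b where ab: "c () * a = p * b + 1"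
        using c0 by (metis coprime_bezout_strong gcd_nat.extremum p(1) not_prime_1 coprime_1_right prime_nat_iff)
      have "y [^] (c () * a) \<in> H" using pow_in_subgroup[OF H yc, of a] y(1) by (simp add: nat_pow_pow)
      moreover have "y [^] (p * b) \<in> H" using pow_in_subgroup[OF H p(2), of b] y(1) by (simp add: nat_pow_pow)
      ultimately show False using ab H y subgroup_cancel[of H "y [^] (p * b)" y] by simp
    qed
  qed
  then have "card (generate G (H \<union> (\<lambda>_. y) ` {()})) = p ^ card {()} * card H"
    using y p prime_gt_0_nat by (intro card_generate_Un_eq H) auto
  then show ?thesis by simp
qed

end

section \<open>Counting generating families\<close>

definition euler_prod :: "nat \<Rightarrow> nat \<Rightarrow> real" where
  "euler_prod p m = (\<Prod>i<m. 1 - 1 / real p ^ Suc i)"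

lemma euler_prod_pos: "1 < p \<Longrightarrow> 0 < euler_prod p m"
  unfolding euler_prod_def
proof (intro prod_pos)
  fix i assume "1 < p"
  then have "1 < real p ^ Suc i" by (intro one_less_power) auto
  then show "0 < 1 - 1 / real p ^ Suc i" by simp
qed

context comm_group
begin

lemma generate_generate_Un:
  assumes "A \<subseteq> carrier G" "B \<subseteq> carrier G"
  shows "generate G (generate G A \<union> B) = generate G (A \<union> B)"
proof
  have sub: "subgroup (generate G (A \<union> B)) G" using assms by (intro generate_is_subgroup) auto
  have "generate G A \<subseteq> generate G (A \<union> B)" by (rule mono_generate) auto
  moreover have "B \<subseteq> generate G (A \<union> B)" by (auto intro: generate.incl)
  ultimately show "generate G (generate G A \<union> B) \<subseteq> generate G (A \<union> B)"
    by (intro generate_subgroup_incl[OF _ sub]) auto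
  show "generate G (A \<union> B) \<subseteq> generate G (generate G A \<union> B)"
    by (rule mono_generate) (auto intro: generate.incl)
qed

definition completions :: "'a set \<Rightarrow> 'a set \<Rightarrow> ('i \<Rightarrow> 'a set) \<Rightarrow> 'i set \<Rightarrow> ('i \<Rightarrow> 'a) set" where
  "completions K H U J = {Y \<in> \<Pi>\<^sub>E j\<in>J. U j. generate G (H \<union> Y ` J) = K}"

lemma finite_completions: "finite J \<Longrightarrow> (\<And>j. j \<in> J \<Longrightarrow> finite (U j)) \<Longrightarrow> finite (completions K H U J)"
  unfolding completions_def by (intro finite_Collect_conjI disjI1 finite_PiE[unfolded PiE_iff] ) (auto simp: finite_PiE)

lemma card_completions_insert:
  assumes J: "finite J" "j \<notin> J" and H: "H \<subseteq> carrier G"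
    and U: "\<And>i. i \<in> insert j J \<Longrightarrow> U i \<subseteq> carrier G \<and> finite (U i)"
  shows "card (completions K H U (insert j J)) = (\<Sum>y\<in>U j. card (completions K (generate G (insert y H)) U J))"
proof -
  have gen: "generate G (generate G (insert y H) \<union> Y ` J) = generate G (H \<union> (Y(j := y)) ` insert j J)"
    if "y \<in> U j" "Y \<in> (\<Pi>\<^sub>E i\<in>J. U i)" for y Y
  proof -
    have "Y ` J \<subseteq> carrier G" using that U by (force simp: PiE_iff)
    moreover have "y \<in> carrier G" using that U by auto
    ultimately have "generate G (generate G (insert y H) \<union> Y ` J) = generate G (insert y H \<union> Y ` J)"
      using H by (intro generate_generate_Un) auto
    also have "insert y H \<union> Y ` J = H \<union> (Y(j := y)) ` insert j J" using J(2) by auto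
    finally show ?thesis .
  qed
  have "bij_betw (\<lambda>(y, Y). Y(j := y)) (SIGMA y:U j. completions K (generate G (insert y H)) U J)
          (completions K H U (insert j J))"
  proof (rule bij_betw_byWitness[where f' = "\<lambda>Y. (Y j, Y(j := undefined))"])
    show "\<forall>a\<in>SIGMA y:U j. completions K (generate G (insert y H)) U J.
            (\<lambda>Y. (Y j, Y(j := undefined))) ((\<lambda>(y, Y). Y(j := y)) a) = a"
      using J(2) by (auto simp: completions_def PiE_iff extensional_def fun_eq_iff)
    show "\<forall>Y\<in>completions K H U (insert j J). (\<lambda>(y, Y). Y(j := y)) (Y j, Y(j := undefined)) = Y"
      by auto
    show "(\<lambda>(y, Y). Y(j := y)) ` (SIGMA y:U j. completions K (generate G (insert y H)) U J)
            \<subseteq> completions K H U (insert j J)"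
    proof clarify
      fix y Y assume y: "y \<in> U j" and Y: "Y \<in> completions K (generate G (insert y H)) U J"
      then have "Y(j := y) \<in> (\<Pi>\<^sub>E i\<in>insert j J. U i)"
        and "generate G (generate G (insert y H) \<union> Y ` J) = K"
        using PiE_fun_upd[of y U j Y J] unfolding completions_def by blast+
      moreover have "Y \<in> (\<Pi>\<^sub>E i\<in>J. U i)" using Y unfolding completions_def by blast
      ultimately have "Y(j := y) \<in> (\<Pi>\<^sub>E i\<in>insert j J. U i)" "generate G (H \<union> (Y(j := y)) ` insert j J) = K"
        using gen[OF y, of Y] by (simp_all only:)
      then show "Y(j := y) \<in> completions K H U (insert j J)"
        unfolding completions_def by blast
    qed
    show "(\<lambda>Y. (Y j, Y(j := undefined))) ` completions K H U (insert j J)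
            \<subseteq> (SIGMA y:U j. completions K (generate G (insert y H)) U J)"
    proof clarify
      fix Y assume Y: "Y \<in> completions K H U (insert j J)"
      then have "Y j \<in> U j" "Y(j := undefined) \<in> (\<Pi>\<^sub>E i\<in>J. U i)"
        using J(2) by (auto simp: completions_def PiE_iff extensional_def)
      with gen[OF this] Y show "Y j \<in> U j \<and> Y(j := undefined) \<in> completions K (generate G (insert (Y j) H)) U J"
        unfolding completions_def by (simp add: insert_absorb fun_upd_idem)
    qed
  qed
  from bij_betw_same_card[OF this] show ?thesis
    using U J(1) finite_completions[of J U] by (simp add: card_SigmaI)
qed

text \<open>
  Each new generator enlarges a subgroup at most by the factor \<open>p\<close>.
\<close>

lemma completions_empty_of_large_index:
  assumes p: "0 < p" and J: "finite J" and H: "subgroup H G" "finite H"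
    and U: "\<And>j. j \<in> J \<Longrightarrow> U j \<subseteq> K" and K: "K \<subseteq> carrier G" "\<And>x. x \<in> K \<Longrightarrow> x [^] (p::nat) \<in> H"
    and idx: "p ^ card J * card H < card K"
  shows "completions K H U J = {}"
proof -
  have False if Y: "Y \<in> completions K H U J" for Y
  proof -
    have YK: "Y j \<in> K" if "j \<in> J" for j using Y U that by (auto simp: completions_def)
    then have "card (generate G (H \<union> Y ` J)) \<le> p ^ card J * card H"
      using assms by (intro card_generate_Un_le) auto
    with idx Y show False by (auto simp: completions_def)
  qed
  then show ?thesis by auto
qed

text \<open>
  The multiplication map from \<open>U \<times> H\<close> to \<open>K\<close> has fibres of at most \<open>card (U \<inter> H)\<close> elements.
\<close>

lemma card_mult_le_index:
  assumes K: "subgroup K G" "finite K" and U: "subgroup U G" "U \<subseteq> K" and H: "subgroup H G" "H \<subseteq> K"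
  shows "card U * card H \<le> card K * card (U \<inter> H)"
proof -
  have sub: "U \<subseteq> carrier G" "H \<subseteq> carrier G" using U(1) H(1) by (auto dest: subgroup.subset)
  have fin: "finite U" "finite H" using U H K finite_subset by auto
  let ?f = "\<lambda>(u, h). u \<otimes> h"
  have fK: "?f ` (U \<times> H) \<subseteq> K" using U H subgroup.m_closed[OF K(1)] by auto
  have "card (U \<times> H) = (\<Sum>y\<in>?f ` (U \<times> H). card {x \<in> U \<times> H. ?f x = y})"
    using sum.image_gen[of "U \<times> H" "\<lambda>_. 1 :: nat" ?f] fin by simp
  also have "\<dots> \<le> (\<Sum>y\<in>?f ` (U \<times> H). card (U \<inter> H))"
  proof (rule sum_mono)
    fix y assume "y \<in> ?f ` (U \<times> H)"
    then obtain u h where uh: "u \<in> U" "h \<in> H" "y = u \<otimes> h" by auto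
    have "{x \<in> U \<times> H. ?f x = y} \<subseteq> (\<lambda>z. (u \<otimes> z, inv z \<otimes> h)) ` (U \<inter> H)"
    proof
      fix x assume "x \<in> {x \<in> U \<times> H. ?f x = y}"
      then obtain u' h' where x: "x = (u', h')" and *: "u' \<in> U" "h' \<in> H" "u' \<otimes> h' = y" by auto
      let ?z = "inv u \<otimes> u'"
      have c: "u \<in> carrier G" "u' \<in> carrier G" "h \<in> carrier G" "h' \<in> carrier G" using uh * sub by auto
      have "?z \<otimes> h' = inv u \<otimes> (u \<otimes> h)" using c * uh by (simp add: m_assoc)
      then have h: "h = ?z \<otimes> h'" using c by (simp add: m_assoc[symmetric])
      then have z: "?z = h \<otimes> inv h'" using c by (simp add: m_assoc[of _ h'])
      have "?z \<in> U" using uh * U(1) by (simp add: subgroup.m_closed subgroup.m_inv_closed)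
      moreover have "?z \<in> H" unfolding z using uh * H(1) by (simp add: subgroup.m_closed subgroup.m_inv_closed)
      moreover have "u' = u \<otimes> ?z" using c by (simp add: m_assoc[symmetric])
      moreover have "h' = inv ?z \<otimes> h"
      proof -
        have "h' = inv z \<otimes> h" if "h = z \<otimes> h'" "z \<in> carrier G" for z
          using that c by (simp add: m_assoc[symmetric])
        with h c show ?thesis by blast
      qed
      ultimately show "x \<in> (\<lambda>z. (u \<otimes> z, inv z \<otimes> h)) ` (U \<inter> H)"
        unfolding x by (intro image_eqI[of _ _ ?z]) auto
    qed
    then show "card {x \<in> U \<times> H. ?f x = y} \<le> card (U \<inter> H)"
      using fin by (meson card_image_le card_mono finite_Int finite_imageI le_trans)
  qed
  also have "\<dots> \<le> card K * card (U \<inter> H)"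
    using card_mono[OF K(2) fK] by simp
  finally show ?thesis by (simp add: card_cartesian_product)
qed

lemma generate_insert_index:
  assumes p: "prime p" and K: "subgroup K G"
    and H: "subgroup H G" "H \<subseteq> K" "\<And>x. x \<in> K \<Longrightarrow> x [^] (p::nat) \<in> H"
    and idx: "card K = p ^ Suc m * card H" and y: "y \<in> K" "y \<notin> H"
  shows "subgroup (generate G (insert y H)) G" "generate G (insert y H) \<subseteq> K"
    "\<And>x. x \<in> K \<Longrightarrow> x [^] p \<in> generate G (insert y H)"
    "card K = p ^ m * card (generate G (insert y H))"
proof -
  have Kc: "K \<subseteq> carrier G" using K by (rule subgroup.subset)
  have ins: "insert y H \<subseteq> K" using y H(2) by auto
  show "subgroup (generate G (insert y H)) G" using ins Kc by (intro generate_is_subgroup) auto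
  show "generate G (insert y H) \<subseteq> K" using ins K by (rule generate_subgroup_incl)
  show "x [^] p \<in> generate G (insert y H)" if "x \<in> K" for x
    using H(3)[OF that] by (auto intro: generate.incl)
  have "card (generate G (insert y H)) = p * card H"
    using y Kc H by (intro card_generate_insert_prime p) auto
  then show "card K = p ^ m * card (generate G (insert y H))" using idx by simp
qed

text \<open>
  A generator inside \<open>H\<close> is wasted: the remaining ones are too few to bridge the index \<open>p ^ Suc (card J)\<close>.
\<close>

lemma card_completions_step:
  assumes p: "prime p" and fin: "finite K" and K: "subgroup K G" and J: "finite J" "j \<notin> J"
    and U: "\<And>i. i \<in> insert j J \<Longrightarrow> U i \<subseteq> K"
    and H: "subgroup H G" "H \<subseteq> K" "\<And>x. x \<in> K \<Longrightarrow> x [^] (p::nat) \<in> H"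
    and idx: "card K = p ^ Suc (card J) * card H"
  shows "card (completions K H U (insert j J)) =
    (\<Sum>y\<in>U j - H. card (completions K (generate G (insert y H)) U J))"
proof -
  have Kc: "K \<subseteq> carrier G" using K by (rule subgroup.subset)
  have p1: "1 < p" using p prime_gt_1_nat by auto
  have finH: "finite H" using H(2) fin by (rule finite_subset)
  have cH: "0 < card H" using finH subgroup.one_closed[OF H(1)] by (auto simp: card_gt_0_iff)
  have U': "\<And>i. i \<in> insert j J \<Longrightarrow> U i \<subseteq> carrier G \<and> finite (U i)"
    using U fin finite_subset Kc by blast
  have "completions K (generate G (insert y H)) U J = {}" if "y \<in> H" for y
  proof -
    have "generate G (insert y H) = H" using that H(1)
      by (metis generateI insert_absorb order_refl)
    moreover have "completions K H U J = {}" using J U H finH cH p1 Kc idx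
      by (intro completions_empty_of_large_index[of p]) auto
    ultimately show ?thesis by simp
  qed
  then have "(\<Sum>y\<in>U j. card (completions K (generate G (insert y H)) U J)) =
      (\<Sum>y\<in>U j - H. card (completions K (generate G (insert y H)) U J))"
    using U'[of j] by (intro sum.mono_neutral_right) auto
  moreover have "card (completions K H U (insert j J)) =
      (\<Sum>y\<in>U j. card (completions K (generate G (insert y H)) U J))"
    using H(2) Kc by (intro card_completions_insert[OF J _ U']) auto
  ultimately show ?thesis by simp
qed

text \<open>
  When \<open>i\<close> generators are still to be chosen, the subgroup reached so far has index \<open>p\<^sup>i\<close> in \<open>K\<close>, so it contains at
  least the proportion \<open>p\<^sup>-\<^sup>i\<close> of any subgroup \<open>U j\<close>, and the next generator has to avoid it.
\<close>

lemma card_completions_le: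
  assumes p: "prime p" and fin: "finite K" and K: "subgroup K G" and J: "finite J"
    and U: "\<And>j. j \<in> J \<Longrightarrow> subgroup (U j) G \<and> U j \<subseteq> K"
    and H: "subgroup H G" "H \<subseteq> K" "\<And>x. x \<in> K \<Longrightarrow> x [^] (p::nat) \<in> H"
    and idx: "card K = p ^ card J * card H"
  shows "real (card (completions K H U J)) \<le> (\<Prod>j\<in>J. real (card (U j))) * euler_prod p (card J)"
  using J U H idx
proof (induction J arbitrary: H rule: finite_induct)
  case empty
  have "completions K H U {} \<subseteq> {\<lambda>_. undefined}" by (auto simp: completions_def)
  then have "card (completions K H U {}) \<le> 1"
    using card_mono[of "{\<lambda>_. undefined}" "completions K H U {}"] by simp
  then show ?case by (simp add: euler_prod_def)
next
  case (insert j J)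
  let ?q = "1 - 1 / real p ^ Suc (card J)"
  let ?P = "(\<Prod>j\<in>J. real (card (U j))) * euler_prod p (card J)"
  have p1: "1 < p" using p prime_gt_1_nat by auto
  have cH: "0 < card H"
    using insert.prems(2,3) fin subgroup.one_closed[of H G] finite_subset[of H K] by (auto simp: card_gt_0_iff)
  have idx: "card K = p ^ Suc (card J) * card H" using insert.prems(5) insert.hyps by simp
  have Uj: "subgroup (U j) G" "U j \<subseteq> K" "finite (U j)"
    using insert.prems(1)[of j] fin finite_subset[of "U j" K] by auto
  have P0: "0 \<le> ?P" using p1 euler_prod_pos[of p "card J"]
    by (intro mult_nonneg_nonneg prod_nonneg) auto
  have "real (card (completions K H U (insert j J))) =
      (\<Sum>y\<in>U j - H. real (card (completions K (generate G (insert y H)) U J)))"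
    using insert.prems(1) by (subst card_completions_step[OF p fin K insert.hyps _ insert.prems(2-4) idx]) auto
  also have "\<dots> \<le> (\<Sum>y\<in>U j - H. ?P)"
  proof (rule sum_mono)
    fix y assume "y \<in> U j - H"
    then have y: "y \<in> K" "y \<notin> H" using Uj by auto
    show "real (card (completions K (generate G (insert y H)) U J)) \<le> ?P"
      using insert.prems(1) generate_insert_index[OF p K insert.prems(2-4) idx y] by (intro insert.IH) auto
  qed
  also have "\<dots> = real (card (U j - H)) * ?P" by simp
  also have "\<dots> \<le> (real (card (U j)) * ?q) * ?P"
  proof (rule mult_right_mono[OF _ P0])
    have "card (U j) * card H \<le> card K * card (U j \<inter> H)"
      using fin K Uj insert.prems by (intro card_mult_le_index) auto
    then have "card (U j) \<le> p ^ Suc (card J) * card (U j \<inter> H)" using cH idx by simp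
    then have "real (card (U j)) \<le> real p ^ Suc (card J) * real (card (U j \<inter> H))"
      by (metis of_nat_le_iff of_nat_mult of_nat_power)
    then have "real (card (U j)) / real p ^ Suc (card J) \<le> real (card (U j \<inter> H))"
      using p1 by (simp add: divide_le_eq mult.commute)
    moreover have "card (U j - H) = card (U j) - card (U j \<inter> H)" "card (U j \<inter> H) \<le> card (U j)"
      using Uj by (auto simp: card_Diff_subset_Int intro: card_mono)
    ultimately show "real (card (U j - H)) \<le> real (card (U j)) * ?q" by (simp add: algebra_simps)
  qed
  also have "\<dots> = (\<Prod>j\<in>insert j J. real (card (U j))) * euler_prod p (card (insert j J))"
    using insert.hyps by (simp add: euler_prod_def)
  finally show ?case .
qed

text \<open>
  If the generators range over all of \<open>K\<close>, then the proportion to be avoided is exactly \<open>p\<^sup>-\<^sup>i\<close> at each step.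
\<close>

lemma card_completions_eq:
  assumes p: "prime p" and fin: "finite K" and K: "subgroup K G" and J: "finite (J :: 'i set)"
    and H: "subgroup H G" "H \<subseteq> K" "\<And>x. x \<in> K \<Longrightarrow> x [^] (p::nat) \<in> H"
    and idx: "card K = p ^ card J * card H"
  shows "real (card (completions K H (\<lambda>_. K) J)) = real (card K) ^ card J * euler_prod p (card J)"
  using J H idx
proof (induction J arbitrary: H rule: finite_induct)
  case empty
  have "H = K" using empty fin by (intro card_subset_eq) auto
  then have "generate G H = K" using K by (metis generateI order_refl)
  then have "completions K H (\<lambda>_. K) ({} :: 'i set) = {\<lambda>_. undefined}" by (auto simp: completions_def)
  then show ?case by (simp add: euler_prod_def)
next
  case (insert j J)
  let ?P = "real (card K) ^ card J * euler_prod p (card J)"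
  have p1: "1 < p" using p prime_gt_1_nat by auto
  have idx: "card K = p ^ Suc (card J) * card H" using insert.prems(4) insert.hyps by simp
  have "real (card (completions K H (\<lambda>_. K) (insert j J))) =
      (\<Sum>y\<in>K - H. real (card (completions K (generate G (insert y H)) (\<lambda>_. K) J)))"
    by (subst card_completions_step[OF p fin K insert.hyps _ insert.prems(1-3) idx]) auto
  also have "\<dots> = (\<Sum>y\<in>K - H. ?P)"
  proof (rule sum.cong[OF refl])
    fix y assume "y \<in> K - H"
    then have y: "y \<in> K" "y \<notin> H" by auto
    show "real (card (completions K (generate G (insert y H)) (\<lambda>_. K) J)) = ?P"
      using generate_insert_index[OF p K insert.prems(1-3) idx y] by (rule insert.IH)
  qed
  also have "\<dots> = real (card (K - H)) * ?P" by simp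
  also have "real (card (K - H)) = real (card K) * (1 - 1 / real p ^ Suc (card J))"
  proof -
    have "card (K - H) = card K - card H" "card H \<le> card K"
      using insert.prems(2) fin finite_subset[of H K] by (auto simp: card_Diff_subset intro: card_mono)
    moreover have "real (card K) = real p ^ Suc (card J) * real (card H)" using idx by simp
    ultimately show ?thesis using p1 by (simp add: field_simps)
  qed
  finally show ?case using insert.hyps by (simp add: euler_prod_def)
qed

end

section \<open>Homomorphisms out of finite abelian groups\<close>

context comm_group
begin

lemma subgroup_powers:
  assumes "subgroup K G"
  shows "subgroup (powers G p K) G"
proof -
  have "group_hom G G (\<lambda>x. x [^] p)"
    by unfold_locales (auto simp: hom_def nat_pow_distrib)
  then show ?thesis using assms by (rule group_hom.subgroup_img_is_subgroup)
qed

text \<open>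
  The fibres of the \<open>p\<close>-th power map on \<open>K\<close> are cosets of the \<open>p\<close>-torsion.
\<close>

lemma card_eq_torsion_times_powers:
  assumes K: "subgroup K G" "finite K" and T: "torsion G p \<subseteq> K"
  shows "card K = card (torsion G p) * card (powers G p K)"
proof -
  let ?f = "\<lambda>x. x [^] p" and ?T = "torsion G p"
  have Kc: "K \<subseteq> carrier G" using K(1) by (rule subgroup.subset)
  have "card K = (\<Sum>y\<in>?f ` K. card {x \<in> K. ?f x = y})"
    using sum.image_gen[of K "\<lambda>_. 1 :: nat" ?f] K by simp
  also have "\<dots> = (\<Sum>y\<in>?f ` K. card ?T)"
  proof (rule sum.cong[OF refl])
    fix y assume "y \<in> ?f ` K"
    then obtain x where x: "x \<in> K" "y = x [^] p" by auto
    have xc: "x \<in> carrier G" using x Kc by auto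
    have "{z \<in> K. ?f z = y} = (\<lambda>t. x \<otimes> t) ` ?T"
    proof (intro equalityI subsetI)
      fix z assume z: "z \<in> {z \<in> K. ?f z = y}"
      then have zc: "z \<in> carrier G" using Kc by auto
      have "(inv x \<otimes> z) [^] p = \<one>" using z x zc xc by (simp add: nat_pow_distrib nat_pow_inv)
      moreover have "z = x \<otimes> (inv x \<otimes> z)" using zc xc by (simp add: m_assoc[symmetric])
      ultimately show "z \<in> (\<lambda>t. x \<otimes> t) ` ?T" using zc xc by blast
    next
      fix z assume "z \<in> (\<lambda>t. x \<otimes> t) ` ?T"
      then obtain t where t: "t \<in> ?T" "z = x \<otimes> t" by auto
      then have "z \<in> K" using T x subgroup.m_closed[OF K(1)] by auto
      then show "z \<in> {z \<in> K. ?f z = y}" using t x xc by (simp add: nat_pow_distrib)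
    qed
    moreover have "inj_on (\<lambda>t. x \<otimes> t) ?T" using xc by (auto intro: inj_onI)
    ultimately show "card {z \<in> K. ?f z = y} = card ?T" by (simp add: card_image)
  qed
  finally show ?thesis by (simp add: mult.commute)
qed

text \<open>
  This is a Frattini argument: inserting \<open>K = K\<^sup>p W\<close> into itself repeatedly shows that every element of \<open>K\<close> is
  a product of a \<open>p\<^sup>k\<close>-th power, which is trivial, and an element of \<open>W\<close>.
\<close>

lemma subgroup_eq_of_supplement_powers:
  assumes K: "subgroup K G" and W: "subgroup W G" "W \<subseteq> K"
    and gen: "K \<subseteq> generate G (powers G p K \<union> W)"
    and exp: "\<And>x. x \<in> K \<Longrightarrow> x [^] (p ^ k) = \<one>"
  shows "W = K"
proof -
  let ?P = "powers G p K"
  have Kc: "K \<subseteq> carrier G" and Wc: "W \<subseteq> carrier G" using K W subgroup.subset by auto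
  have P: "subgroup ?P G" using K by (rule subgroup_powers)
  have Pc: "?P \<subseteq> carrier G" using P by (rule subgroup.subset)
  have "?P \<union> W \<subseteq> ?P <#> W"
  proof
    fix x assume "x \<in> ?P \<union> W"
    then have "x = x \<otimes> \<one> \<and> x = \<one> \<otimes> x" "x \<in> ?P \<or> x \<in> W" using Pc Wc by auto
    then show "x \<in> ?P <#> W" unfolding set_mult_def
      using subgroup.one_closed[OF P] subgroup.one_closed[OF W(1)] by blast
  qed
  then have "generate G (?P \<union> W) \<subseteq> ?P <#> W"
    using mult_subgroups[OF P W(1)] by (intro generate_subgroup_incl) auto
  with gen have KPW: "K \<subseteq> ?P <#> W" by auto
  have "\<exists>y\<in>K. \<exists>w\<in>W. x = y [^] (p ^ j) \<otimes> w" if "x \<in> K" for x j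
  proof (induction j)
    case 0
    show ?case using that Kc subgroup.one_closed[OF W(1)] by (intro bexI[of _ x] bexI[of _ \<one>]) auto
  next
    case (Suc j)
    then obtain y w where yw: "y \<in> K" "w \<in> W" "x = y [^] (p ^ j) \<otimes> w" by auto
    obtain z w' where zw: "z \<in> K" "w' \<in> W" "y = z [^] p \<otimes> w'"
      using KPW yw(1) unfolding set_mult_def by blast
    have c: "z \<in> carrier G" "w' \<in> carrier G" "w \<in> carrier G" using zw yw Kc Wc by auto
    have "x = z [^] (p ^ Suc j) \<otimes> (w' [^] (p ^ j) \<otimes> w)"
      unfolding yw(3) zw(3) using c by (simp add: nat_pow_distrib nat_pow_pow m_assoc)
    moreover have "w' [^] (p ^ j) \<otimes> w \<in> W"
      using W(1) zw yw by (simp add: subgroup.m_closed pow_in_subgroup)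
    ultimately show ?case using zw(1) by blast
  qed
  from this[of _ k] have "K \<subseteq> W" using exp Wc by fastforce
  with W(2) show ?thesis by auto
qed

lemma word_reduce:
  assumes x: "x \<in> J \<rightarrow> carrier G" and xN: "\<forall>j\<in>J. x j [^] (N::nat) = \<one>"
  shows "word G x J c = word G x J (\<lambda>j\<in>J. c j mod N)"
proof -
  have "word G x J c = word G x J (\<lambda>j. c j mod N)"
    using word_mod[OF triv_subgroup x, of N c] xN word_closed[OF x] by auto
  also have "\<dots> = word G x J (\<lambda>j\<in>J. c j mod N)" by (rule word_cong[OF x]) auto
  finally show ?thesis .
qed

text \<open>
  By the assumption on the cardinality, the words in \<open>a\<close> with exponents below \<open>N\<close> are distinct, so \<open>a\<close> is a basis of a
  free module over \<open>\<int>/N\<close>.  The homomorphism maps a word in \<open>a\<close> to the word in \<open>g\<close> with the same exponents.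
\<close>

lemma free_hom_exists:
  fixes A (structure)
  assumes J: "finite J" and a: "a \<in> J \<rightarrow> carrier G" and N: "0 < (N::nat)"
    and gen: "generate G (a ` J) = carrier G" and card: "card (carrier G) = N ^ card J"
    and aN: "\<forall>j\<in>J. a j [^]\<^bsub>G\<^esub> N = \<one>\<^bsub>G\<^esub>"
    and A: "comm_group A" and g: "g \<in> J \<rightarrow> carrier A" and gN: "\<forall>j\<in>J. g j [^]\<^bsub>A\<^esub> N = \<one>\<^bsub>A\<^esub>"
  shows "\<exists>F\<in>hom G A. \<forall>j\<in>J. F (a j) = g j"
proof -
  interpret A: comm_group A by fact
  let ?C = "\<Pi>\<^sub>E j\<in>J. {..<N}" and ?red = "\<lambda>c. \<lambda>j\<in>J. c j mod N"
  have red: "?red c \<in> ?C" for c using N by auto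
  have wG: "word G a J c \<in> carrier G" for c using a by (rule word_closed)
  have ac: "a ` J \<subseteq> carrier G" using a by auto
  have "generate G ({\<one>\<^bsub>G\<^esub>} \<union> a ` J) = carrier G"
    using gen mono_generate[of "a ` J" "{\<one>\<^bsub>G\<^esub>} \<union> a ` J"] generate_incl[of "{\<one>\<^bsub>G\<^esub>} \<union> a ` J"] ac by auto
  then have "carrier G = (\<lambda>(h, c). h \<otimes>\<^bsub>G\<^esub> word G a J c) ` ({\<one>\<^bsub>G\<^esub>} \<times> ?C)"
    using generate_Un_eq_words[OF triv_subgroup J a N] aN by auto
  also have "\<dots> = word G a J ` ?C" using wG by (force simp: image_iff)
  finally have im: "word G a J ` ?C = carrier G" ..
  have "finite ?C" "card ?C = N ^ card J" using J by (auto simp: card_PiE intro: finite_PiE)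
  then have inj: "inj_on (word G a J) ?C" using im card by (intro eq_card_imp_inj_on) auto
  define F where "F x = word A g J (inv_into ?C (word G a J) x)" for x
  have F: "F (word G a J c) = word A g J c" for c
  proof -
    have "F (word G a J c) = F (word G a J (?red c))" using word_reduce[OF a aN] by simp
    also have "\<dots> = word A g J (?red c)" unfolding F_def using inj red by simp
    also have "\<dots> = word A g J c" using A.word_reduce[OF g gN] by simp
    finally show ?thesis .
  qed
  have "F \<in> hom G A"
  proof (rule homI)
    fix x assume "x \<in> carrier G"
    then obtain c where "x = word G a J c" using im by blast
    then show "F x \<in> carrier A" using F A.word_closed[OF g] by simp
  next
    fix x y assume "x \<in> carrier G" "y \<in> carrier G"
    then obtain c c' where xy: "x = word G a J c" "y = word G a J c'" using im by blast
    have "F (x \<otimes>\<^bsub>G\<^esub> y) = F (word G a J (\<lambda>j. c j + c' j))" unfolding xy word_add[OF a] ..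
    also have "\<dots> = F x \<otimes>\<^bsub>A\<^esub> F y" unfolding xy F A.word_add[OF g] ..
    finally show "F (x \<otimes>\<^bsub>G\<^esub> y) = F x \<otimes>\<^bsub>A\<^esub> F y" .
  qed
  moreover have "F (a j) = g j" if "j \<in> J" for j
    using F[of "\<lambda>i. if i = j then 1 else 0"] word_single[OF J that a] A.word_single[OF J that g] by simp
  ultimately show ?thesis by blast
qed

end

text \<open>
  Like the automorphisms in \<open>auto\<close>, the epimorphisms are made extensional so that they can be counted.
\<close>

definition epi_ext :: "('a, 'c) monoid_scheme \<Rightarrow> ('b, 'd) monoid_scheme \<Rightarrow> ('a \<Rightarrow> 'b) set" where
  "epi_ext G A = epi G A \<inter> extensional (carrier G)"

lemma (in group_hom) hom_eq_iff:
  assumes "x \<in> carrier G" "y \<in> carrier G"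
  shows "h x = h y \<longleftrightarrow> x \<otimes> inv y \<in> kernel G H h"
proof -
  have "x \<otimes> inv y \<in> kernel G H h \<longleftrightarrow> h x \<otimes>\<^bsub>H\<^esub> inv\<^bsub>H\<^esub> h y = \<one>\<^bsub>H\<^esub>"
    using assms by (simp add: kernel_def)
  also have "\<dots> \<longleftrightarrow> h x = h y" using assms by (metis H.inv_solve_right H.l_one hom_closed H.one_closed)
  finally show ?thesis ..
qed

context group
begin

lemma group_hom_of_epi_ext: "group A \<Longrightarrow> F \<in> epi_ext G A \<Longrightarrow> group_hom G A F"
  unfolding epi_ext_def epi_def by (auto intro!: group_hom.intro simp: group_hom_axioms_def is_group)

text \<open>
  Two epimorphisms with the same kernel differ by a unique automorphism of \<open>A\<close>.
\<close>

lemma card_epi_ext_kernel: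
  fixes A (structure)
  assumes W: "W \<lhd> G" and A: "group A"
  shows "card {F \<in> epi_ext G A. kernel G A F = W} = (if G Mod W \<cong> A then card (auto A) else 0)"
proof (cases "G Mod W \<cong> A")
  case False
  have "F \<notin> epi_ext G A" if "kernel G A F = W" for F
    using False that group_hom.FactGroup_iso[OF group_hom_of_epi_ext[OF A]]
    by (auto simp: epi_ext_def epi_def)
  then show ?thesis using False by (auto intro: card_eq_0_iff[THEN iffD2])
next
  case True
  interpret A: group A by fact
  interpret W: normal W G by fact
  obtain \<phi> where \<phi>: "\<phi> \<in> iso (G Mod W) A" using True by (auto simp: is_iso_def)
  have \<phi>h: "\<phi> \<in> hom (G Mod W) A" and \<phi>b: "bij_betw \<phi> (carrier (G Mod W)) (carrier A)"
    using \<phi> by (auto simp: iso_def)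
  define F0 where "F0 = restrict (\<lambda>x. \<phi> (W #>\<^bsub>G\<^esub> x)) (carrier G)"
  have F0h: "F0 \<in> hom G A"
    using hom_compose[OF W.r_coset_hom_Mod \<phi>h] unfolding F0_def hom_def by (auto simp: compose_def)
  have "F0 ` carrier G = \<phi> ` ((\<lambda>x. W #>\<^bsub>G\<^esub> x) ` carrier G)" unfolding F0_def by auto
  also have "(\<lambda>x. W #>\<^bsub>G\<^esub> x) ` carrier G = carrier (G Mod W)" by (auto simp: FactGroup_def RCOSETS_def)
  also have "\<phi> ` \<dots> = carrier A" using \<phi>b by (rule bij_betw_imp_surj_on)
  finally have F0s: "F0 ` carrier G = carrier A" .
  have F0: "F0 \<in> epi_ext G A" using F0h F0s by (auto simp: epi_ext_def epi_def F0_def)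
  interpret F0: group_hom G A F0 using A F0 by (rule group_hom_of_epi_ext)
  have one: "\<phi> W = \<one>\<^bsub>A\<^esub>"
    using hom_one[OF \<phi>h W.factorgroup_is_group A] by (simp add: FactGroup_def)
  have Wcos: "W \<in> carrier (G Mod W)"
    using monoid.one_closed[OF group.is_monoid[OF W.factorgroup_is_group]] by (simp add: FactGroup_def)
  have F0k: "kernel G A F0 = W"
  proof (intro equalityI subsetI)
    fix x assume x: "x \<in> kernel G A F0"
    then have xc: "x \<in> carrier G" and "\<phi> (W #>\<^bsub>G\<^esub> x) = \<phi> W" using one by (auto simp: kernel_def F0_def)
    moreover have "W #>\<^bsub>G\<^esub> x \<in> carrier (G Mod W)" using xc by (auto simp: FactGroup_def RCOSETS_def)
    ultimately have "W #>\<^bsub>G\<^esub> x = W" using \<phi>b Wcos by (auto simp: bij_betw_def dest: inj_onD)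
    then show "x \<in> W" using xc W.is_subgroup coset_join1[OF _ xc W.subgroup_axioms] W.subset by auto
  next
    fix x assume x: "x \<in> W"
    then have "x \<in> carrier G" "W #>\<^bsub>G\<^esub> x = W" using W.subset coset_join2 W.is_subgroup by auto
    then show "x \<in> kernel G A F0" using one by (auto simp: kernel_def F0_def)
  qed
  have "bij_betw (\<lambda>\<alpha>. compose (carrier G) \<alpha> F0) (auto A) {F \<in> epi_ext G A. kernel G A F = W}"
  proof (rule bij_betw_imageI)
    show "inj_on (\<lambda>\<alpha>. compose (carrier G) \<alpha> F0) (auto A)"
    proof (rule inj_onI)
      fix \<alpha> \<beta> assume ab: "\<alpha> \<in> auto A" "\<beta> \<in> auto A" "compose (carrier G) \<alpha> F0 = compose (carrier G) \<beta> F0"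
      show "\<alpha> = \<beta>"
      proof (rule extensionalityI)
        show "\<alpha> \<in> extensional (carrier A)" "\<beta> \<in> extensional (carrier A)"
          using ab by (auto simp: auto_def Bij_def)
        fix b assume "b \<in> carrier A"
        then obtain x where x: "x \<in> carrier G" "b = F0 x" using F0s by blast
        show "\<alpha> b = \<beta> b" using fun_cong[OF ab(3), of x] x by (simp add: compose_def)
      qed
    qed
    show "(\<lambda>\<alpha>. compose (carrier G) \<alpha> F0) ` auto A = {F \<in> epi_ext G A. kernel G A F = W}"
    proof (intro equalityI subsetI)
      fix F assume "F \<in> (\<lambda>\<alpha>. compose (carrier G) \<alpha> F0) ` auto A"
      then obtain \<alpha> where \<alpha>: "\<alpha> \<in> auto A" and F: "F = compose (carrier G) \<alpha> F0" by auto
      have ah: "\<alpha> \<in> hom A A" and ab: "bij_betw \<alpha> (carrier A) (carrier A)"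
        using \<alpha> by (auto simp: auto_def Bij_def)
      interpret \<alpha>: group_hom A A \<alpha> using ah by unfold_locales
      have "F \<in> hom G A" unfolding F using F0h ah by (rule hom_compose)
      moreover have "F ` carrier G = carrier A"
      proof -
        have "F ` carrier G = \<alpha> ` (F0 ` carrier G)" unfolding F by (auto simp: compose_def)
        also have "\<dots> = carrier A" unfolding F0s using ab by (rule bij_betw_imp_surj_on)
        finally show ?thesis .
      qed
      moreover have "kernel G A F = W"
      proof -
        have "\<alpha> b = \<one>\<^bsub>A\<^esub> \<longleftrightarrow> b = \<one>\<^bsub>A\<^esub>" if "b \<in> carrier A" for b
          using ab that by (metis A.one_closed \<alpha>.hom_one bij_betw_inv_into_left)
        then have "kernel G A F = kernel G A F0" unfolding F kernel_def by (auto simp: compose_def)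
        then show ?thesis using F0k by simp
      qed
      ultimately show "F \<in> {F \<in> epi_ext G A. kernel G A F = W}"
        unfolding epi_ext_def epi_def F by (auto simp: compose_def)
    next
      fix F assume "F \<in> {F \<in> epi_ext G A. kernel G A F = W}"
      then have F: "F \<in> epi_ext G A" and Fk: "kernel G A F = W" by auto
      interpret F: group_hom G A F using A F by (rule group_hom_of_epi_ext)
      have Fs: "F ` carrier G = carrier A" and Fe: "F \<in> extensional (carrier G)"
        using F by (auto simp: epi_ext_def epi_def)
      have eq: "F x = F y \<longleftrightarrow> F0 x = F0 y" if "x \<in> carrier G" "y \<in> carrier G" for x y
        using that F.hom_eq_iff F0.hom_eq_iff Fk F0k by simp
      define \<alpha> where "\<alpha> = restrict (\<lambda>b. F (inv_into (carrier G) F0 b)) (carrier A)"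
      have \<alpha>: "\<alpha> (F0 x) = F x" if "x \<in> carrier G" for x
      proof -
        have "inv_into (carrier G) F0 (F0 x) \<in> carrier G" "F0 (inv_into (carrier G) F0 (F0 x)) = F0 x"
          using that by (auto intro: inv_into_into f_inv_into_f)
        then show ?thesis unfolding \<alpha>_def using eq that by simp
      qed
      have "\<alpha> \<in> hom A A"
      proof (rule homI)
        fix b assume "b \<in> carrier A"
        then obtain x where x: "x \<in> carrier G" "b = F0 x" using F0s by blast
        then show "\<alpha> b \<in> carrier A" using \<alpha> by simp
      next
        fix b c assume "b \<in> carrier A" "c \<in> carrier A"
        then obtain x y where xy: "x \<in> carrier G" "b = F0 x" "y \<in> carrier G" "c = F0 y" using F0s by blast
        then have "\<alpha> (b \<otimes>\<^bsub>A\<^esub> c) = \<alpha> (F0 (x \<otimes>\<^bsub>G\<^esub> y))" by simp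
        also have "\<dots> = \<alpha> b \<otimes>\<^bsub>A\<^esub> \<alpha> c" using xy by (simp add: \<alpha> del: F0.hom_mult)
        finally show "\<alpha> (b \<otimes>\<^bsub>A\<^esub> c) = \<alpha> b \<otimes>\<^bsub>A\<^esub> \<alpha> c" .
      qed
      moreover have "bij_betw \<alpha> (carrier A) (carrier A)"
      proof (rule bij_betw_imageI)
        show "inj_on \<alpha> (carrier A)"
        proof (rule inj_onI)
          fix b c assume "b \<in> carrier A" "c \<in> carrier A" and e: "\<alpha> b = \<alpha> c"
          then obtain x y where xy: "x \<in> carrier G" "b = F0 x" "y \<in> carrier G" "c = F0 y" using F0s by blast
          then show "b = c" using e \<alpha> eq by simp
        qed
        have "\<alpha> ` carrier A = \<alpha> ` F0 ` carrier G" using F0s by simp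
        also have "\<dots> = F ` carrier G" using \<alpha> by (auto simp: image_iff)
        finally show "\<alpha> ` carrier A = carrier A" using Fs by simp
      qed
      ultimately have "\<alpha> \<in> auto A" by (auto simp: auto_def Bij_def \<alpha>_def)
      moreover have "F = compose (carrier G) \<alpha> F0"
        by (rule extensionalityI[OF Fe]) (auto simp: compose_def \<alpha>)
      ultimately show "F \<in> (\<lambda>\<alpha>. compose (carrier G) \<alpha> F0) ` auto A" by blast
    qed
  qed
  from bij_betw_same_card[OF this] True show ?thesis by simp
qed

end

section \<open>Quotients by random extensions of an independent family\<close>

definition gen_tuples :: "('a, 'c) monoid_scheme \<Rightarrow> 'b set \<Rightarrow> ('b \<Rightarrow> 'a) set" where
  "gen_tuples A J = {g \<in> \<Pi>\<^sub>E j\<in>J. carrier A. generate A (g ` J) = carrier A}"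

lemma gen_hom_eq:
  assumes "group_hom G A F" "group_hom G A F'" "X \<subseteq> carrier G" "\<And>x. x \<in> X \<Longrightarrow> F x = F' x"
    and "y \<in> generate G X"
  shows "F y = F' y"
proof -
  interpret F: group_hom G A F by fact
  interpret F': group_hom G A F' by fact
  have X: "\<And>x. x \<in> X \<Longrightarrow> x \<in> carrier G" using assms(3) by auto
  from assms(5) show ?thesis
  proof induction
    case (inv h)
    then show ?case using assms(4) X by simp
  next
    case (eng h1 h2)
    then show ?case using F.G.generate_in_carrier[OF assms(3)] by simp
  qed (auto simp: assms(4))
qed

context comm_group
begin

lemma indep_mod_mono: "indep_mod G M H x J \<Longrightarrow> H' \<subseteq> H \<Longrightarrow> indep_mod G M H' x J"
  unfolding indep_mod_def by blast

text \<open>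
  The assumptions on the group express that it behaves like \<open>(\<int>/p\<^sup>k)\<^sup>n\<close>.  The family \<open>S\<close> consists of the columns that are
  given, and \<open>Jf\<close> indexes the columns that are to be chosen freely.
\<close>

context
  fixes p k n :: nat and Js Jf :: "'i set" and S :: "'i \<Rightarrow> 'a"
  assumes p: "prime p" and k: "0 < k" and fin: "finite (carrier G)"
    and expo: "\<And>x. x \<in> carrier G \<Longrightarrow> x [^] (p ^ k) = \<one>"
    and card: "card (carrier G) = (p ^ k) ^ n"
    and torsion: "card (torsion G p) = p ^ n"
    and torsion_pow: "torsion G p \<subseteq> powers G (p ^ (k - 1)) (carrier G)"
    and Js: "finite Js" and Jf: "finite Jf" and disj: "Js \<inter> Jf = {}" and n: "card Js + card Jf = n"
    and S: "S \<in> Js \<rightarrow> carrier G"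
    and indep: "indep_mod G p (powers G p (carrier G)) S Js"
begin

text \<open>
  Since \<open>K\<close> contains the whole \<open>p\<close>-torsion, \<open>K/K\<^sup>p\<close> has order \<open>p\<^sup>n\<close>.  The family \<open>S\<close>, being independent modulo \<open>p\<close>-th
  powers of the whole group, is all the more independent modulo \<open>K\<^sup>p\<close>.  So \<open>K\<^sup>p\<close> and \<open>S\<close> together generate a subgroup of
  index \<open>p ^ card Jf\<close>, and \<open>K\<^sup>p\<close> may be omitted from the generators by the Frattini argument.
\<close>

lemma card_generating_extensions:
  assumes K: "subgroup K G" "torsion G p \<subseteq> K" "S ` Js \<subseteq> K"
  shows "real (card {Y \<in> \<Pi>\<^sub>E j\<in>Jf. K. generate G (S ` Js \<union> Y ` Jf) = K}) =
    real (card K) ^ card Jf * euler_prod p (card Jf)"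
proof -
  let ?P = "powers G p K"
  have p0: "0 < p" using p prime_gt_0_nat by auto
  have Kc: "K \<subseteq> carrier G" using K(1) by (rule subgroup.subset)
  have finK: "finite K" using Kc fin by (rule finite_subset)
  have P: "subgroup ?P G" using K(1) by (rule subgroup_powers)
  have PK: "?P \<subseteq> K" using pow_in_subgroup[OF K(1)] by auto
  let ?H = "generate G (?P \<union> S ` Js)"
  have PS: "?P \<union> S ` Js \<subseteq> K" using PK K(3) by auto
  have HK: "?H \<subseteq> K" using PS K(1) by (rule generate_subgroup_incl)
  have H: "subgroup ?H G" using PS Kc by (intro generate_is_subgroup) auto
  have "card ?H = p ^ card Js * card ?P"
  proof (rule card_generate_Un_eq[OF P Js S p0])
    show "\<forall>j\<in>Js. S j [^] p \<in> ?P" using K(3) by auto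
    show "indep_mod G p ?P S Js" using indep Kc by (auto intro: indep_mod_mono)
  qed
  moreover have "card K = p ^ n * card ?P"
    using card_eq_torsion_times_powers[OF K(1) finK K(2)] torsion by simp
  ultimately have idx: "card K = p ^ card Jf * card ?H" unfolding n[symmetric] by (simp add: power_add)
  have "{Y \<in> \<Pi>\<^sub>E j\<in>Jf. K. generate G (S ` Js \<union> Y ` Jf) = K} = completions K ?H (\<lambda>_. K) Jf"
    unfolding completions_def
  proof (intro Collect_cong conj_cong refl)
    fix Y assume Y: "Y \<in> (\<Pi>\<^sub>E j\<in>Jf. K)"
    then have YK: "Y ` Jf \<subseteq> K" by auto
    let ?W = "generate G (S ` Js \<union> Y ` Jf)"
    have SY: "S ` Js \<union> Y ` Jf \<subseteq> K" using YK K(3) by auto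
    have W: "subgroup ?W G" using SY Kc by (intro generate_is_subgroup) auto
    have WK: "?W \<subseteq> K" using SY K(1) by (rule generate_subgroup_incl)
    have e: "generate G (?H \<union> Y ` Jf) = generate G (?P \<union> S ` Js \<union> Y ` Jf)"
      using PS YK Kc by (intro generate_generate_Un) auto
    have le: "generate G (?P \<union> S ` Js \<union> Y ` Jf) \<subseteq> K" using PS YK K(1) by (intro generate_subgroup_incl) auto
    show "?W = K \<longleftrightarrow> generate G (?H \<union> Y ` Jf) = K"
    proof
      assume "?W = K"
      moreover have "?W \<subseteq> generate G (?P \<union> S ` Js \<union> Y ` Jf)" by (rule mono_generate) auto
      ultimately show "generate G (?H \<union> Y ` Jf) = K" using e le by auto
    next
      assume "generate G (?H \<union> Y ` Jf) = K"
      then have "K \<subseteq> generate G (?P \<union> S ` Js \<union> Y ` Jf)" using e by simp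
      also have "\<dots> \<subseteq> generate G (?P \<union> ?W)" by (rule mono_generate) (auto intro: generate.incl)
      finally have "K \<subseteq> generate G (?P \<union> ?W)" .
      then show "?W = K" using expo Kc by (intro subgroup_eq_of_supplement_powers[OF K(1) W WK, of p k]) auto
    qed
  qed
  moreover have "real (card (completions K ?H (\<lambda>_. K) Jf)) = real (card K) ^ card Jf * euler_prod p (card Jf)"
    using idx finK Jf H HK PS by (intro card_completions_eq p K) (auto intro: generate.incl)
  ultimately show ?thesis by simp
qed

text \<open>
  By the preceding lemma for the whole group, \<open>S\<close> can be completed to a basis by some family \<open>Y\<close>.  An epimorphism that
  vanishes on \<open>S\<close> is determined by its values on \<open>Y\<close>, which can be any family that generates \<open>A\<close>.
\<close>

lemma card_epi_ext_vanishing: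
  fixes A (structure)
  assumes A: "comm_group A" and AN: "\<And>g. g \<in> carrier A \<Longrightarrow> g [^]\<^bsub>A\<^esub> (p ^ k) = \<one>\<^bsub>A\<^esub>"
  shows "card {F \<in> epi_ext G A. \<forall>j\<in>Js. F (S j) = \<one>\<^bsub>A\<^esub>} = card (gen_tuples A Jf)"
proof -
  interpret A: comm_group A by fact
  have p0: "1 < p" using p prime_gt_1_nat by auto
  have "0 < real (card {Y \<in> \<Pi>\<^sub>E j\<in>Jf. carrier G. generate G (S ` Js \<union> Y ` Jf) = carrier G})"
  proof (subst card_generating_extensions)
    have "card (carrier G) > 0" using p0 card by simp
    then show "0 < real (card (carrier G)) ^ card Jf * euler_prod p (card Jf)"
      using euler_prod_pos[OF p0] by simp
  qed (use S subgroup_self in auto)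
  then obtain Y where Y: "Y \<in> (\<Pi>\<^sub>E j\<in>Jf. carrier G)" and gen: "generate G (S ` Js \<union> Y ` Jf) = carrier G"
    by (metis (mono_tags, lifting) card_eq_0_iff of_nat_0 less_irrefl equals0I mem_Collect_eq)
  have SYc: "S ` Js \<union> Y ` Jf \<subseteq> carrier G" using S Y by auto
  have Yc: "Y j \<in> carrier G" if "j \<in> Jf" for j using Y that by auto
  let ?E = "{F \<in> epi_ext G A. \<forall>j\<in>Js. F (S j) = \<one>\<^bsub>A\<^esub>}"
  have "bij_betw (\<lambda>F. \<lambda>j\<in>Jf. F (Y j)) ?E (gen_tuples A Jf)"
  proof (rule bij_betw_imageI)
    show "inj_on (\<lambda>F. \<lambda>j\<in>Jf. F (Y j)) ?E"
    proof (rule inj_onI)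
      fix F F' assume F: "F \<in> ?E" "F' \<in> ?E" and eq: "(\<lambda>j\<in>Jf. F (Y j)) = (\<lambda>j\<in>Jf. F' (Y j))"
      have h: "group_hom G A F" "group_hom G A F'"
        using F group_hom_of_epi_ext[OF A.is_group] by auto
      have "F (Y j) = F' (Y j)" if "j \<in> Jf" for j using fun_cong[OF eq, of j] that by simp
      then have "F z = F' z" if "z \<in> S ` Js \<union> Y ` Jf" for z using that F by auto
      then have "F x = F' x" if "x \<in> carrier G" for x
        using gen_hom_eq[OF h SYc, of x] that unfolding gen by blast
      then show "F = F'" using F
        by (intro extensionalityI[of F "carrier G"]) (auto simp: epi_ext_def)
    qed
    show "(\<lambda>F. \<lambda>j\<in>Jf. F (Y j)) ` ?E = gen_tuples A Jf"
    proof (intro equalityI subsetI)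
      fix g assume "g \<in> (\<lambda>F. \<lambda>j\<in>Jf. F (Y j)) ` ?E"
      then obtain F where F: "F \<in> epi_ext G A" "\<forall>j\<in>Js. F (S j) = \<one>\<^bsub>A\<^esub>" and g: "g = (\<lambda>j\<in>Jf. F (Y j))" by auto
      interpret F: group_hom G A F using F group_hom_of_epi_ext[OF A.is_group] by auto
      have gc: "g ` Jf \<subseteq> carrier A" unfolding g using Yc by auto
      have "carrier A = F ` generate G (S ` Js \<union> Y ` Jf)" using F gen by (auto simp: epi_ext_def epi_def)
      also have "\<dots> = generate A (F ` (S ` Js \<union> Y ` Jf))" using F.generate_img[OF SYc] by simp
      also have "\<dots> \<subseteq> generate A (g ` Jf)"
      proof (rule A.generate_subgroup_incl)
        show "subgroup (generate A (g ` Jf)) A" using gc by (rule A.generate_is_subgroup)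
        show "F ` (S ` Js \<union> Y ` Jf) \<subseteq> generate A (g ` Jf)"
          using F(2) by (auto simp: g intro: generate.one generate.incl)
      qed
      finally have "generate A (g ` Jf) = carrier A" using A.generate_incl[OF gc] by auto
      then show "g \<in> gen_tuples A Jf" using gc by (auto simp: gen_tuples_def g)
    next
      fix g assume g: "g \<in> gen_tuples A Jf"
      let ?a = "\<lambda>j. if j \<in> Js then S j else Y j" and ?g = "\<lambda>j. if j \<in> Js then \<one>\<^bsub>A\<^esub> else g j"
      have im: "?a ` (Js \<union> Jf) = S ` Js \<union> Y ` Jf" using disj by (auto simp: image_iff)
      have gA: "g j \<in> carrier A" if "j \<in> Jf" for j using g that by (auto simp: gen_tuples_def)
      have "\<exists>F\<in>hom G A. \<forall>j\<in>Js \<union> Jf. F (?a j) = ?g j"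
      proof (rule free_hom_exists)
        show "0 < p ^ k" using p0 by simp
        show "?a \<in> Js \<union> Jf \<rightarrow> carrier G" using S Yc by auto
        show "?g \<in> Js \<union> Jf \<rightarrow> carrier A" using gA by auto
        show "generate G (?a ` (Js \<union> Jf)) = carrier G" unfolding im by (rule gen)
        show "card (carrier G) = (p ^ k) ^ card (Js \<union> Jf)"
          using card n Js Jf disj by (simp add: card_Un_disjoint)
        show "\<forall>j\<in>Js \<union> Jf. ?a j [^] (p ^ k) = \<one>" using S Yc expo by auto
        show "\<forall>j\<in>Js \<union> Jf. ?g j [^]\<^bsub>A\<^esub> (p ^ k) = \<one>\<^bsub>A\<^esub>" using gA AN by auto
      qed (use Js Jf A in auto)
      then obtain F where F: "F \<in> hom G A" "\<And>j. j \<in> Js \<union> Jf \<Longrightarrow> F (?a j) = ?g j" by blast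
      have FS: "F (S j) = \<one>\<^bsub>A\<^esub>" if "j \<in> Js" for j using F(2)[of j] that by simp
      have FY: "F (Y j) = g j" if "j \<in> Jf" for j using F(2)[of j] that disj by (auto split: if_splits)
      interpret F: group_hom G A F using F(1) by unfold_locales
      have "carrier A = generate A (g ` Jf)" using g by (simp add: gen_tuples_def)
      also have "\<dots> \<subseteq> F ` carrier G"
        using FY Yc by (intro A.generate_subgroup_incl F.img_is_subgroup) (auto simp: FY[symmetric])
      finally have Fs: "F ` carrier G = carrier A" by auto
      let ?F = "restrict F (carrier G)"
      have "?F \<in> ?E" using F(1) Fs FS S by (auto simp: epi_ext_def epi_def hom_def)
      moreover have "g = (\<lambda>j\<in>Jf. ?F (Y j))"
        using g FY Yc by (intro extensionalityI[of _ Jf]) (auto simp: gen_tuples_def PiE_def)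
      ultimately show "g \<in> (\<lambda>F. \<lambda>j\<in>Jf. F (Y j)) ` ?E" by blast
    qed
  qed
  then show ?thesis by (rule bij_betw_same_card)
qed

text \<open>
  Count the pairs of a family \<open>Y\<close> and an epimorphism \<open>F\<close> onto \<open>A\<close> whose kernel is generated by \<open>S\<close> and \<open>Y\<close>.  A family
  \<open>Y\<close> with quotient \<open>A\<close> occurs in \<open>card (auto A)\<close> pairs.  An epimorphism occurs only if it vanishes on \<open>S\<close>, and then
  the number of its \<open>Y\<close> is known, because its kernel has index \<open>card (carrier A)\<close> and contains the \<open>p\<close>-torsion.
  The right-hand side does not involve \<open>S\<close>: all independent families give the same distribution.
\<close>

theorem card_extensions_with_quotient:
  fixes A (structure)
  assumes A: "comm_group A" and finA: "finite (carrier A)"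
    and AN: "\<And>g. g \<in> carrier A \<Longrightarrow> g [^]\<^bsub>A\<^esub> (p ^ (k - 1)) = \<one>\<^bsub>A\<^esub>"
  shows "real (card {Y \<in> \<Pi>\<^sub>E j\<in>Jf. carrier G. G Mod generate G (S ` Js \<union> Y ` Jf) \<cong> A}) * real (card (auto A)) =
    real (card (gen_tuples A Jf)) * (real (card (carrier G)) / real (card (carrier A))) ^ card Jf *
      euler_prod p (card Jf)"
proof -
  interpret A: comm_group A by fact
  let ?D = "\<Pi>\<^sub>E j\<in>Jf. carrier G" and ?W = "\<lambda>Y. generate G (S ` Js \<union> Y ` Jf)"
  let ?E = "{F \<in> epi_ext G A. \<forall>j\<in>Js. F (S j) = \<one>\<^bsub>A\<^esub>}"
  have finD: "finite ?D" using Jf fin by (intro finite_PiE) auto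
  have finE: "finite (epi_ext G A)"
  proof (rule finite_subset)
    show "epi_ext G A \<subseteq> (\<Pi>\<^sub>E x\<in>carrier G. carrier A)"
      by (auto simp: epi_ext_def epi_def hom_def PiE_def)
    show "finite (\<Pi>\<^sub>E x\<in>carrier G. carrier A)" using fin finA by (intro finite_PiE) auto
  qed
  have AN': "g [^]\<^bsub>A\<^esub> (p ^ k) = \<one>\<^bsub>A\<^esub>" if "g \<in> carrier A" for g
  proof -
    have "p ^ k = p ^ (k - 1) * p" using k by (metis Suc_diff_1 power_Suc2)
    then show ?thesis using AN[OF that] that by (simp add: A.nat_pow_pow[symmetric])
  qed
  have W: "?W Y \<lhd> G" if "Y \<in> ?D" for Y
  proof -
    have "subgroup (?W Y) G" using that S by (intro generate_is_subgroup) auto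
    then show ?thesis by (rule subgroup_imp_normal)
  qed
  have inner: "real (card {Y \<in> ?D. kernel G A F = ?W Y}) =
     (if F \<in> ?E then (real (card (carrier G)) / real (card (carrier A))) ^ card Jf * euler_prod p (card Jf) else 0)"
    if F: "F \<in> epi_ext G A" for F
  proof -
    interpret F: group_hom G A F using F group_hom_of_epi_ext[OF A.is_group] by auto
    have Fs: "F ` carrier G = carrier A" using F by (auto simp: epi_ext_def epi_def)
    let ?K = "kernel G A F"
    show ?thesis
    proof (cases "F \<in> ?E")
      case False
      then obtain j where j: "j \<in> Js" "F (S j) \<noteq> \<one>\<^bsub>A\<^esub>" using F by auto
      then have "S j \<notin> ?K" by (simp add: kernel_def)
      moreover have "S j \<in> ?W Y" for Y using j by (auto intro: generate.incl)
      ultimately have "{Y \<in> ?D. ?K = ?W Y} = {}" by blast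
      then show ?thesis using False by (simp only: card.empty of_nat_0 if_False)
    next
      case True
      have K: "subgroup ?K G" by (rule F.subgroup_kernel)
      have tors: "torsion G p \<subseteq> ?K"
      proof
        fix x assume x: "x \<in> torsion G p"
        then obtain y where y: "y \<in> carrier G" "x = y [^] (p ^ (k - 1))" using torsion_pow by blast
        then have "F x = F y [^]\<^bsub>A\<^esub> (p ^ (k - 1))" using F.hom_nat_pow by simp
        then show "x \<in> ?K" using AN y x by (simp add: kernel_def)
      qed
      have SK: "S ` Js \<subseteq> ?K" using True S by (auto simp: kernel_def)
      have "{Y \<in> ?D. ?K = ?W Y} = {Y \<in> \<Pi>\<^sub>E j\<in>Jf. ?K. ?W Y = ?K}"
      proof (intro equalityI subsetI)
        fix Y assume Y: "Y \<in> {Y \<in> ?D. ?K = ?W Y}"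
        then have "Y j \<in> ?K" if "j \<in> Jf" for j using that by (auto intro: generate.incl)
        then show "Y \<in> {Y \<in> \<Pi>\<^sub>E j\<in>Jf. ?K. ?W Y = ?K}" using Y by (auto simp: PiE_iff)
      next
        fix Y assume "Y \<in> {Y \<in> \<Pi>\<^sub>E j\<in>Jf. ?K. ?W Y = ?K}"
        then show "Y \<in> {Y \<in> ?D. ?K = ?W Y}" using subgroup.subset[OF K] by (auto simp: PiE_iff)
      qed
      then have "real (card {Y \<in> ?D. ?K = ?W Y}) = real (card ?K) ^ card Jf * euler_prod p (card Jf)"
        using card_generating_extensions[OF K tors SK] by simp
      moreover have "real (card ?K) = real (card (carrier G)) / real (card (carrier A))"
      proof -
        have "card (rcosets ?K) = card (carrier A)"
          using bij_betw_same_card[of _ "carrier (G Mod ?K)" "carrier A"] F.FactGroup_iso_set[OF Fs]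
          by (auto simp: iso_def FactGroup_def)
        then have "card (carrier A) * card ?K = card (carrier G)"
          using lagrange[OF K] by (simp add: order_def)
        moreover have "card (carrier A) > 0" using finA A.one_closed by (auto simp: card_gt_0_iff)
        ultimately show ?thesis by (simp add: field_simps flip: of_nat_mult)
      qed
      ultimately show ?thesis using True by simp
    qed
  qed
  have "real (card {Y \<in> ?D. G Mod ?W Y \<cong> A}) * real (card (auto A)) =
      (\<Sum>Y\<in>?D. if G Mod ?W Y \<cong> A then real (card (auto A)) else 0)"
    using finD by (simp flip: sum.inter_filter)
  also have "\<dots> = (\<Sum>Y\<in>?D. real (card {F \<in> epi_ext G A. kernel G A F = ?W Y}))"
    by (intro sum.cong refl) (simp add: card_epi_ext_kernel[OF W A.is_group])
  also have "\<dots> = (\<Sum>Y\<in>?D. \<Sum>F\<in>epi_ext G A. if kernel G A F = ?W Y then 1 else 0)"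
    using finE by (simp flip: sum.inter_filter)
  also have "\<dots> = (\<Sum>F\<in>epi_ext G A. \<Sum>Y\<in>?D. if kernel G A F = ?W Y then 1 else 0)"
    by (rule sum.swap)
  also have "\<dots> = (\<Sum>F\<in>epi_ext G A. real (card {Y \<in> ?D. kernel G A F = ?W Y}))"
    using finD by (simp flip: sum.inter_filter)
  also have "\<dots> = (\<Sum>F\<in>epi_ext G A. if F \<in> ?E then
        (real (card (carrier G)) / real (card (carrier A))) ^ card Jf * euler_prod p (card Jf) else 0)"
    by (intro sum.cong refl inner)
  also have "\<dots> = (\<Sum>F\<in>?E. (real (card (carrier G)) / real (card (carrier A))) ^ card Jf * euler_prod p (card Jf))"
    using finE by (intro sum.mono_neutral_cong_right) auto
  also have "\<dots> = real (card ?E) * ((real (card (carrier G)) / real (card (carrier A))) ^ card Jf * euler_prod p (card Jf))"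
    by simp
  also have "card ?E = card (gen_tuples A Jf)" using A AN' by (rule card_epi_ext_vanishing)
  finally show ?thesis by (simp add: mult.assoc)
qed

end

end

text \<open>
  A family that does not generate lies in one of at most \<open>2 ^ card (carrier G)\<close> proper subgroups, each of index at least \<open>2\<close>.
\<close>

lemma (in group) gen_tuples_fraction:
  assumes fin: "finite (carrier G)" and J: "finite J"
  shows "\<bar>1 - real (card (gen_tuples G J)) / real (card (carrier G)) ^ card J\<bar> \<le>
     2 ^ card (carrier G) * (1 / 2) ^ card J"
proof -
  let ?D = "\<Pi>\<^sub>E j\<in>J. carrier G" and ?W = "{W. subgroup W G \<and> W \<noteq> carrier G}" and ?q = "real (card (carrier G))"
  have q0: "?q > 0" using fin by (auto simp: card_gt_0_iff)
  have finD: "finite ?D" using fin J by (intro finite_PiE) auto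
  have cD: "real (card ?D) = ?q ^ card J" using J by (simp add: card_PiE)
  have Wsub: "?W \<subseteq> Pow (carrier G)" by (auto dest: subgroup.subset)
  then have finW: "finite ?W" using fin by (auto intro: finite_subset)
  have gsub: "gen_tuples G J \<subseteq> ?D" by (auto simp: gen_tuples_def)
  have "?D - gen_tuples G J \<subseteq> (\<Union>W\<in>?W. \<Pi>\<^sub>E j\<in>J. W)"
  proof
    fix g assume g: "g \<in> ?D - gen_tuples G J"
    then have gc: "g ` J \<subseteq> carrier G" by auto
    have "generate G (g ` J) \<in> ?W" using g generate_is_subgroup[OF gc] by (auto simp: gen_tuples_def)
    moreover have "g \<in> (\<Pi>\<^sub>E j\<in>J. generate G (g ` J))" using g by (auto simp: PiE_iff intro: generate.incl)
    ultimately show "g \<in> (\<Union>W\<in>?W. \<Pi>\<^sub>E j\<in>J. W)" by blast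
  qed
  then have "card (?D - gen_tuples G J) \<le> card (\<Union>W\<in>?W. \<Pi>\<^sub>E j\<in>J. W)"
  proof (intro card_mono finite_UN_I finW)
    fix W assume "W \<in> ?W"
    then have "finite W" using Wsub fin finite_subset by blast
    then show "finite (\<Pi>\<^sub>E j\<in>J. W)" using J by (intro finite_PiE) auto
  qed
  also have "\<dots> \<le> (\<Sum>W\<in>?W. card (\<Pi>\<^sub>E j\<in>J. W))" using finW by (rule card_UN_le)
  finally have "real (card (?D - gen_tuples G J)) \<le> (\<Sum>W\<in>?W. real (card (\<Pi>\<^sub>E j\<in>J. W)))"
    unfolding of_nat_sum[symmetric] of_nat_le_iff .
  also have "\<dots> \<le> (\<Sum>W\<in>?W. (?q / 2) ^ card J)"
  proof (rule sum_mono)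
    fix W assume W: "W \<in> ?W"
    then have sub: "subgroup W G" "W \<subseteq> carrier G" "W \<noteq> carrier G" using Wsub by auto
    have l: "card (rcosets W) * card W = card (carrier G)" using lagrange[OF sub(1)] by (simp add: order_def)
    have "card W < card (carrier G)" using sub fin by (simp add: psubset_card_mono psubset_eq)
    then have "card (rcosets W) \<noteq> 0" "card (rcosets W) \<noteq> 1" using l by (intro notI; simp)+
    then have "2 * card W \<le> card (carrier G)" unfolding l[symmetric] by (intro mult_right_mono) auto
    then have "real (card W) \<le> ?q / 2" by simp
    then show "real (card (\<Pi>\<^sub>E j\<in>J. W)) \<le> (?q / 2) ^ card J" using J by (simp add: card_PiE power_mono)
  qed
  also have "\<dots> = real (card ?W) * (?q / 2) ^ card J" by simp
  also have "\<dots> \<le> 2 ^ card (carrier G) * (?q / 2) ^ card J"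
  proof (intro mult_right_mono)
    have "card ?W \<le> card (Pow (carrier G))" using Wsub fin by (intro card_mono) auto
    then have "card ?W \<le> 2 ^ card (carrier G)" using fin by (simp add: card_Pow)
    then show "real (card ?W) \<le> 2 ^ card (carrier G)" by (metis of_nat_le_iff of_nat_numeral of_nat_power)
  qed auto
  finally have le: "real (card (?D - gen_tuples G J)) \<le> 2 ^ card (carrier G) * (?q / 2) ^ card J" .
  have "real (card (?D - gen_tuples G J)) = ?q ^ card J - real (card (gen_tuples G J))"
    using gsub finD card_mono[OF finD gsub] cD by (simp add: card_Diff_subset finite_subset of_nat_diff)
  then have "1 - real (card (gen_tuples G J)) / ?q ^ card J = real (card (?D - gen_tuples G J)) / ?q ^ card J"
    using q0 by (simp add: diff_divide_distrib)
  moreover have "\<dots> \<le> 2 ^ card (carrier G) * (?q / 2) ^ card J / ?q ^ card J"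
    using le by (rule divide_right_mono) simp
  moreover have "\<dots> = 2 ^ card (carrier G) * (1 / 2) ^ card J"
    using q0 by (simp add: power_divide)
  ultimately show ?thesis using q0 by simp
qed

section \<open>Divisibility and units in the p-adic integers\<close>

lemma residue_range: "residue (x :: 'p :: prime_card padic_int) k \<in> {0..<int CARD('p) ^ k}"
  using residue[of x] by blast

lemma residue_Suc_mod: "residue (x :: 'p :: prime_card padic_int) (Suc k) mod int CARD('p) ^ k = residue x k"
  using residue[of x] by blast

lemma residue_mod:
  "residue (x :: 'p :: prime_card padic_int) (k + j) mod int CARD('p) ^ k = residue x k"
proof (induction j)
  case 0
  then show ?case using residue_range[of x k] by simp
next
  case (Suc j)
  have "residue x (k + Suc j) mod int CARD('p) ^ k =
      residue x (Suc (k + j)) mod int CARD('p) ^ (k + j) mod int CARD('p) ^ k"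
    by (simp add: mod_mod_cancel le_imp_power_dvd)
  then show ?case using Suc residue_Suc_mod[of x "k + j"] by simp
qed

lemma residue_plus: "residue (x + y :: 'p :: prime_card padic_int) k = (residue x k + residue y k) mod int CARD('p) ^ k"
  by (simp add: plus_padic_int.rep_eq)

lemma residue_times: "residue (x * y :: 'p :: prime_card padic_int) k = (residue x k * residue y k) mod int CARD('p) ^ k"
  by (simp add: times_padic_int.rep_eq)

lemma residue_minus: "residue (x - y :: 'p :: prime_card padic_int) k = (residue x k - residue y k) mod int CARD('p) ^ k"
  by (simp add: minus_padic_int.rep_eq)

lemma residue_zero [simp]: "residue (0 :: 'p :: prime_card padic_int) k = 0"
  by (simp add: zero_padic_int.rep_eq)

lemma residue_one: "residue (1 :: 'p :: prime_card padic_int) k = 1 mod int CARD('p) ^ k"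
  by (simp add: one_padic_int.rep_eq)

lemma residue_of_nat: "residue (of_nat m :: 'p :: prime_card padic_int) k = int m mod int CARD('p) ^ k"
proof (induction m)
  case (Suc m)
  then show ?case by (simp add: residue_plus residue_one mod_simps)
qed simp

lemma residue_sum:
  "residue (\<Sum>i\<in>I. f i :: 'p :: prime_card padic_int) k = (\<Sum>i\<in>I. residue (f i) k) mod int CARD('p) ^ k"
proof (induction I rule: infinite_finite_induct)
  case (insert i I)
  then show ?case by (simp add: residue_plus mod_simps)
qed auto

lemma padic_eqI: "(\<And>k. residue x k = residue y k) \<Longrightarrow> x = y"
  by (metis residue_inject ext)

lemma padic_of_residues:
  fixes f :: "nat \<Rightarrow> int"
  assumes "\<And>k. f (Suc k) mod int CARD('p :: prime_card) ^ k = f k mod int CARD('p) ^ k"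
  obtains x :: "'p :: prime_card padic_int" where "\<And>k. residue x k = f k mod int CARD('p) ^ k"
proof
  have "(\<lambda>k. f k mod int CARD('p) ^ k) \<in> {f. \<forall>k. f k \<in> {0 ..< int CARD('p) ^ k} \<and>
      f (Suc k) mod int CARD('p) ^ k = f k}"
    using inverse_system_mod[of f, where 'p = 'p, OF assms] by blast
  then show "residue (Abs_padic_int (\<lambda>k. f k mod int CARD('p) ^ k) :: 'p padic_int) k = f k mod int CARD('p) ^ k" for k
    by (subst Abs_padic_int_inverse) auto
qed

text \<open>
  The quotient has \<open>residue x (j + k) div p\<^sup>k\<close> as its residue modulo \<open>p\<^sup>j\<close>.
\<close>

lemma padic_dvd_of_residue_zero:
  fixes x :: "'p :: prime_card padic_int"
  assumes "residue x k = 0"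
  obtains z where "x = of_nat (CARD('p) ^ k) * z"
proof -
  let ?P = "int CARD('p)"
  define f where "f j = residue x (j + k) div ?P ^ k" for j
  have P0: "?P ^ j > 0" for j by simp
  have xf: "residue x (j + k) = ?P ^ k * f j" for j
  proof -
    have "residue x (j + k) mod ?P ^ k = 0" using residue_mod[of x k j] assms by (simp add: add.commute)
    then show ?thesis unfolding f_def by (metis mult_div_mod_eq add.right_neutral)
  qed
  have "f (Suc j) mod ?P ^ j = f j mod ?P ^ j" for j
  proof -
    have "?P ^ k * f j = ?P ^ k * f (Suc j) mod ?P ^ (j + k)"
      using residue_Suc_mod[of x "j + k"] xf[of j] xf[of "Suc j"] by simp
    also have "\<dots> = ?P ^ k * (f (Suc j) mod ?P ^ j)"
      by (simp only: power_add mult_mod_right mult.commute[of "?P ^ j"])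
    finally have "f j = f (Suc j) mod ?P ^ j" using P0[of k] by simp
    then show ?thesis by simp
  qed
  then obtain z :: "'p padic_int" where z: "\<And>j. residue z j = f j mod ?P ^ j"
    using padic_of_residues[of f] by blast
  have "x = of_nat (CARD('p) ^ k) * z"
  proof (rule padic_eqI)
    fix j
    have "residue (of_nat (CARD('p) ^ k) * z) j = ((?P ^ k mod ?P ^ j) * (f j mod ?P ^ j)) mod ?P ^ j"
      unfolding residue_times residue_of_nat z by simp
    also have "\<dots> = (?P ^ k * f j) mod ?P ^ j" by (rule mod_mult_eq)
    also have "\<dots> = residue x j" unfolding xf[symmetric] by (rule residue_mod)
    finally show "residue x j = residue (of_nat (CARD('p) ^ k) * z) j" ..
  qed
  then show ?thesis by (rule that)
qed

text \<open>
  The inverses modulo the powers of \<open>p\<close> are unique, hence compatible with each other.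
\<close>

lemma padic_unit_of_residue_nonzero:
  fixes x :: "'p :: prime_card padic_int"
  assumes "residue x 1 \<noteq> 0"
  shows "x dvd 1"
proof -
  let ?P = "int CARD('p)"
  have pr: "prime ?P" using prime_card[where 'a = 'p] by simp
  have cop: "coprime (residue x k) (?P ^ k)" for k
  proof (cases k)
    case (Suc j)
    have "residue x k mod ?P = residue x 1" using residue_mod[of x 1 j] Suc by simp
    then have "\<not> ?P dvd residue x k" using assms by (auto simp: mod_eq_0_iff_dvd)
    then have "coprime ?P (residue x k)" using pr by (rule prime_imp_coprime[rotated])
    then show ?thesis by (simp add: coprime_commute)
  qed auto
  have "\<exists>u. (residue x k * u) mod ?P ^ k = 1 mod ?P ^ k" for k
    using cong_solve_coprime_int[OF cop[of k]] by (auto simp: cong_def)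
  then obtain f where f: "\<And>k. (residue x k * f k) mod ?P ^ k = 1 mod ?P ^ k" by metis
  have "f (Suc k) mod ?P ^ k = f k mod ?P ^ k" for k
  proof -
    have "(residue x (Suc k) * f (Suc k)) mod ?P ^ Suc k mod ?P ^ k = 1 mod ?P ^ Suc k mod ?P ^ k"
      using f[of "Suc k"] by simp
    then have "(residue x (Suc k) * f (Suc k)) mod ?P ^ k = 1 mod ?P ^ k"
      by (simp add: mod_mod_cancel)
    then have "(residue x k * f (Suc k)) mod ?P ^ k = 1 mod ?P ^ k"
      by (metis mod_mult_left_eq residue_Suc_mod)
    with f[of k] have "[residue x k * f (Suc k) = residue x k * f k] (mod ?P ^ k)" by (simp add: cong_def)
    then show ?thesis using cop[of k] by (simp add: cong_mult_lcancel cong_def[symmetric])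
  qed
  then obtain z :: "'p padic_int" where z: "\<And>j. residue z j = f j mod ?P ^ j"
    using padic_of_residues[of f] by blast
  have "1 = x * z"
    by (rule padic_eqI) (simp add: residue_times residue_one z mod_simps f)
  then show ?thesis by (rule dvdI)
qed

lemma reduce_eq_of_int: "reduce x = (of_int (residue x 1) :: 'p :: prime_card mod_ring)"
  unfolding reduce_def by (simp add: of_int_of_int_mod_ring)

lemma of_int_mod_card [simp]: "(of_int (a mod int CARD('p)) :: 'p :: prime_card mod_ring) = of_int a"
  unfolding of_int_of_int_mod_ring by (transfer) simp

interpretation reduce: comm_ring_hom "reduce :: 'p :: prime_card padic_int \<Rightarrow> 'p mod_ring"
proof
  fix x y :: "'p padic_int"
  show "reduce (x + y) = reduce x + reduce y" by (simp add: reduce_eq_of_int residue_plus)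
  show "reduce (x * y) = reduce x * reduce y" by (simp add: reduce_eq_of_int residue_times)
  show "reduce (1 :: 'p padic_int) = 1" by (simp add: reduce_eq_of_int residue_one)
  show "reduce (0 :: 'p padic_int) = 0" by (simp add: reduce_eq_of_int)
qed

lemma reduce_eq_0_iff: "reduce (x :: 'p :: prime_card padic_int) = 0 \<longleftrightarrow> residue x 1 = 0"
proof
  assume "reduce x = 0"
  then have "to_int_mod_ring (of_int_mod_ring (residue x 1) :: 'p mod_ring) = 0"
    unfolding reduce_def by (simp only: to_int_mod_ring_hom.hom_zero)
  then show "residue x 1 = 0" using residue_range[of x 1]
    by (subst (asm) to_int_mod_ring_of_int_mod_ring) auto
qed (simp add: reduce_eq_of_int)

lemma padic_dvd_1_iff: "(x :: 'p :: prime_card padic_int) dvd 1 \<longleftrightarrow> reduce x \<noteq> 0"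
proof
  assume "x dvd 1"
  then obtain y where "1 = x * y" by (auto elim: dvdE)
  then have "reduce x * reduce y = 1" by (metis reduce.hom_mult reduce.hom_one)
  then show "reduce x \<noteq> 0" by auto
qed (simp add: padic_unit_of_residue_nonzero reduce_eq_0_iff)

section \<open>Vectors modulo a prime power\<close>

text \<open>
  The additive group \<open>(\<int>/N)\<^sup>n\<close>.
\<close>

definition mod_vecs :: "nat \<Rightarrow> nat \<Rightarrow> (nat \<Rightarrow> int) monoid" where
  "mod_vecs N n = product_group {..<n} (\<lambda>_. integer_mod_group N)"

lemma comm_group_mod_vecs: "comm_group (mod_vecs N n)"
proof -
  have "group (mod_vecs N n)" unfolding mod_vecs_def by (rule product_group) simp
  then show ?thesis unfolding mod_vecs_def
    by (rule group.group_comm_groupI) (auto simp: add.commute)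
qed

lemma carrier_mod_vecs: "0 < N \<Longrightarrow> carrier (mod_vecs N n) = (\<Pi>\<^sub>E i\<in>{..<n}. {0..<int N})"
  by (simp add: mod_vecs_def carrier_integer_mod_group)

lemma mult_mod_vecs: "x \<otimes>\<^bsub>mod_vecs N n\<^esub> y = (\<lambda>i\<in>{..<n}. (x i + y i) mod int N)"
  by (simp add: mod_vecs_def)

lemma one_mod_vecs: "\<one>\<^bsub>mod_vecs N n\<^esub> = (\<lambda>i\<in>{..<n}. 0)"
  by (simp add: mod_vecs_def)

lemma pow_mod_vecs: "x [^]\<^bsub>mod_vecs N n\<^esub> (m::nat) = (\<lambda>i\<in>{..<n}. (int m * x i) mod int N)"
proof (induction m)
  case 0
  then show ?case by (auto simp: one_mod_vecs)
next
  case (Suc m)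
  then show ?case by (auto simp: mult_mod_vecs mod_simps algebra_simps)
qed

lemma card_mod_vecs: "0 < N \<Longrightarrow> card (carrier (mod_vecs N n)) = N ^ n"
  by (simp add: carrier_mod_vecs card_PiE)

lemma finite_mod_vecs: "0 < N \<Longrightarrow> finite (carrier (mod_vecs N n))"
  by (simp add: carrier_mod_vecs finite_PiE)

lemma pow_modulus_mod_vecs: "x [^]\<^bsub>mod_vecs N n\<^esub> N = \<one>\<^bsub>mod_vecs N n\<^esub>"
  unfolding pow_mod_vecs one_mod_vecs by (intro restrict_ext) simp

lemma word_mod_vecs:
  assumes "x \<in> J \<rightarrow> carrier (mod_vecs N n)" "finite J"
  shows "word (mod_vecs N n) x J c = (\<lambda>i\<in>{..<n}. (\<Sum>j\<in>J. int (c j) * x j i) mod int N)"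
proof -
  interpret V: comm_group "mod_vecs N n" by (rule comm_group_mod_vecs)
  show ?thesis using assms(2,1) unfolding word_def
  proof (induction J rule: finite_induct)
    case empty
    then show ?case by (auto simp: one_mod_vecs)
  next
    case (insert j J)
    have "finprod (mod_vecs N n) (\<lambda>j. x j [^]\<^bsub>mod_vecs N n\<^esub> c j) (insert j J) =
      x j [^]\<^bsub>mod_vecs N n\<^esub> c j \<otimes>\<^bsub>mod_vecs N n\<^esub> finprod (mod_vecs N n) (\<lambda>j. x j [^]\<^bsub>mod_vecs N n\<^esub> c j) J"
      using insert by (intro V.finprod_insert) auto
    also have "\<dots> = (\<lambda>i\<in>{..<n}. (\<Sum>j\<in>insert j J. int (c j) * x j i) mod int N)"
      using insert by (simp add: mult_mod_vecs pow_mod_vecs mod_simps restrict_def fun_eq_iff)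
    finally show ?case .
  qed
qed

text \<open>
  An entry is killed by \<open>p\<close> if and only if it is a multiple of \<open>p ^ (k - 1)\<close>.
\<close>

lemma torsion_mod_vecs:
  assumes p: "0 < (p::nat)" and k: "0 < k"
  shows "torsion (mod_vecs (p ^ k) n) p =
    (\<Pi>\<^sub>E i\<in>{..<n}. (\<lambda>c. int p ^ (k - 1) * int c) ` {..<p})" (is "?T = ?R")
proof -
  have pk: "int p ^ k = int p ^ (k - 1) * int p" using k by (metis Suc_diff_1 power_Suc2)
  have *: "{a \<in> {0..<int p ^ k}. (int p * a) mod int p ^ k = 0} = (\<lambda>c. int p ^ (k - 1) * int c) ` {..<p}"
  proof (intro equalityI subsetI)
    fix a assume a: "a \<in> {a \<in> {0..<int p ^ k}. (int p * a) mod int p ^ k = 0}"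
    then have "int p ^ k dvd int p * a" by auto
    then have "int p ^ (k - 1) * int p dvd a * int p" unfolding pk by (simp only: mult.commute)
    then have "int p = 0 \<or> int p ^ (k - 1) dvd a" by (simp only: dvd_mult_cancel_right)
    then have "int p ^ (k - 1) dvd a" using p by simp
    then obtain b where b: "a = int p ^ (k - 1) * b" by auto
    have "0 \<le> int p ^ (k - 1) * b" "int p ^ (k - 1) * b < int p ^ (k - 1) * int p" using a b pk by auto
    moreover have "0 \<le> b \<and> b < int p" if "0 < q" "0 \<le> q * b" "q * b < q * int p" for q :: int
      using that by (auto simp: zero_le_mult_iff)
    ultimately have "0 \<le> b" "b < int p" using p by (metis of_nat_0_less_iff zero_less_power)+
    then show "a \<in> (\<lambda>c. int p ^ (k - 1) * int c) ` {..<p}" using b by (intro image_eqI[of _ _ "nat b"]) auto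
  next
    fix a assume "a \<in> (\<lambda>c. int p ^ (k - 1) * int c) ` {..<p}"
    then obtain c where c: "c < p" "a = int p ^ (k - 1) * int c" by auto
    then have "a < int p ^ k" using p by (simp add: pk)
    moreover have e: "int p * a = int p ^ k * int c" by (simp add: pk c)
    have "(int p * a) mod int p ^ k = 0" unfolding e by simp
    moreover have "0 \<le> a" using c by simp
    ultimately show "a \<in> {a \<in> {0..<int p ^ k}. (int p * a) mod int p ^ k = 0}"
      by (simp only: mem_Collect_eq atLeastLessThan_iff)
  qed
  have "?T = (\<Pi>\<^sub>E i\<in>{..<n}. {a \<in> {0..<int p ^ k}. (int p * a) mod int p ^ k = 0})"
  proof -
    have "x [^]\<^bsub>mod_vecs (p ^ k) n\<^esub> p = \<one>\<^bsub>mod_vecs (p ^ k) n\<^esub> \<longleftrightarrow>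
        (\<forall>i\<in>{..<n}. (int p * x i) mod int p ^ k = 0)" for x
      unfolding pow_mod_vecs one_mod_vecs of_nat_power by (metis (no_types, lifting) restrict_apply' restrict_ext)
    moreover have "carrier (mod_vecs (p ^ k) n) = (\<Pi>\<^sub>E i\<in>{..<n}. {0..<int p ^ k})"
      using p by (simp add: carrier_mod_vecs)
    moreover have "{x \<in> \<Pi>\<^sub>E i\<in>I. B. \<forall>i\<in>I. Q (x i)} = (\<Pi>\<^sub>E i\<in>I. {a \<in> B. Q a})"
      for I :: "nat set" and B :: "int set" and Q by (auto simp: PiE_iff extensional_def)
    ultimately show ?thesis by (simp only:)
  qed
  then show ?thesis unfolding * .
qed

lemma card_torsion_mod_vecs:
  assumes p: "0 < (p::nat)" and k: "0 < k"
  shows "card (torsion (mod_vecs (p ^ k) n) p) = p ^ n"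
proof -
  have "inj_on (\<lambda>c. int p ^ (k - 1) * int c) {..<p}" using p by (intro inj_onI) auto
  then show ?thesis unfolding torsion_mod_vecs[OF assms] by (simp add: card_PiE card_image)
qed

lemma torsion_subset_powers_mod_vecs:
  assumes p: "0 < (p::nat)" and k: "0 < k"
  shows "torsion (mod_vecs (p ^ k) n) p \<subseteq>
    powers (mod_vecs (p ^ k) n) (p ^ (k - 1)) (carrier (mod_vecs (p ^ k) n))"
proof
  fix x assume "x \<in> torsion (mod_vecs (p ^ k) n) p"
  then have x: "x \<in> (\<Pi>\<^sub>E i\<in>{..<n}. (\<lambda>c. int p ^ (k - 1) * int c) ` {..<p})"
    unfolding torsion_mod_vecs[OF assms] .
  then have "\<forall>i\<in>{..<n}. \<exists>c<p. x i = int p ^ (k - 1) * int c" by (auto simp: PiE_iff)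
  then obtain c where c: "\<And>i. i < n \<Longrightarrow> c i < p \<and> x i = int p ^ (k - 1) * int (c i)" by (metis lessThan_iff)
  have ppk: "p \<le> p ^ k" using p k by (simp add: self_le_power)
  have pk: "int p ^ k = int p ^ (k - 1) * int p" using k by (metis Suc_diff_1 power_Suc2)
  let ?w = "\<lambda>i\<in>{..<n}. int (c i)"
  have "c i < p ^ k" if "i < n" for i using c[OF that] ppk by linarith
  then have "?w \<in> carrier (mod_vecs (p ^ k) n)"
    using p by (auto simp: carrier_mod_vecs simp flip: of_nat_power)
  moreover have "x = ?w [^]\<^bsub>mod_vecs (p ^ k) n\<^esub> (p ^ (k - 1))"
  proof (rule extensionalityI[of _ "{..<n}"])
    fix i assume i: "i \<in> {..<n}"
    have "int p ^ (k - 1) * int (c i) < int p ^ k" using c[of i] i p by (simp add: pk)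
    then show "x i = (?w [^]\<^bsub>mod_vecs (p ^ k) n\<^esub> (p ^ (k - 1))) i" using c i by (simp add: pow_mod_vecs)
  qed (use x in \<open>auto simp: pow_mod_vecs PiE_def\<close>)
  ultimately show "x \<in> powers (mod_vecs (p ^ k) n) (p ^ (k - 1)) (carrier (mod_vecs (p ^ k) n))" by blast
qed

lemma powers_mod_vecs:
  assumes p: "0 < (p::nat)" and k: "0 < k" and x: "x \<in> powers (mod_vecs (p ^ k) n) p (carrier (mod_vecs (p ^ k) n))"
    and i: "i < n"
  shows "int p dvd x i"
proof -
  obtain y where "x i = (int p * y i) mod int p ^ k" using x i by (auto simp: pow_mod_vecs)
  moreover have "int p dvd int p ^ k" using k by (simp add: dvd_power)
  ultimately show ?thesis by (simp add: dvd_mod)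
qed

section \<open>Cokernels through residues\<close>

definition residue_vec :: "nat \<Rightarrow> 'p :: prime_card padic_int vec \<Rightarrow> nat \<Rightarrow> int" where
  "residue_vec k v = (\<lambda>i\<in>{..<dim_vec v}. residue (v $ i) k)"

lemma card_auto_pos:
  fixes A (structure)
  assumes "group A" "finite (carrier A)"
  shows "0 < card (auto A)"
proof -
  have "finite (auto A)"
  proof (rule finite_subset)
    show "auto A \<subseteq> (\<Pi>\<^sub>E x\<in>carrier A. carrier A)" by (auto simp: auto_def Bij_def PiE_def hom_def)
    show "finite (\<Pi>\<^sub>E x\<in>carrier A. carrier A)" using assms by (intro finite_PiE) auto
  qed
  then show ?thesis using group.id_in_auto[OF assms(1)] by (metis card_gt_0_iff empty_iff)
qed

text \<open>
  The subgroup \<open>L\<close> is the kernel of an epimorphism onto \<open>A\<close>, where \<open>m\<close>-th powers are trivial by Lagrange's theorem.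
\<close>

lemma (in comm_group) pow_mem_of_quotient_iso:
  assumes L: "subgroup L G" and A: "group A" "finite (carrier A)" "order A = m" and iso: "G Mod L \<cong> A"
    and v: "v \<in> carrier G"
  shows "v [^] m \<in> L"
proof -
  interpret A: group A by fact
  have "card (auto A) \<noteq> 0" using card_auto_pos[OF A(1,2)] by simp
  then have "{F \<in> epi_ext G A. kernel G A F = L} \<noteq> {}"
    using card_epi_ext_kernel[OF subgroup_imp_normal[OF L] A(1)] iso by (metis card.empty)
  then obtain F where F: "F \<in> epi_ext G A" "kernel G A F = L" by blast
  interpret F: group_hom G A F using A(1) F(1) by (rule group_hom_of_epi_ext)
  have "F (v [^] m) = \<one>\<^bsub>A\<^esub>" using v A.pow_order_eq_1[of "F v"] A by (simp add: F.hom_nat_pow)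
  then show ?thesis using F v by (auto simp: kernel_def)
qed

abbreviation padic_vecs :: "'p :: prime_card itself \<Rightarrow> nat \<Rightarrow> 'p padic_int vec monoid" where
  "padic_vecs _ n \<equiv> monoid_vec TYPE('p padic_int) n"

lemma pow_monoid_vec:
  assumes "v \<in> carrier_vec n"
  shows "v [^]\<^bsub>monoid_vec TYPE('a :: comm_ring_1) n\<^esub> (m :: nat) = of_nat m \<cdot>\<^sub>v v"
proof (induction m)
  case 0
  then show ?case using assms by (auto simp: monoid_vec_simps)
next
  case (Suc m)
  then show ?case using assms by (auto simp: monoid_vec_simps algebra_simps)
qed

lemma group_hom_residue_vec:
  "group_hom (padic_vecs TYPE('p :: prime_card) n) (mod_vecs (CARD('p) ^ k) n) (residue_vec k)"
proof -
  interpret Z: comm_group "padic_vecs TYPE('p) n" by (rule comm_group_vec)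
  interpret V: comm_group "mod_vecs (CARD('p) ^ k) n" by (rule comm_group_mod_vecs)
  have "residue_vec k \<in> hom (padic_vecs TYPE('p) n) (mod_vecs (CARD('p) ^ k) n)"
  proof (rule homI)
    have r: "0 \<le> residue x k \<and> residue x k < int CARD('p) ^ k" for x :: "'p padic_int"
      using residue_range[of x k] by simp
    fix v :: "'p padic_int vec" assume "v \<in> carrier (padic_vecs TYPE('p) n)"
    then show "residue_vec k v \<in> carrier (mod_vecs (CARD('p) ^ k) n)"
      using r by (auto simp: carrier_mod_vecs residue_vec_def monoid_vec_simps)
  next
    fix v w :: "'p padic_int vec" assume "v \<in> carrier (padic_vecs TYPE('p) n)" "w \<in> carrier (padic_vecs TYPE('p) n)"
    then show "residue_vec k (v \<otimes>\<^bsub>padic_vecs TYPE('p) n\<^esub> w) = residue_vec k v \<otimes>\<^bsub>mod_vecs (CARD('p) ^ k) n\<^esub> residue_vec k w"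
      by (auto simp: residue_vec_def monoid_vec_simps mult_mod_vecs residue_plus)
  qed
  then show ?thesis by unfold_locales
qed

lemma residue_vec_surj:
  "(residue_vec k :: 'p :: prime_card padic_int vec \<Rightarrow> nat \<Rightarrow> int) ` carrier_vec n =
    carrier (mod_vecs (CARD('p) ^ k) n)"
proof
  interpret h: group_hom "padic_vecs TYPE('p) n" "mod_vecs (CARD('p) ^ k) n" "residue_vec k"
    by (rule group_hom_residue_vec)
  show "(residue_vec k :: 'p padic_int vec \<Rightarrow> nat \<Rightarrow> int) ` carrier_vec n \<subseteq> carrier (mod_vecs (CARD('p) ^ k) n)"
    using h.hom_closed by (auto simp: monoid_vec_simps)
  show "carrier (mod_vecs (CARD('p) ^ k) n) \<subseteq> (residue_vec k :: 'p padic_int vec \<Rightarrow> nat \<Rightarrow> int) ` carrier_vec n"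
  proof
    fix x assume "x \<in> carrier (mod_vecs (CARD('p) ^ k) n)"
    then have x: "x \<in> (\<Pi>\<^sub>E i\<in>{..<n}. {0..<int CARD('p) ^ k})" by (simp add: carrier_mod_vecs)
    let ?v = "vec n (\<lambda>i. of_nat (nat (x i)) :: 'p padic_int)"
    have "x = residue_vec k ?v"
    proof (rule extensionalityI[of _ "{..<n}"])
      fix i assume "i \<in> {..<n}"
      moreover then have "0 \<le> x i" "x i < int CARD('p) ^ k" using x by (auto simp: PiE_iff)
      moreover have "residue (of_nat (nat (x i)) :: 'p padic_int) k = int (nat (x i)) mod int CARD('p) ^ k"
        by (rule residue_of_nat)
      ultimately show "x i = residue_vec k ?v i" by (simp add: residue_vec_def del: of_nat_nat)
    qed (use x in \<open>auto simp: residue_vec_def PiE_def\<close>)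
    then show "x \<in> (residue_vec k :: 'p padic_int vec \<Rightarrow> nat \<Rightarrow> int) ` carrier_vec n" by (intro image_eqI[of _ _ ?v]) auto
  qed
qed

lemma subgroup_mat_image:
  assumes A: "(A :: 'a :: comm_ring_1 mat) \<in> carrier_mat n n"
  shows "subgroup ((\<lambda>v. A *\<^sub>v v) ` carrier_vec n) (monoid_vec TYPE('a) n)"
proof -
  interpret Z: comm_group "monoid_vec TYPE('a) n" by (rule comm_group_vec)
  have "group_hom (monoid_vec TYPE('a) n) (monoid_vec TYPE('a) n) (\<lambda>v. A *\<^sub>v v)"
    using A by unfold_locales (auto simp: hom_def monoid_vec_simps mult_add_distrib_mat_vec)
  from group_hom.img_is_subgroup[OF this] show ?thesis by (simp add: monoid_vec_simps)
qed

text \<open>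
  The coefficients of a linear combination of the columns act on residues through their own residues, which are integers.
  So the span over the p-adic integers has the same image as the additive group generated by the columns.
\<close>

lemma residue_vec_mat_image:
  fixes A :: "'p :: prime_card padic_int mat"
  assumes A: "A \<in> carrier_mat n n"
  shows "residue_vec k ` (\<lambda>v. A *\<^sub>v v) ` carrier_vec n =
    generate (mod_vecs (CARD('p) ^ k) n) ((\<lambda>j. residue_vec k (col A j)) ` {..<n})"
    (is "?h ` ?L = generate ?V (?x ` _)")
proof
  interpret Z: comm_group "padic_vecs TYPE('p) n" by (rule comm_group_vec)
  interpret V: comm_group ?V by (rule comm_group_mod_vecs)
  interpret h: group_hom "padic_vecs TYPE('p) n" ?V ?h by (rule group_hom_residue_vec)
  have x: "?x j \<in> carrier ?V" if "j < n" for j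
    using A that h.hom_closed[of "col A j"] by (simp add: monoid_vec_simps)
  have xJ: "?x \<in> {..<n} \<rightarrow> carrier ?V" using x by auto
  show "generate ?V (?x ` {..<n}) \<subseteq> ?h ` ?L"
  proof (rule V.generate_subgroup_incl)
    show "subgroup (?h ` ?L) ?V" using subgroup_mat_image[OF A] by (rule h.subgroup_img_is_subgroup)
    show "?x ` {..<n} \<subseteq> ?h ` ?L"
    proof
      fix y assume "y \<in> ?x ` {..<n}"
      then obtain j where j: "j < n" "y = ?x j" by auto
      have "A *\<^sub>v unit_vec n j = col A j" using A j by (intro eq_vecI) auto
      then show "y \<in> ?h ` ?L" using j by (metis (no_types, lifting) image_eqI unit_vec_carrier)
    qed
  qed
  show "?h ` ?L \<subseteq> generate ?V (?x ` {..<n})"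
  proof
    fix y assume "y \<in> ?h ` ?L"
    then obtain v where v: "v \<in> carrier_vec n" "y = ?h (A *\<^sub>v v)" by auto
    let ?c = "\<lambda>j. nat (residue (v $ j) k)"
    have c: "int (?c j) = residue (v $ j) k" for j using residue_range[of "v $ j" k] by simp
    have "y = word ?V ?x {..<n} ?c"
      unfolding word_mod_vecs[OF xJ finite_lessThan]
    proof (rule extensionalityI[of _ "{..<n}"])
      fix i assume i: "i \<in> {..<n}"
      have "y i = residue (\<Sum>j\<in>{..<n}. A $$ (i, j) * v $ j) k"
        using v A i by (simp add: residue_vec_def scalar_prod_def atLeast0LessThan)
      also have "\<dots> = (\<Sum>j\<in>{..<n}. residue (A $$ (i, j)) k * residue (v $ j) k) mod int CARD('p) ^ k"
        unfolding residue_sum residue_times mod_sum_eq ..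
      also have "(\<Sum>j\<in>{..<n}. residue (A $$ (i, j)) k * residue (v $ j) k) = (\<Sum>j\<in>{..<n}. int (?c j) * ?x j i)"
        unfolding c using A i by (intro sum.cong refl) (simp add: residue_vec_def mult.commute)
      finally show "y i = (\<lambda>i\<in>{..<n}. (\<Sum>j\<in>{..<n}. int (?c j) * ?x j i) mod int (CARD('p) ^ k)) i"
        using i by (simp del: int_nat_eq)
    qed (use v A in \<open>auto simp: residue_vec_def\<close>)
    moreover have "subgroup (generate ?V (?x ` {..<n})) ?V" using x by (intro V.generate_is_subgroup) auto
    then have "word ?V ?x {..<n} ?c \<in> generate ?V (?x ` {..<n})"
      by (rule V.word_in_subgroup) (auto intro: V.pow_in_subgroup[OF \<open>subgroup _ _\<close>] generate.incl)
    ultimately show "y \<in> generate ?V (?x ` {..<n})" by simp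
  qed
qed

lemma mat_mult_smult_vec:
  assumes "(A :: 'a :: comm_ring_1 mat) \<in> carrier_mat m n" "v \<in> carrier_vec n"
  shows "A *\<^sub>v (k \<cdot>\<^sub>v v) = k \<cdot>\<^sub>v (A *\<^sub>v v)"
  using assms by (intro eq_vecI) auto

lemma smult_mat_mult_vec:
  assumes "(A :: 'a :: comm_ring_1 mat) \<in> carrier_mat m n" "v \<in> carrier_vec n"
  shows "(k \<cdot>\<^sub>m A) *\<^sub>v v = k \<cdot>\<^sub>v (A *\<^sub>v v)"
  using assms by (intro eq_vecI) (auto simp: scalar_prod_def sum_distrib_left mult.assoc)

lemma mat_image_of_unit_det:
  assumes D: "(D :: 'a :: comm_ring_1 mat) \<in> carrier_mat n n" and u: "det D dvd 1" and v: "v \<in> carrier_vec n"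
  obtains w where "w \<in> carrier_vec n" "D *\<^sub>v w = v"
proof -
  obtain c where c: "1 = det D * c" using u by (auto elim: dvdE)
  note adj = adj_mat[OF D]
  let ?w = "c \<cdot>\<^sub>v (adj_mat D *\<^sub>v v)"
  have "D *\<^sub>v ?w = c \<cdot>\<^sub>v (D *\<^sub>v (adj_mat D *\<^sub>v v))" using D adj v by (intro mat_mult_smult_vec[of D n n]) auto
  also have "D *\<^sub>v (adj_mat D *\<^sub>v v) = (D * adj_mat D) *\<^sub>v v"
    by (rule assoc_mult_mat_vec[OF D adj(1) v, symmetric])
  also have "\<dots> = det D \<cdot>\<^sub>v v" unfolding adj(2) using v by (simp add: smult_mat_mult_vec[of _ n n])
  also have "c \<cdot>\<^sub>v (det D \<cdot>\<^sub>v v) = v" using c by (simp add: smult_smult_assoc mult.commute)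
  finally show ?thesis using that[of ?w] adj v by auto
qed

text \<open>
  This is an instance of Nakayama's lemma.  The assumption, applied to the unit vectors, yields matrices with
  \<open>p\<^sup>e = A U + p\<^sup>e\<^sup>+\<^sup>1 Z\<close>, that is, \<open>A U = p\<^sup>e (1 - p Z)\<close>, and \<open>1 - p Z\<close> is invertible because its determinant is \<open>1\<close>
  modulo \<open>p\<close>.
\<close>

lemma mat_image_lift:
  fixes A :: "'p :: prime_card padic_int mat"
  assumes A: "A \<in> carrier_mat n n"
    and ex: "\<And>v. v \<in> carrier_vec n \<Longrightarrow> \<exists>u\<in>carrier_vec n. \<exists>z\<in>carrier_vec n.
      of_nat (CARD('p) ^ e) \<cdot>\<^sub>v v = A *\<^sub>v u + of_nat (CARD('p) ^ Suc e) \<cdot>\<^sub>v z"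
    and v: "v \<in> carrier_vec n"
  shows "of_nat (CARD('p) ^ e) \<cdot>\<^sub>v v \<in> (\<lambda>v. A *\<^sub>v v) ` carrier_vec n"
proof -
  let ?q = "of_nat (CARD('p) ^ e) :: 'p padic_int" and ?p = "of_nat CARD('p) :: 'p padic_int"
  have "\<forall>j. \<exists>u z. u \<in> carrier_vec n \<and> z \<in> carrier_vec n \<and>
      ?q \<cdot>\<^sub>v unit_vec n j = A *\<^sub>v u + of_nat (CARD('p) ^ Suc e) \<cdot>\<^sub>v z"
    using ex[OF unit_vec_carrier] by blast
  then obtain u z where uz: "\<And>j. u j \<in> carrier_vec n" "\<And>j. z j \<in> carrier_vec n"
      "\<And>j. ?q \<cdot>\<^sub>v unit_vec n j = A *\<^sub>v u j + of_nat (CARD('p) ^ Suc e) \<cdot>\<^sub>v z j" by metis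
  define U where "U = mat n n (\<lambda>(i, j). u j $ i)"
  define Z where "Z = mat n n (\<lambda>(i, j). z j $ i)"
  have U: "U \<in> carrier_mat n n" and Z: "Z \<in> carrier_mat n n" by (auto simp: U_def Z_def)
  define D where "D = 1\<^sub>m n - ?p \<cdot>\<^sub>m Z"
  have D: "D \<in> carrier_mat n n" using Z by (auto simp: D_def)
  have "A * U = ?q \<cdot>\<^sub>m D"
  proof (rule eq_matI)
    fix i j assume "i < dim_row (?q \<cdot>\<^sub>m D)" "j < dim_col (?q \<cdot>\<^sub>m D)"
    then have ij: "i < n" "j < n" using D by auto
    have "col U j = u j" using ij uz(1)[of j] by (intro eq_vecI) (auto simp: U_def)
    then have "(A * U) $$ (i, j) = (A *\<^sub>v u j) $ i" using A U ij by simp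
    moreover have "(?q \<cdot>\<^sub>v unit_vec n j) $ i = (A *\<^sub>v u j + of_nat (CARD('p) ^ Suc e) \<cdot>\<^sub>v z j) $ i"
      using uz(3) by simp
    then have "?q * (if i = j then 1 else 0) = (A *\<^sub>v u j) $ i + ?q * ?p * z j $ i"
      using ij A uz(2)[of j] by (auto simp: unit_vec_def mult_ac)
    ultimately show "(A * U) $$ (i, j) = (?q \<cdot>\<^sub>m D) $$ (i, j)"
      using ij Z by (auto simp: D_def Z_def one_mat_def algebra_simps)
  qed (use A U D in auto)
  note AU = this
  have "reduce ?p = 0" by (simp add: reduce_eq_0_iff residue_of_nat)
  then have "map_mat reduce D = 1\<^sub>m n" using Z
    by (intro eq_matI) (auto simp: D_def one_mat_def reduce.hom_minus reduce.hom_mult)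
  then have "reduce (det D) = 1" by (metis det_one reduce.hom_det)
  then have "det D dvd 1" by (simp add: padic_dvd_1_iff)
  then obtain w where w: "w \<in> carrier_vec n" "D *\<^sub>v w = v" using mat_image_of_unit_det[OF D _ v] by blast
  have "A *\<^sub>v (U *\<^sub>v w) = (?q \<cdot>\<^sub>m D) *\<^sub>v w"
    by (simp only: AU[symmetric] assoc_mult_mat_vec[OF A U w(1)])
  also have "\<dots> = ?q \<cdot>\<^sub>v (D *\<^sub>v w)" using D w(1) by (rule smult_mat_mult_vec)
  finally show ?thesis using w U by (metis (no_types, lifting) image_eqI mult_mat_vec_carrier)
qed

text \<open>
  Let \<open>L\<close> be the column span of \<open>A\<close>.  The quotient on the right-hand side is that of the full lattice by
  \<open>L' = L + p\<^sup>e\<^sup>+\<^sup>1 \<int>\<^sub>p\<^sup>n\<close>.  If the quotient by \<open>L\<close> has order \<open>p\<^sup>e\<close>, then \<open>L\<close> contains \<open>p\<^sup>e \<int>\<^sub>p\<^sup>n\<close>; if the quotient by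
  \<open>L'\<close> has order \<open>p\<^sup>e\<close>, then the same follows from Nakayama's lemma.  Either way \<open>L' = L\<close>.  The additional power of \<open>p\<close> in the
  modulus is what makes Nakayama's lemma applicable.
\<close>

theorem cok_iso_iff_residue_quotient:
  fixes A :: "'p :: prime_card padic_int mat" and B (structure)
  assumes A: "A \<in> carrier_mat n n" and B: "group B" "finite (carrier B)" "order B = CARD('p) ^ e"
  shows "cok A \<cong> B \<longleftrightarrow> mod_vecs (CARD('p) ^ Suc e) n Mod
      generate (mod_vecs (CARD('p) ^ Suc e) n) ((\<lambda>j. residue_vec (Suc e) (col A j)) ` {..<n}) \<cong> B"
    (is "_ \<longleftrightarrow> ?V Mod ?W \<cong> B")
proof -
  let ?Z = "padic_vecs TYPE('p) n" and ?h = "residue_vec (Suc e) :: 'p padic_int vec \<Rightarrow> nat \<Rightarrow> int"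
  let ?L = "(\<lambda>v. A *\<^sub>v v) ` carrier_vec n"
  interpret Z: comm_group ?Z by (rule comm_group_vec)
  interpret V: comm_group ?V by (rule comm_group_mod_vecs)
  interpret h: group_hom ?Z ?V ?h by (rule group_hom_residue_vec)
  have L: "subgroup ?L ?Z" by (rule subgroup_mat_image[OF A])
  have Lc: "?L \<subseteq> carrier_vec n" using A by auto
  have cok: "cok A = ?Z Mod ?L" using A by (simp add: cok_def)
  have hL: "?h ` ?L = ?W" by (rule residue_vec_mat_image[OF A])
  have W: "subgroup ?W ?V" unfolding hL[symmetric] using L by (rule h.subgroup_img_is_subgroup)
  then have Wn: "?W \<lhd> ?V" by (rule V.subgroup_imp_normal)
  interpret W: normal ?W ?V by (rule Wn)
  interpret VW: group "?V Mod ?W" by (rule W.factorgroup_is_group)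
  define q where "q = compose (carrier ?Z) (\<lambda>x. ?W #>\<^bsub>?V\<^esub> x) ?h"
  have q: "q v = ?W #>\<^bsub>?V\<^esub> ?h v" if "v \<in> carrier_vec n" for v
    using that by (simp only: q_def compose_def restrict_apply' monoid_vec_simps)
  have "q \<in> hom ?Z (?V Mod ?W)"
    unfolding q_def using h.homh W.r_coset_hom_Mod by (rule Z.hom_compose)
  then interpret q: group_hom ?Z "?V Mod ?W" q by unfold_locales
  let ?L' = "kernel ?Z (?V Mod ?W) q"
  have "q ` carrier ?Z = (\<lambda>x. ?W #>\<^bsub>?V\<^esub> x) ` ?h ` carrier_vec n"
    unfolding image_image monoid_vec_simps by (rule image_cong[OF refl q])
  also have "\<dots> = carrier (?V Mod ?W)" unfolding residue_vec_surj by (auto simp: FactGroup_def RCOSETS_def)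
  finally have iso': "?Z Mod ?L' \<cong> ?V Mod ?W" by (rule q.FactGroup_iso)
  have L'iff: "v \<in> ?L' \<longleftrightarrow> ?h v \<in> ?W" if v: "v \<in> carrier_vec n" for v
  proof -
    have hv: "?h v \<in> carrier ?V" using v h.hom_closed by (simp add: monoid_vec_simps)
    have "v \<in> ?L' \<longleftrightarrow> ?W #>\<^bsub>?V\<^esub> ?h v = ?W"
      using v q[OF v] unfolding kernel_def FactGroup_def monoid_vec_simps by (simp only: mem_Collect_eq) simp
    also have "\<dots> \<longleftrightarrow> ?h v \<in> ?W"
      using V.coset_join1[OF _ hv W] V.coset_join2[OF hv W] W.subset by auto
    finally show ?thesis .
  qed
  have LL': "?L \<subseteq> ?L'" using L'iff Lc hL by blast
  have L'dec: "\<exists>u\<in>carrier_vec n. \<exists>z\<in>carrier_vec n. v = A *\<^sub>v u + of_nat (CARD('p) ^ Suc e) \<cdot>\<^sub>v z"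
    if v': "v \<in> ?L'" for v
  proof -
    have v: "v \<in> carrier_vec n" using v' by (simp add: kernel_def monoid_vec_simps)
    then have "?h v \<in> ?h ` ?L" using L'iff v' hL by simp
    then obtain u where u: "u \<in> carrier_vec n" "?h v = ?h (A *\<^sub>v u)" by auto
    let ?y = "A *\<^sub>v u"
    have y: "?y \<in> carrier_vec n" using A u by auto
    have "\<exists>z. v $ i - ?y $ i = of_nat (CARD('p) ^ Suc e) * z" if "i < n" for i
    proof -
      have "residue (v $ i) (Suc e) = residue (?y $ i) (Suc e)"
        using fun_cong[OF u(2), of i] that v A by (simp add: residue_vec_def)
      then have "residue (v $ i - ?y $ i) (Suc e) = 0" by (simp add: residue_minus)
      then show ?thesis by (metis padic_dvd_of_residue_zero)
    qed
    then obtain z where z: "\<And>i. i < n \<Longrightarrow> v $ i - ?y $ i = of_nat (CARD('p) ^ Suc e) * z i" by metis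
    have "v = ?y + of_nat (CARD('p) ^ Suc e) \<cdot>\<^sub>v vec n z"
    proof (rule eq_vecI)
      fix i assume "i < dim_vec (?y + of_nat (CARD('p) ^ Suc e) \<cdot>\<^sub>v vec n z)"
      then have i: "i < n" using y by simp
      have "v $ i = ?y $ i + of_nat (CARD('p) ^ Suc e) * z i" using z[OF i] by (metis diff_add_cancel add.commute)
      then show "v $ i = (?y + of_nat (CARD('p) ^ Suc e) \<cdot>\<^sub>v vec n z) $ i" using i y by simp
    qed (use v y in auto)
    then show ?thesis using u by (intro bexI[of _ u] bexI[of _ "vec n z"]) auto
  qed
  have L'eq: "?L' = ?L" if "\<And>v. v \<in> carrier_vec n \<Longrightarrow> of_nat (CARD('p) ^ e) \<cdot>\<^sub>v v \<in> ?L"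
  proof
    show "?L' \<subseteq> ?L"
    proof
      fix v assume "v \<in> ?L'"
      then obtain u z where uz: "u \<in> carrier_vec n" "z \<in> carrier_vec n"
        "v = A *\<^sub>v u + of_nat (CARD('p) ^ Suc e) \<cdot>\<^sub>v z" using L'dec by blast
      have "of_nat (CARD('p) ^ Suc e) \<cdot>\<^sub>v z = of_nat (CARD('p) ^ e) \<cdot>\<^sub>v (of_nat CARD('p) \<cdot>\<^sub>v z)"
        by (simp add: smult_smult_assoc mult.commute)
      then have "of_nat (CARD('p) ^ Suc e) \<cdot>\<^sub>v z \<in> ?L" using that[of "of_nat CARD('p) \<cdot>\<^sub>v z"] uz by simp
      moreover have "A *\<^sub>v u \<in> ?L" using uz by auto
      ultimately show "v \<in> ?L" using subgroup.m_closed[OF L] uz(3) by (simp add: monoid_vec_simps)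
    qed
  qed (rule LL')
  show ?thesis
  proof
    assume *: "cok A \<cong> B"
    have "of_nat (CARD('p) ^ e) \<cdot>\<^sub>v v \<in> ?L" if v: "v \<in> carrier_vec n" for v
      using Z.pow_mem_of_quotient_iso[OF L B, of v] * v by (simp add: cok pow_monoid_vec monoid_vec_simps)
    then have "?L' = ?L" by (rule L'eq)
    moreover have "?V Mod ?W \<cong> ?Z Mod ?L'"
      using normal.factorgroup_is_group[OF q.normal_kernel] iso' by (rule group.iso_sym)
    ultimately have "?V Mod ?W \<cong> cok A" by (simp only: cok)
    then show "?V Mod ?W \<cong> B" using * by (rule iso_trans)
  next
    assume "?V Mod ?W \<cong> B"
    with iso' have *: "?Z Mod ?L' \<cong> B" by (rule iso_trans)
    have "of_nat (CARD('p) ^ e) \<cdot>\<^sub>v v \<in> ?L'" if v: "v \<in> carrier_vec n" for v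
      using Z.pow_mem_of_quotient_iso[OF q.subgroup_kernel B *, of v] v by (simp add: pow_monoid_vec monoid_vec_simps)
    then have "of_nat (CARD('p) ^ e) \<cdot>\<^sub>v v \<in> ?L" if v: "v \<in> carrier_vec n" for v
      using L'dec v by (intro mat_image_lift[OF A]) auto
    then have "?L' = ?L" by (rule L'eq)
    then show "cok A \<cong> B" using * by (simp add: cok)
  qed
qed

text \<open>
  Both sides say that \<open>A\<close> is invertible over the p-adic integers.
\<close>

theorem cok_trivial_iff_det_reduce:
  fixes A :: "'p :: prime_card padic_int mat"
  assumes A: "A \<in> carrier_mat n n"
  shows "cok A \<cong> singleton_group a \<longleftrightarrow> det (map_mat reduce A) \<noteq> 0"
proof -
  let ?Z = "padic_vecs TYPE('p) n" and ?L = "(\<lambda>v. A *\<^sub>v v) ` carrier_vec n"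
  interpret Z: comm_group ?Z by (rule comm_group_vec)
  have L: "subgroup ?L ?Z" by (rule subgroup_mat_image[OF A])
  have cok: "cok A = ?Z Mod ?L" using A by (simp add: cok_def)
  have det: "det (map_mat reduce A) \<noteq> 0 \<longleftrightarrow> det A dvd 1" by (simp add: padic_dvd_1_iff)
  show ?thesis
  proof
    assume "cok A \<cong> singleton_group a"
    then have pow1: "v [^]\<^bsub>?Z\<^esub> (1::nat) \<in> ?L" if "v \<in> carrier_vec n" for v
      using that by (intro Z.pow_mem_of_quotient_iso[OF L]) (auto simp: cok order_def monoid_vec_simps)
    then have surj: "v \<in> ?L" if "v \<in> carrier_vec n" for v
    proof -
      have "1 \<cdot>\<^sub>v v \<in> ?L" using pow1[OF that] unfolding pow_monoid_vec[OF that] by simp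
      then show ?thesis using that by simp
    qed
    have "\<forall>j. \<exists>u. u \<in> carrier_vec n \<and> unit_vec n j = A *\<^sub>v u" using surj[OF unit_vec_carrier] by blast
    then obtain u where u: "\<And>j. u j \<in> carrier_vec n" "\<And>j. unit_vec n j = A *\<^sub>v u j" by metis
    define U where "U = mat n n (\<lambda>(i, j). u j $ i)"
    have U: "U \<in> carrier_mat n n" by (auto simp: U_def)
    have "A * U = 1\<^sub>m n"
    proof (rule eq_matI)
      fix i j assume "i < dim_row (1\<^sub>m n)" "j < dim_col (1\<^sub>m n)"
      then have ij: "i < n" "j < n" by auto
      have "col U j = u j" using ij u(1)[of j] by (intro eq_vecI) (auto simp: U_def)
      then have "(A * U) $$ (i, j) = (A *\<^sub>v u j) $ i" using A U ij by simp
      also have "\<dots> = 1\<^sub>m n $$ (i, j)" using ij by (simp flip: u(2) add: unit_vec_def)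
      finally show "(A * U) $$ (i, j) = 1\<^sub>m n $$ (i, j)" .
    qed (use A U in auto)
    then have "det A * det U = 1" using det_mult[OF A U] by simp
    then have "det A dvd 1" by (metis dvd_triv_left)
    then show "det (map_mat reduce A) \<noteq> 0" using det by simp
  next
    assume "det (map_mat reduce A) \<noteq> 0"
    then have "det A dvd 1" using det by simp
    then have "v \<in> ?L" if "v \<in> carrier_vec n" for v using that by (metis A mat_image_of_unit_det image_eqI)
    then have "?L = carrier_vec n" using A by auto
    moreover have "kernel ?Z (singleton_group a) (\<lambda>_. a) = carrier_vec n"
      by (auto simp: kernel_def monoid_vec_simps singleton_group_def)
    moreover have "group_hom ?Z (singleton_group a) (\<lambda>_. a)"
      by (intro group_hom.intro) (auto simp: group_hom_axioms_def)
    moreover have "(0\<^sub>v n :: 'p padic_int vec) \<in> carrier ?Z" by (simp add: monoid_vec_simps)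
    then have "(\<lambda>_. a) ` carrier ?Z = carrier (singleton_group a)"
      unfolding carrier_singleton_group by (rule image_constant)
    ultimately have "?Z Mod kernel ?Z (singleton_group a) (\<lambda>_. a) \<cong> singleton_group a"
      and "kernel ?Z (singleton_group a) (\<lambda>_. a) = ?L"
      using group_hom.FactGroup_iso by blast+
    then show "cok A \<cong> singleton_group a" by (simp add: cok)
  qed
qed

section \<open>Residues of Haar-random matrices\<close>

lemma residue_disc_borel: "{y :: 'p :: prime_card padic_int. residue y k = a} \<in> sets borel"
  by (rule borel_open) (auto simp: open_padic_int_def)

text \<open>
  The discs of the elements with a given residue are translates of each other, so they have equal measure.
\<close>

lemma prob_residue_haar:
  fixes x :: "'w \<Rightarrow> 'p :: prime_card padic_int"
  assumes M: "prob_space M" and x: "haar_random M x" and a: "a \<in> {0..<int CARD('p) ^ k}"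
  shows "x -` {y. residue y k = a} \<inter> space M \<in> sets M"
    and "measure M (x -` {y. residue y k = a} \<inter> space M) = 1 / real (CARD('p) ^ k)"
proof -
  interpret prob_space M by fact
  let ?D = "\<lambda>a. {y :: 'p padic_int. residue y k = a}" and ?I = "{0..<int CARD('p) ^ k}"
  have xm: "x \<in> borel_measurable M" and haar: "is_haar_prob (distr M borel x)"
    using x by (auto simp: haar_random_def)
  have D: "?D a \<in> sets borel" for a by (rule residue_disc_borel)
  show "x -` ?D a \<inter> space M \<in> sets M" using xm D by (rule measurable_sets)
  have *: "measure M (x -` ?D b \<inter> space M) = measure (distr M borel x) (?D b)" for b
    using xm D by (simp add: measure_distr)
  have eq: "measure (distr M borel x) (?D b) = measure (distr M borel x) (?D 0)" if b: "b \<in> ?I" for b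
  proof -
    let ?b = "of_nat (nat b) :: 'p padic_int"
    have rb: "residue ?b k = b" using b by (subst residue_of_nat) simp
    have "?D b = (+) ?b ` ?D 0"
    proof (intro equalityI subsetI)
      fix y assume "y \<in> ?D b"
      then have "y - ?b \<in> ?D 0" using rb by (simp add: residue_minus)
      moreover have "y = ?b + (y - ?b)" by simp
      ultimately show "y \<in> (+) ?b ` ?D 0" by blast
    next
      fix y assume "y \<in> (+) ?b ` ?D 0"
      then show "y \<in> ?D b" using rb b by (auto simp: residue_plus simp del: of_nat_nat)
    qed
    then show ?thesis using haar D unfolding is_haar_prob_def measure_def by metis
  qed
  have "1 = measure M (space M)" by (simp add: prob_space)
  also have "space M = (\<Union>b\<in>?I. x -` ?D b \<inter> space M)" using residue_range by blast
  also have "measure M \<dots> = (\<Sum>b\<in>?I. measure M (x -` ?D b \<inter> space M))"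
    using measurable_sets[OF xm D] by (intro finite_measure_finite_Union) (auto simp: disjoint_family_on_def)
  also have "\<dots> = (\<Sum>b\<in>?I. measure (distr M borel x) (?D 0))" unfolding * by (intro sum.cong refl eq)
  also have "\<dots> = real (CARD('p) ^ k) * measure M (x -` ?D a \<inter> space M)"
    unfolding * using eq[OF a] by (simp flip: of_nat_power)
  finally show "measure M (x -` ?D a \<inter> space M) = 1 / real (CARD('p) ^ k)"
    by (simp add: field_simps)
qed

definition supp_vecs :: "nat \<Rightarrow> nat \<Rightarrow> nat set \<Rightarrow> (nat \<Rightarrow> int) set" where
  "supp_vecs N n s = (\<Pi>\<^sub>E i\<in>{..<n}. if i \<in> s then {0..<int N} else {0})"

lemma card_supp_vecs: "card (supp_vecs N n s) = N ^ card ({..<n} \<inter> s)"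
proof -
  have "card (supp_vecs N n s) = (\<Prod>i<n. if i \<in> s then N else 1)"
    unfolding supp_vecs_def by (subst card_PiE) (auto intro: prod.cong)
  also have "\<dots> = (\<Prod>i\<in>{..<n} \<inter> s. N)" by (simp add: prod.If_cases)
  finally show ?thesis by simp
qed

lemma finite_supp_vecs: "finite (supp_vecs N n s)"
  unfolding supp_vecs_def by (intro finite_PiE) auto

lemma subgroup_supp_vecs:
  assumes "0 < N"
  shows "subgroup (supp_vecs N n s) (mod_vecs N n)"
  unfolding supp_vecs_def mod_vecs_def
proof (subst PiE_subgroup_product_group)
  show "\<forall>i\<in>{..<n}. subgroup (if i \<in> s then {0..<int N} else {0}) (integer_mod_group N)"
    using assms group.subgroup_self[OF group_integer_mod_group, of N] group.triv_subgroup[OF group_integer_mod_group, of N]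
    by (auto simp: carrier_integer_mod_group)
qed simp

definition support_matrices :: "nat \<Rightarrow> nat \<Rightarrow> (nat \<Rightarrow> nat set) \<Rightarrow> (nat \<Rightarrow> nat \<Rightarrow> int) set" where
  "support_matrices N n \<tau> = (\<Pi>\<^sub>E j\<in>{..<n}. supp_vecs N n (\<tau> j))"

lemma card_support_matrices: "card (support_matrices N n \<tau>) = N ^ (\<Sum>j<n. card ({..<n} \<inter> \<tau> j))"
  unfolding support_matrices_def by (simp add: card_PiE card_supp_vecs power_sum)

lemma finite_support_matrices: "finite (support_matrices N n \<tau>)"
  unfolding support_matrices_def by (intro finite_PiE) (auto simp: finite_supp_vecs)

definition residue_cols :: "nat \<Rightarrow> 'p :: prime_card padic_int mat \<Rightarrow> nat \<Rightarrow> nat \<Rightarrow> int" where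
  "residue_cols k A = (\<lambda>j\<in>{..<dim_col A}. residue_vec k (col A j))"

lemma residue_cols_apply:
  "A \<in> carrier_mat n n \<Longrightarrow> i < n \<Longrightarrow> j < n \<Longrightarrow> residue_cols k A j i = residue (A $$ (i, j)) k"
  by (simp add: residue_cols_def residue_vec_def)

text \<open>
  The supports of the columns with row and column indices starting at \<open>0\<close>, as they are used for matrix entries.
\<close>

definition zero_based :: "(nat \<Rightarrow> nat set) \<Rightarrow> nat \<Rightarrow> nat set" where
  "zero_based \<sigma> j = {i. Suc i \<in> \<sigma> (Suc j)}"

context
  fixes M :: "'w measure" and n :: nat and \<sigma> :: "nat \<Rightarrow> nat set"
    and X :: "'w \<Rightarrow> 'p :: prime_card padic_int mat"
  assumes M: "prob_space M" and X: "haar_matrix_supported M n \<sigma> X"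
begin

interpretation prob_space M by (rule M)

lemma X_carrier: "\<omega> \<in> space M \<Longrightarrow> X \<omega> \<in> carrier_mat n n"
  using X by (auto simp: haar_matrix_supported_def)

lemma residue_cols_mem_support:
  assumes "\<omega> \<in> space M"
  shows "residue_cols k (X \<omega>) \<in> support_matrices (CARD('p) ^ k) n (zero_based \<sigma>)"
proof -
  have zero: "X \<omega> $$ (i, j) = 0" if "i < n" "j < n" "i \<notin> zero_based \<sigma> j" for i j
  proof -
    have "Suc i \<in> {1..n}" "Suc j \<in> {1..n}" "Suc i \<notin> \<sigma> (Suc j)" using that by (auto simp: zero_based_def)
    then have "X \<omega> $$ (Suc i - 1, Suc j - 1) = 0"
      using X assms unfolding haar_matrix_supported_def by blast
    then show ?thesis by simp
  qed
  have r: "0 \<le> residue y k \<and> residue y k < int CARD('p) ^ k" for y :: "'p padic_int"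
    using residue_range[of y k] by simp
  show ?thesis
    unfolding support_matrices_def supp_vecs_def
    using X_carrier[OF assms] r zero
    by (auto simp: PiE_iff residue_cols_def residue_vec_def)
qed

lemma prob_residue_cols_eq:
  assumes u: "u \<in> support_matrices (CARD('p) ^ k) n (zero_based \<sigma>)"
  shows "{\<omega> \<in> space M. residue_cols k (X \<omega>) = u} \<in> sets M"
    and "prob {\<omega> \<in> space M. residue_cols k (X \<omega>) = u} =
      1 / real (card (support_matrices (CARD('p) ^ k) n (zero_based \<sigma>)))"
proof -
  let ?N = "CARD('p) ^ k"
  define S where "S = {(i, j). i \<in> {1..n} \<and> j \<in> {1..n} \<and> i \<in> \<sigma> j}"
  define Y where "Y = (\<lambda>(i, j) \<omega>. X \<omega> $$ (i - 1, j - 1))"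
  define D where "D = (\<lambda>(i, j). {y :: 'p padic_int. residue y k = u (j - 1) (i - 1)})"
  have finS: "finite S" by (rule finite_subset[of _ "{1..n} \<times> {1..n}"]) (auto simp: S_def)
  have indep: "indep_vars (\<lambda>_. borel) Y S" using X by (simp add: haar_matrix_supported_def Y_def S_def)
  have u_range: "u j i \<in> {0..<int ?N}" if "i < n" "j < n" "i \<in> zero_based \<sigma> j" for i j
  proof -
    have "u j \<in> supp_vecs ?N n (zero_based \<sigma> j)" using u that by (auto simp: support_matrices_def)
    from PiE_mem[OF this[unfolded supp_vecs_def], of i] that show ?thesis by simp
  qed
  have ev: "Y s -` D s \<inter> space M \<in> sets M" "prob (Y s -` D s \<inter> space M) = 1 / real ?N" if s: "s \<in> S" for s
  proof -
    obtain i j where ij: "s = (Suc i, Suc j)" "i < n" "j < n" "Suc i \<in> \<sigma> (Suc j)"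
      using s by (cases s; cases "fst s"; cases "snd s") (auto simp: S_def)
    have "haar_random M (\<lambda>\<omega>. X \<omega> $$ (Suc i - 1, Suc j - 1))"
      using X ij unfolding haar_matrix_supported_def by fastforce
    then have h: "haar_random M (Y s)" by (simp add: Y_def ij)
    have "u j i \<in> {0..<int CARD('p) ^ k}" using u_range[of i j] ij by (simp add: zero_based_def)
    from prob_residue_haar[OF M h this]
    show "Y s -` D s \<inter> space M \<in> sets M" "prob (Y s -` D s \<inter> space M) = 1 / real ?N"
      by (simp_all add: D_def ij)
  qed
  have set_eq: "{\<omega> \<in> space M. residue_cols k (X \<omega>) = u} = {\<omega> \<in> space M. \<forall>s\<in>S. Y s \<omega> \<in> D s}"
  proof (intro Collect_cong conj_cong refl)
    fix \<omega> assume w: "\<omega> \<in> space M"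
    let ?R = "residue_cols k (X \<omega>)"
    have R: "?R \<in> support_matrices ?N n (zero_based \<sigma>)" by (rule residue_cols_mem_support[OF w])
    have Rap: "?R j i = residue (X \<omega> $$ (i, j)) k" if "i < n" "j < n" for i j
      using residue_cols_apply[OF X_carrier[OF w] that] .
    show "?R = u \<longleftrightarrow> (\<forall>s\<in>S. Y s \<omega> \<in> D s)"
    proof
      assume "?R = u"
      then show "\<forall>s\<in>S. Y s \<omega> \<in> D s" using Rap by (auto simp: S_def Y_def D_def)
    next
      assume H: "\<forall>s\<in>S. Y s \<omega> \<in> D s"
      have "?R j i = u j i" if ij: "i < n" "j < n" for i j
      proof (cases "i \<in> zero_based \<sigma> j")
        case True
        then have "(Suc i, Suc j) \<in> S" using ij by (simp add: S_def zero_based_def)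
        then have "Y (Suc i, Suc j) \<omega> \<in> D (Suc i, Suc j)" using H by blast
        then show ?thesis using Rap ij by (simp add: Y_def D_def)
      next
        case False
        have "v j i = 0" if "v \<in> support_matrices ?N n (zero_based \<sigma>)" for v
        proof -
          have "v j \<in> supp_vecs ?N n (zero_based \<sigma> j)" using that ij by (auto simp: support_matrices_def)
          from PiE_mem[OF this[unfolded supp_vecs_def], of i] ij False show ?thesis by simp
        qed
        from this[OF R] this[OF u] show ?thesis by simp
      qed
      note eq = this
      have "?R j = u j" if "j < n" for j
      proof (rule extensionalityI[of _ "{..<n}"])
        have "v j \<in> extensional {..<n}" if "v \<in> support_matrices ?N n (zero_based \<sigma>)" for v
          using that \<open>j < n\<close> unfolding support_matrices_def supp_vecs_def by (auto simp: PiE_iff)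
        then show "?R j \<in> extensional {..<n}" "u j \<in> extensional {..<n}" using R u by auto
      qed (use eq that in auto)
      then show "?R = u" using R u unfolding support_matrices_def by (intro PiE_ext) auto
    qed
  qed
  have cardS: "card S = (\<Sum>j<n. card ({..<n} \<inter> zero_based \<sigma> j))"
  proof -
    have "bij_betw (\<lambda>(j, i). (Suc i, Suc j)) (SIGMA j:{..<n}. {..<n} \<inter> zero_based \<sigma> j) S"
      by (rule bij_betw_byWitness[where f' = "\<lambda>(i, j). (j - 1, i - 1)"])
        (auto simp: S_def zero_based_def)
    from bij_betw_same_card[OF this] show ?thesis by (simp add: card_SigmaI)
  qed
  have "{\<omega> \<in> space M. \<forall>s\<in>S. Y s \<omega> \<in> D s} \<in> sets M \<and>
     prob {\<omega> \<in> space M. \<forall>s\<in>S. Y s \<omega> \<in> D s} = (1 / real ?N) ^ card S"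
  proof (cases "S = {}")
    case True
    then show ?thesis by (simp add: prob_space)
  next
    case False
    have *: "{\<omega> \<in> space M. \<forall>s\<in>S. Y s \<omega> \<in> D s} = (\<Inter>s\<in>S. Y s -` D s \<inter> space M)" using False by auto
    have "prob (\<Inter>s\<in>S. Y s -` D s \<inter> space M) = (\<Prod>s\<in>S. prob (Y s -` D s \<inter> space M))"
      using indep False finS by (rule indep_varsD_finite) (auto simp: D_def residue_disc_borel)
    also have "\<dots> = (1 / real ?N) ^ card S" using ev(2) by simp
    finally have "prob (\<Inter>s\<in>S. Y s -` D s \<inter> space M) = (1 / real ?N) ^ card S" .
    moreover have "(\<Inter>s\<in>S. Y s -` D s \<inter> space M) \<in> sets M"
      using finS False by (rule sets.finite_INT) (rule ev(1))
    ultimately show ?thesis unfolding * by blast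
  qed
  then show "{\<omega> \<in> space M. residue_cols k (X \<omega>) = u} \<in> sets M"
    and "prob {\<omega> \<in> space M. residue_cols k (X \<omega>) = u} =
      1 / real (card (support_matrices (CARD('p) ^ k) n (zero_based \<sigma>)))"
    unfolding set_eq card_support_matrices cardS by (simp_all add: power_one_over)
qed

text \<open>
  The matrix of residues is uniformly distributed on \<open>support_matrices\<close>.
\<close>

theorem prob_residue_cols:
  "prob {\<omega> \<in> space M. Q (residue_cols k (X \<omega>))} =
    real (card {u \<in> support_matrices (CARD('p) ^ k) n (zero_based \<sigma>). Q u}) /
    real (card (support_matrices (CARD('p) ^ k) n (zero_based \<sigma>)))"
proof -
  let ?O = "support_matrices (CARD('p) ^ k) n (zero_based \<sigma>)"
  let ?E = "\<lambda>u. {\<omega> \<in> space M. residue_cols k (X \<omega>) = u}"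
  have "{\<omega> \<in> space M. Q (residue_cols k (X \<omega>))} = (\<Union>u\<in>{u \<in> ?O. Q u}. ?E u)"
    using residue_cols_mem_support by auto
  also have "prob \<dots> = (\<Sum>u\<in>{u \<in> ?O. Q u}. prob (?E u))"
    using prob_residue_cols_eq(1) finite_support_matrices
    by (intro finite_measure_finite_Union) (auto simp: disjoint_family_on_def)
  also have "\<dots> = (\<Sum>u\<in>{u \<in> ?O. Q u}. 1 / real (card ?O))"
    by (intro sum.cong refl prob_residue_cols_eq(2)) auto
  finally show ?thesis by simp
qed

end

section \<open>Linear dependencies among staircase columns\<close>

lemma bij_betw_PiE_Un:
  assumes "I \<inter> J = {}"
  shows "bij_betw (\<lambda>f. (restrict f I, restrict f J)) (\<Pi>\<^sub>E i\<in>I \<union> J. A i) ((\<Pi>\<^sub>E i\<in>I. A i) \<times> (\<Pi>\<^sub>E i\<in>J. A i))"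
proof (rule bij_betw_byWitness[where f' = "\<lambda>(g, h). \<lambda>i. if i \<in> I then g i else h i"])
  show "\<forall>f\<in>\<Pi>\<^sub>E i\<in>I \<union> J. A i. (\<lambda>(g, h). \<lambda>i. if i \<in> I then g i else h i) (restrict f I, restrict f J) = f"
    by (auto simp: fun_eq_iff PiE_iff extensional_def)
  show "\<forall>f\<in>(\<Pi>\<^sub>E i\<in>I. A i) \<times> (\<Pi>\<^sub>E i\<in>J. A i).
      (\<lambda>f. (restrict f I, restrict f J)) ((\<lambda>(g, h). \<lambda>i. if i \<in> I then g i else h i) f) = f"
    using assms by (auto simp: fun_eq_iff PiE_iff extensional_def restrict_def)
qed (use assms in \<open>auto simp: PiE_iff extensional_def\<close>)

lemma sum_PiE_Un_prod:
  fixes F :: "_ \<Rightarrow> real"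
  assumes "I \<inter> J = {}"
  shows "(\<Sum>f\<in>(\<Pi>\<^sub>E i\<in>I \<union> J. A i). F (restrict f I) * H (restrict f J)) =
    (\<Sum>f\<in>(\<Pi>\<^sub>E i\<in>I. A i). F f) * (\<Sum>f\<in>(\<Pi>\<^sub>E i\<in>J. A i). H f)"
proof -
  have "(\<Sum>f\<in>(\<Pi>\<^sub>E i\<in>I \<union> J. A i). F (restrict f I) * H (restrict f J)) =
      (\<Sum>z\<in>(\<Pi>\<^sub>E i\<in>I. A i) \<times> (\<Pi>\<^sub>E i\<in>J. A i). F (fst z) * H (snd z))"
    using sum.reindex_bij_betw[OF bij_betw_PiE_Un[OF assms, of A], of "\<lambda>z. F (fst z) * H (snd z)"] by simp
  also have "\<dots> = (\<Sum>f\<in>(\<Pi>\<^sub>E i\<in>I. A i). \<Sum>h\<in>(\<Pi>\<^sub>E i\<in>J. A i). F f * H h)"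
    by (simp add: sum.cartesian_product case_prod_beta)
  finally show ?thesis by (simp add: sum_product)
qed

text \<open>
  The rows in which the linear combination of the columns in \<open>J\<close> with coefficients \<open>c\<close> is random.
\<close>

definition used_rows :: "(nat \<Rightarrow> nat set) \<Rightarrow> nat set \<Rightarrow> (nat \<Rightarrow> nat) \<Rightarrow> nat set" where
  "used_rows \<tau> J c = (\<Union>j\<in>{j \<in> J. c j \<noteq> 0}. \<tau> j)"

lemma sum_PiE_insert:
  fixes F :: "_ \<Rightarrow> real"
  assumes "j \<notin> J"
  shows "(\<Sum>f\<in>(\<Pi>\<^sub>E i\<in>insert j J. A i). F f) = (\<Sum>a\<in>A j. \<Sum>f\<in>(\<Pi>\<^sub>E i\<in>J. A i). F (f(j := a)))"
proof -
  have inj: "inj_on (\<lambda>(a, f). f(j := a)) (A j \<times> (\<Pi>\<^sub>E i\<in>J. A i))" using assms by (rule inj_combinator)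
  show ?thesis unfolding PiE_insert_eq sum.reindex[OF inj]
    by (simp add: sum.cartesian_product case_prod_beta)
qed

text \<open>
  If the supports form a chain, then the used rows are the support of the last column with a nonzero coefficient, and
  fewer than \<open>p ^ Suc i\<close> coefficient vectors have that column at position \<open>i\<close>.
\<close>

lemma sum_used_rows_chain:
  assumes p: "1 < (p::nat)" and inj: "inj_on g {..<s}"
    and chain: "\<And>i i'. i \<le> i' \<Longrightarrow> i' < s \<Longrightarrow> \<tau> (g i) \<subseteq> \<tau> (g i')"
  shows "(\<Sum>c\<in>(\<Pi>\<^sub>E j\<in>g ` {..<s}. {..<p}). (1 / real p) ^ card (used_rows \<tau> (g ` {..<s}) c))
    \<le> 1 + (\<Sum>i<s. real p ^ Suc i * (1 / real p) ^ card (\<tau> (g i)))"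
  using inj chain
proof (induction s)
  case 0
  then show ?case by (simp add: used_rows_def)
next
  case (Suc s)
  let ?J = "g ` {..<s}" and ?q = "1 / real p"
  have new: "g s \<notin> ?J"
  proof
    assume "g s \<in> ?J"
    then obtain i where "i < s" "g s = g i" by auto
    then show False using inj_onD[OF Suc.prems(1), of s i] by auto
  qed
  have ins: "g ` {..<Suc s} = insert (g s) ?J" by (auto simp: lessThan_Suc)
  have zero: "used_rows \<tau> (insert (g s) ?J) (c(g s := 0)) = used_rows \<tau> ?J c" for c
  proof -
    have "{j \<in> insert k K. (c(k := 0)) j \<noteq> 0} = {j \<in> K. c j \<noteq> 0}" if "k \<notin> K" for k K
      using that by auto
    then show ?thesis unfolding used_rows_def using new by simp
  qed
  have nonzero: "used_rows \<tau> (insert (g s) ?J) (c(g s := a)) = \<tau> (g s)" if "a \<noteq> 0" for a c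
  proof
    show "used_rows \<tau> (insert (g s) ?J) (c(g s := a)) \<subseteq> \<tau> (g s)"
    proof
      fix y assume "y \<in> used_rows \<tau> (insert (g s) ?J) (c(g s := a))"
      then obtain j where j: "j \<in> insert (g s) ?J" "y \<in> \<tau> j" by (auto simp: used_rows_def)
      then have "\<exists>i\<le>s. j = g i"
        by (metis imageE insertE lessThan_iff less_or_eq_imp_le order_refl)
      then obtain i where "i \<le> s" "j = g i" by blast
      then show "y \<in> \<tau> (g s)" using Suc.prems(2)[of i s] j by auto
    qed
    show "\<tau> (g s) \<subseteq> used_rows \<tau> (insert (g s) ?J) (c(g s := a))"
      unfolding used_rows_def by (rule UN_upper) (use that in simp)
  qed
  have card_c: "real (card (\<Pi>\<^sub>E j\<in>?J. {..<p})) = real p ^ s"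
    using Suc.prems(1) by (simp add: card_PiE card_image inj_on_subset)
  have split: "{..<p} = insert 0 {1..<p}" using p by auto
  have "(\<Sum>c\<in>(\<Pi>\<^sub>E j\<in>g ` {..<Suc s}. {..<p}). ?q ^ card (used_rows \<tau> (g ` {..<Suc s}) c)) =
      (\<Sum>a\<in>{..<p}. \<Sum>c\<in>(\<Pi>\<^sub>E j\<in>?J. {..<p}). ?q ^ card (used_rows \<tau> (insert (g s) ?J) (c(g s := a))))"
    unfolding ins by (rule sum_PiE_insert[OF new])
  also have "\<dots> = (\<Sum>c\<in>(\<Pi>\<^sub>E j\<in>?J. {..<p}). ?q ^ card (used_rows \<tau> ?J c)) +
      (\<Sum>a\<in>{1..<p}. \<Sum>c\<in>(\<Pi>\<^sub>E j\<in>?J. {..<p}). ?q ^ card (\<tau> (g s)))"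
    by (subst split, subst sum.insert) (auto simp: zero nonzero)
  also have "(\<Sum>a\<in>{1..<p}. \<Sum>c\<in>(\<Pi>\<^sub>E j\<in>?J. {..<p}). ?q ^ card (\<tau> (g s))) =
      real (p - 1) * (real p ^ s * ?q ^ card (\<tau> (g s)))"
    using card_c by simp
  also have "\<dots> \<le> real p * (real p ^ s * ?q ^ card (\<tau> (g s)))"
    by (intro mult_right_mono) auto
  also have "(\<Sum>c\<in>(\<Pi>\<^sub>E j\<in>?J. {..<p}). ?q ^ card (used_rows \<tau> ?J c)) \<le>
      1 + (\<Sum>i<s. real p ^ Suc i * ?q ^ card (\<tau> (g i)))"
    using Suc.prems by (intro Suc.IH) (auto simp: inj_on_def)
  finally show ?case by (simp add: mult.assoc)
qed

text \<open>
  For \<open>d \<ge> 2\<close> the number of coefficient vectors grows more slowly than the supports, so the first terms dominate.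
\<close>

lemma sum_chain_geometric:
  assumes p: "2 \<le> (p::nat)" and d: "2 \<le> d" and len: "\<And>i. i < s \<Longrightarrow> l i = r + d * i"
  shows "(\<Sum>i<s. real p ^ Suc i * (1 / real p) ^ l i) \<le> 2 * real p * (1 / real p) ^ r"
proof -
  have "(\<Sum>i<s. real p ^ Suc i * (1 / real p) ^ l i) \<le> (\<Sum>i<s. real p * (1 / real p) ^ r * (1 / 2) ^ i)"
  proof (rule sum_mono)
    fix i assume "i \<in> {..<s}"
    then have l: "l i = r + d * i" using len by simp
    obtain d' where d': "d = 2 + d'" using d le_Suc_ex by blast
    have "real p ^ Suc i * (1 / real p) ^ l i =
        real p * (1 / real p) ^ r * (real p ^ i * (1 / real p) ^ i) * (1 / real p) ^ i * (1 / real p) ^ (d' * i)"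
      unfolding l d' by (simp add: power_add algebra_simps mult_2)
    also have "real p ^ i * (1 / real p) ^ i = 1" using p by (simp flip: power_mult_distrib)
    also have "real p * (1 / real p) ^ r * 1 * (1 / real p) ^ i * (1 / real p) ^ (d' * i) \<le>
        real p * (1 / real p) ^ r * 1 * (1 / 2) ^ i * 1"
    proof (intro mult_mono order_refl)
      have q: "1 / real p \<le> 1 / 2" using p by (simp add: field_simps)
      then show "(1 / real p) ^ i \<le> (1 / 2) ^ i" by (intro power_mono) auto
      show "(1 / real p) ^ (d' * i) \<le> 1" using q by (intro power_le_one) auto
    qed auto
    finally show "real p ^ Suc i * (1 / real p) ^ l i \<le> real p * (1 / real p) ^ r * (1 / 2) ^ i" by simp
  qed
  also have "\<dots> = real p * (1 / real p) ^ r * (\<Sum>i<s. (1 / 2) ^ i)" by (simp add: sum_distrib_left)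
  also have "\<dots> \<le> real p * (1 / real p) ^ r * 2"
    by (intro mult_left_mono) (auto simp: sum_gp_strict)
  finally show ?thesis by (simp add: mult_ac)
qed

lemma UN_chain_eq_Max:
  fixes S :: "nat set"
  assumes "finite S" "S \<noteq> {}" "\<And>i i'. i \<le> i' \<Longrightarrow> T i \<subseteq> T i'"
  shows "(\<Union>i\<in>S. T i) = T (Max S)"
  using assms Max_in[OF assms(1,2)] by (meson Max_ge UN_least UN_upper subset_antisym)

text \<open>
  The left-hand side bounds the probability of a nontrivial relation among the sparse columns.  The used rows among the first \<open>t\<close>
  columns form an initial segment, and those among the last \<open>t\<close> columns form a final segment.  If the two segments cover
  all rows, the probability of the relation is at most \<open>p\<^sup>-\<^sup>n\<close>, and there are \<open>p\<^sup>2\<^sup>t\<close> coefficient vectors; here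
  \<open>2 t + r \<le> n\<close>.  Otherwise the segments are disjoint, and the sum factors into two sums over chains.
  The trivial relation accounts for the summand \<open>1\<close> that is subtracted.
\<close>

lemma stairs_dependency_sum:
  fixes p d t n r :: nat and \<tau> :: "nat \<Rightarrow> nat set"
  assumes p: "2 \<le> p" and d: "2 \<le> d" and n: "n = r + d * t"
    and left: "\<And>j. j < t \<Longrightarrow> \<tau> j = {..<r + d * j}"
    and right: "\<And>j. j < t \<Longrightarrow> \<tau> (n - Suc j) = {n - (r + d * j)..<n}"
  defines "J \<equiv> {..<t} \<union> {n - t..<n}" and "x \<equiv> (1 / real p) ^ r"
  shows "(\<Sum>c\<in>(\<Pi>\<^sub>E j\<in>J. {..<p}) - {\<lambda>j\<in>J. 0}. (1 / real p) ^ card (used_rows \<tau> J c))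
     \<le> x + (1 + 2 * real p * x) ^ 2 - 1"
proof -
  let ?q = "1 / real p" and ?I = "{..<t}" and ?K = "{n - t..<n}" and ?C = "\<Pi>\<^sub>E j\<in>J. {..<p}"
  let ?z = "\<lambda>j\<in>J. 0 :: nat"
  have p1: "1 < p" using p by simp
  have q: "0 \<le> ?q" "?q \<le> 1" using p by auto
  have tn: "2 * t + r \<le> n" unfolding n using d by simp
  have IK: "?I \<inter> ?K = {}" using tn by auto
  have K: "?K = (\<lambda>i. n - Suc i) ` ?I"
  proof (intro equalityI subsetI)
    fix j assume "j \<in> ?K"
    then show "j \<in> (\<lambda>i. n - Suc i) ` ?I" using tn by (intro image_eqI[of _ _ "n - Suc j"]) auto
  qed (use tn in auto)
  have lenr: "r + d * j \<le> n" if "j < t" for j unfolding n using that by simp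
  have F1: "(\<Sum>c\<in>(\<Pi>\<^sub>E j\<in>?I. {..<p}). ?q ^ card (used_rows \<tau> ?I c)) \<le> 1 + 2 * real p * x"
  proof -
    have "(\<Sum>c\<in>(\<Pi>\<^sub>E j\<in>id ` ?I. {..<p}). ?q ^ card (used_rows \<tau> (id ` ?I) c)) \<le>
        1 + (\<Sum>i<t. real p ^ Suc i * ?q ^ card (\<tau> (id i)))"
      by (rule sum_used_rows_chain[OF p1]) (auto simp: left intro: order.strict_trans2)
    also have "(\<Sum>i<t. real p ^ Suc i * ?q ^ card (\<tau> (id i))) \<le> 2 * real p * ?q ^ r"
      by (rule sum_chain_geometric[OF p d]) (simp add: left)
    finally show ?thesis by (simp add: x_def)
  qed
  have F2: "(\<Sum>c\<in>(\<Pi>\<^sub>E j\<in>?K. {..<p}). ?q ^ card (used_rows \<tau> ?K c)) \<le> 1 + 2 * real p * x"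
  proof -
    have inj: "inj_on (\<lambda>i. n - Suc i) ?I" using tn by (intro inj_onI) auto
    have "(\<Sum>c\<in>(\<Pi>\<^sub>E j\<in>(\<lambda>i. n - Suc i) ` ?I. {..<p}). ?q ^ card (used_rows \<tau> ((\<lambda>i. n - Suc i) ` ?I) c)) \<le>
        1 + (\<Sum>i<t. real p ^ Suc i * ?q ^ card (\<tau> (n - Suc i)))"
    proof (rule sum_used_rows_chain[OF p1 inj])
      fix i i' assume "i \<le> i'" "i' < t"
      moreover then have "n - (r + d * i') \<le> n - (r + d * i)"
        by (intro diff_le_mono2 add_left_mono mult_le_mono2)
      ultimately show "\<tau> (n - Suc i) \<subseteq> \<tau> (n - Suc i')" by (simp add: right)
    qed
    also have "(\<Sum>i<t. real p ^ Suc i * ?q ^ card (\<tau> (n - Suc i))) \<le> 2 * real p * ?q ^ r"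
      using lenr by (intro sum_chain_geometric[OF p d]) (simp add: right)
    finally show ?thesis unfolding K by (simp add: x_def)
  qed
  have Max_less: "Max S < t" if "S \<subseteq> ?I" "S \<noteq> {}" for S
    using that finite_subset[OF that(1)] Max_in[of S] by auto
  have initial: "\<exists>\<alpha>\<le>n. used_rows \<tau> ?I c = {..<\<alpha>}" for c
  proof (cases "{j \<in> ?I. c j \<noteq> 0} = {}")
    case True
    then show ?thesis unfolding used_rows_def by (intro exI[of _ 0]) (simp only: True, simp)
  next
    case False
    let ?S = "{j \<in> ?I. c j \<noteq> 0}"
    have "used_rows \<tau> ?I c = (\<Union>j\<in>?S. {..<r + d * j})"
      unfolding used_rows_def using left by (intro SUP_cong) auto
    also have "\<dots> = {..<r + d * Max ?S}" using False by (intro UN_chain_eq_Max) auto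
    finally show ?thesis using lenr[OF Max_less[OF _ False]] by blast
  qed
  have final: "\<exists>\<beta>\<le>n. used_rows \<tau> ?K c = {n - \<beta>..<n}" for c
  proof -
    let ?S = "{j \<in> ?I. c (n - Suc j) \<noteq> 0}"
    have ur: "used_rows \<tau> ?K c = (\<Union>j\<in>?S. {n - (r + d * j)..<n})" unfolding K by (auto simp: used_rows_def right)
    show ?thesis
    proof (cases "?S = {}")
      case True
      then show ?thesis unfolding ur by (intro exI[of _ 0]) (simp only: True, simp)
    next
      case False
      have "(\<Union>j\<in>?S. {n - (r + d * j)..<n}) = {n - (r + d * Max ?S)..<n}"
      proof (intro UN_chain_eq_Max False)
        fix i i' :: nat assume "i \<le> i'"
        then have "n - (r + d * i') \<le> n - (r + d * i)" by (intro diff_le_mono2 add_left_mono mult_le_mono2)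
        then show "{n - (r + d * i)..<n} \<subseteq> {n - (r + d * i')..<n}" by simp
      qed simp
      then show ?thesis unfolding ur using lenr[OF Max_less[OF _ False]] by blast
    qed
  qed
  \<comment> \<open>One of the two summands is the term itself: the first one if the segments cover all rows,
    the second one if they are disjoint.\<close>
  have bound: "?q ^ card (used_rows \<tau> J c) \<le>
      ?q ^ n + ?q ^ card (used_rows \<tau> ?I (restrict c ?I)) * ?q ^ card (used_rows \<tau> ?K (restrict c ?K))" for c
  proof -
    have ur: "used_rows \<tau> ?I (restrict c ?I) = used_rows \<tau> ?I c" "used_rows \<tau> ?K (restrict c ?K) = used_rows \<tau> ?K c"
      by (auto simp: used_rows_def)
    have J: "used_rows \<tau> J c = used_rows \<tau> ?I c \<union> used_rows \<tau> ?K c" by (auto simp: used_rows_def J_def)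
    obtain \<alpha> where \<alpha>: "\<alpha> \<le> n" "used_rows \<tau> ?I c = {..<\<alpha>}" using initial by blast
    obtain \<beta> where \<beta>: "\<beta> \<le> n" "used_rows \<tau> ?K c = {n - \<beta>..<n}" using final by blast
    show ?thesis
    proof (cases "n - \<beta> \<le> \<alpha>")
      case True
      then have "used_rows \<tau> J c = {..<n}" using \<alpha> \<beta> by (auto simp: J)
      then show ?thesis using q by simp
    next
      case False
      then have "card (used_rows \<tau> J c) = \<alpha> + \<beta>" unfolding J \<alpha>(2) \<beta>(2) using \<alpha>(1) \<beta>(1)
        by (subst card_Un_disjoint) auto
      then show ?thesis unfolding ur \<alpha>(2) \<beta>(2) using \<beta>(1) q by (simp add: power_add)
    qed
  qed
  have J: "finite J" "card J = 2 * t" using tn IK by (auto simp: J_def card_Un_disjoint)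
  have zC: "?z \<in> ?C" using p by auto
  have cardC: "real (card ?C) = real p ^ (2 * t)"
    unfolding card_PiE[OF J(1)] prod_constant card_lessThan J(2) by (rule of_nat_power)
  have finC: "finite ?C" using J by (intro finite_PiE) auto
  let ?T = "\<lambda>c. ?q ^ card (used_rows \<tau> ?I (restrict c ?I)) * ?q ^ card (used_rows \<tau> ?K (restrict c ?K))"
  have z: "?q ^ card (used_rows \<tau> J ?z) = 1" by (simp add: used_rows_def)
  have minus: "(\<Sum>c\<in>?C - {?z}. ?q ^ card (used_rows \<tau> J c)) = (\<Sum>c\<in>?C. ?q ^ card (used_rows \<tau> J c)) - 1"
    using sum_diff1[OF finC, of "\<lambda>c. ?q ^ card (used_rows \<tau> J c)" ?z] zC z by (simp only: if_True)
  have "(\<Sum>c\<in>?C. ?q ^ card (used_rows \<tau> J c)) \<le> (\<Sum>c\<in>?C. ?q ^ n + ?T c)"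
    by (intro sum_mono bound)
  moreover have "(\<Sum>c\<in>?C. ?q ^ n + ?T c) = real p ^ (2 * t) * ?q ^ n + (\<Sum>c\<in>?C. ?T c)"
    by (simp only: sum.distrib sum_constant cardC)
  moreover have "(\<Sum>c\<in>?C. ?T c) = (\<Sum>c\<in>(\<Pi>\<^sub>E j\<in>?I. {..<p}). ?q ^ card (used_rows \<tau> ?I c)) *
      (\<Sum>c\<in>(\<Pi>\<^sub>E j\<in>?K. {..<p}). ?q ^ card (used_rows \<tau> ?K c))"
    unfolding J_def by (rule sum_PiE_Un_prod[OF IK])
  moreover have "(\<Sum>c\<in>(\<Pi>\<^sub>E j\<in>?I. {..<p}). ?q ^ card (used_rows \<tau> ?I c)) *
      (\<Sum>c\<in>(\<Pi>\<^sub>E j\<in>?K. {..<p}). ?q ^ card (used_rows \<tau> ?K c)) \<le> (1 + 2 * real p * x) * (1 + 2 * real p * x)"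
    using q by (intro mult_mono F1 F2) (auto simp: x_def intro!: sum_nonneg add_nonneg_nonneg)
  moreover have "real p ^ (2 * t) * ?q ^ n \<le> x"
  proof -
    obtain e where e: "n = 2 * t + r + e" using tn le_Suc_ex by blast
    have "real p ^ (2 * t) * ?q ^ n = (real p * ?q) ^ (2 * t) * ?q ^ r * ?q ^ e"
      unfolding e power_add power_mult_distrib by (simp only: mult.assoc)
    also have "\<dots> = ?q ^ r * ?q ^ e" using p by simp
    also have "\<dots> \<le> ?q ^ r * 1" using q by (intro mult_left_mono power_le_one) auto
    finally show ?thesis by (simp add: x_def)
  qed
  ultimately show ?thesis unfolding minus power2_eq_square by linarith
qed

section \<open>Dependent and independent sparse columns\<close>

lemma supp_vecs_full: "0 < N \<Longrightarrow> supp_vecs N n {..<n} = carrier (mod_vecs N n)"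
  unfolding supp_vecs_def carrier_mod_vecs by (intro PiE_cong) auto

lemma supp_vecs_subset: "0 < N \<Longrightarrow> supp_vecs N n s \<subseteq> carrier (mod_vecs N n)"
  using subgroup.subset[OF subgroup_supp_vecs] .

lemma word_in_powers_imp_dvd:
  assumes p: "0 < (p::nat)" and k: "0 < k" and x: "x \<in> J \<rightarrow> carrier (mod_vecs (p ^ k) n)" and J: "finite J"
    and w: "word (mod_vecs (p ^ k) n) x J c \<in> powers (mod_vecs (p ^ k) n) p (carrier (mod_vecs (p ^ k) n))"
    and i: "i < n"
  shows "int p dvd (\<Sum>j\<in>J. int (c j) * x j i)"
proof -
  have "int p dvd (\<Sum>j\<in>J. int (c j) * x j i) mod int (p ^ k)"
    using powers_mod_vecs[OF p k w i] i unfolding word_mod_vecs[OF x J] by simp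
  moreover have "int p dvd int (p ^ k)" using k by (simp add: dvd_power)
  ultimately show ?thesis by (simp only: dvd_mod_iff)
qed

text \<open>
  For every used row \<open>i\<close> choose a column \<open>g i\<close> with a nonzero coefficient that supports this row.  Adding \<open>b i < p\<close> to
  the entry in row \<open>i\<close> of column \<open>g i\<close> changes the linear combination in row \<open>i\<close> by \<open>c (g i) * b i\<close>, which is a
  different class modulo \<open>p\<close> for each \<open>b i\<close>.  So the translates of the set of matrices that satisfy the relation are disjoint.
\<close>

lemma card_dependency_le:
  assumes p: "prime (p::nat)" and k: "0 < k" and J: "J \<subseteq> {..<n}" and c: "c \<in> (\<Pi>\<^sub>E j\<in>J. {..<p})"
  shows "card {x \<in> support_matrices (p ^ k) n \<tau>. word (mod_vecs (p ^ k) n) x J c \<in>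
      powers (mod_vecs (p ^ k) n) p (carrier (mod_vecs (p ^ k) n))} * p ^ card (used_rows \<tau> J c \<inter> {..<n})
    \<le> card (support_matrices (p ^ k) n \<tau>)"
proof -
  let ?N = "p ^ k" and ?R = "used_rows \<tau> J c \<inter> {..<n}" and ?O = "support_matrices (p ^ k) n \<tau>"
  let ?Bad = "{x \<in> ?O. word (mod_vecs ?N n) x J c \<in> powers (mod_vecs ?N n) p (carrier (mod_vecs ?N n))}"
  have p0: "0 < p" using p prime_gt_0_nat by auto
  have N0: "0 < ?N" using p0 by simp
  have finJ: "finite J" using J finite_subset by blast
  have "\<forall>i\<in>?R. \<exists>j. j \<in> J \<and> c j \<noteq> 0 \<and> i \<in> \<tau> j" by (auto simp: used_rows_def)
  then obtain g where g: "\<And>i. i \<in> ?R \<Longrightarrow> g i \<in> J \<and> c (g i) \<noteq> 0 \<and> i \<in> \<tau> (g i)" by metis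
  define sh where "sh x b = (\<lambda>j\<in>{..<n}. \<lambda>i\<in>{..<n}. if i \<in> ?R \<and> j = g i then (x j i + int (b i)) mod int ?N else x j i)"
    for x :: "nat \<Rightarrow> nat \<Rightarrow> int" and b :: "nat \<Rightarrow> nat"
  have O: "x j i \<in> (if i \<in> \<tau> j then {0..<int ?N} else {0})" if "x \<in> ?O" "j < n" "i < n" for x j i
  proof -
    have "x j \<in> supp_vecs ?N n (\<tau> j)" using that by (auto simp: support_matrices_def)
    from PiE_mem[OF this[unfolded supp_vecs_def], of i] that show ?thesis by simp
  qed
  have shO: "sh x b \<in> ?O" if "x \<in> ?O" for x b
    unfolding support_matrices_def supp_vecs_def
  proof (intro PiE_I)
    fix j i assume ji: "j \<in> {..<n}" "i \<in> {..<n}"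
    then have "i \<in> \<tau> j" if "i \<in> ?R \<and> j = g i" using g[of i] that by auto
    moreover have "0 \<le> a mod int ?N" "a mod int ?N < int ?N" for a using N0 by (simp_all del: of_nat_power)
    ultimately show "sh x b j i \<in> (if i \<in> \<tau> j then {0..<int ?N} else {0})"
      using O[OF that, of j i] ji by (auto simp: sh_def simp del: of_nat_power)
  qed (auto simp: sh_def)
  have inj: "inj_on (\<lambda>(x, b). sh x b) (?Bad \<times> (\<Pi>\<^sub>E i\<in>?R. {..<p}))"
  proof (rule inj_onI)
    fix z z' assume z: "z \<in> ?Bad \<times> (\<Pi>\<^sub>E i\<in>?R. {..<p})" and z': "z' \<in> ?Bad \<times> (\<Pi>\<^sub>E i\<in>?R. {..<p})"
      and zz: "(\<lambda>(x, b). sh x b) z = (\<lambda>(x, b). sh x b) z'"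
    obtain x b x' b' where zx: "z = (x, b)" "z' = (x', b')" by (cases z; cases z')
    have x: "x \<in> ?O" and bad: "word (mod_vecs ?N n) x J c \<in> powers (mod_vecs ?N n) p (carrier (mod_vecs ?N n))"
      and b: "b \<in> (\<Pi>\<^sub>E i\<in>?R. {..<p})"
      using z unfolding zx by (simp_all only: mem_Sigma_iff mem_Collect_eq)
    have x': "x' \<in> ?O" and bad': "word (mod_vecs ?N n) x' J c \<in> powers (mod_vecs ?N n) p (carrier (mod_vecs ?N n))"
      and b': "b' \<in> (\<Pi>\<^sub>E i\<in>?R. {..<p})"
      using z' unfolding zx by (simp_all only: mem_Sigma_iff mem_Collect_eq)
    have eq: "sh x b = sh x' b'" using zz unfolding zx by (simp only: prod.case)
    have sum_cong: "[(\<Sum>j\<in>J. int (c j) * sh z a j i) = int (c (g i)) * int (a i)] (mod int p)"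
      if z: "z \<in> ?O" "word (mod_vecs ?N n) z J c \<in> powers (mod_vecs ?N n) p (carrier (mod_vecs ?N n))"
        and i: "i \<in> ?R" for z a i
    proof -
      have zV: "z \<in> J \<rightarrow> carrier (mod_vecs ?N n)"
        using z(1) J supp_vecs_subset[OF N0] by (fastforce simp: support_matrices_def)
      have dvd: "int p dvd (\<Sum>j\<in>J. int (c j) * z j i)"
        using word_in_powers_imp_dvd[OF p0 k zV finJ z(2)] i by simp
      have pN: "int p dvd int ?N" using k by (simp add: dvd_power)
      have "[sh z a j i = z j i + (if j = g i then int (a i) else 0)] (mod int p)" if "j \<in> J" for j
        using i that J pN by (auto simp: sh_def cong_def mod_mod_cancel simp del: of_nat_power)
      then have "[(\<Sum>j\<in>J. int (c j) * sh z a j i) =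
          (\<Sum>j\<in>J. int (c j) * (z j i + (if j = g i then int (a i) else 0)))] (mod int p)"
        by (intro cong_sum cong_mult cong_refl)
      also have "(\<Sum>j\<in>J. int (c j) * (z j i + (if j = g i then int (a i) else 0))) =
          (\<Sum>j\<in>J. int (c j) * z j i) + (\<Sum>j\<in>J. if j = g i then int (c j) * int (a i) else 0)"
        unfolding sum.distrib[symmetric] by (intro sum.cong refl) (simp add: distrib_left)
      also have "(\<Sum>j\<in>J. if j = g i then int (c j) * int (a i) else 0) = int (c (g i)) * int (a i)"
        using g[OF i] finJ by (simp add: sum.delta)
      also have "[(\<Sum>j\<in>J. int (c j) * z j i) + int (c (g i)) * int (a i) = 0 + int (c (g i)) * int (a i)] (mod int p)"
        using dvd by (intro cong_add cong_refl) (simp add: cong_0_iff)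
      finally show ?thesis by simp
    qed
    have "b i = b' i" if i: "i \<in> ?R" for i
    proof -
      have "[int (c (g i)) * int (b i) = int (c (g i)) * int (b' i)] (mod int p)"
        using sum_cong[OF x bad i, of b] sum_cong[OF x' bad' i, of b'] unfolding eq by (metis cong_sym cong_trans)
      then have "[c (g i) * b i = c (g i) * b' i] (mod p)" by (simp flip: of_nat_mult add: cong_int_iff)
      moreover have "coprime (c (g i)) p"
      proof -
        have "c (g i) < p" "0 < c (g i)" using g[OF i] c by auto
        then show ?thesis using p by (metis coprime_commute nat_dvd_not_less prime_imp_coprime_nat)
      qed
      ultimately have "[b i = b' i] (mod p)" by (simp add: cong_mult_lcancel_nat)
      moreover have "b i < p" "b' i < p" using b b' i by auto
      ultimately show ?thesis by (simp add: cong_def)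
    qed
    then have bb: "b = b'" using b b' by (intro PiE_ext) auto
    have xx: "x j i = x' j i" if "j < n" "i < n" for j i
    proof (cases "i \<in> ?R \<and> j = g i")
      case True
      have "(x j i + int (b i)) mod int ?N = (x' j i + int (b i)) mod int ?N"
        using fun_cong[OF fun_cong[OF eq, of j], of i] that True unfolding bb sh_def by (simp del: of_nat_power)
      then have "x j i mod int ?N = x' j i mod int ?N" by (simp add: mod_eq_dvd_iff del: of_nat_power)
      moreover have "x j i \<in> {0..<int ?N}" "x' j i \<in> {0..<int ?N}"
        using O[OF x, of j i] O[OF x', of j i] that True g[of i] by (auto simp del: of_nat_power)
      ultimately show ?thesis by (simp del: of_nat_power)
    next
      case False
      then show ?thesis using fun_cong[OF fun_cong[OF eq, of j], of i] that unfolding sh_def by auto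
    qed
    have "x j = x' j" if "j < n" for j
    proof -
      have "x j \<in> supp_vecs ?N n (\<tau> j)" "x' j \<in> supp_vecs ?N n (\<tau> j)"
        using x x' that by (auto simp: support_matrices_def)
      then show ?thesis unfolding supp_vecs_def using xx that by (intro PiE_ext) auto
    qed
    then have "x = x'" using x x' unfolding support_matrices_def by (intro PiE_ext) auto
    with bb show "z = z'" unfolding zx by simp
  qed
  have "card ?Bad * p ^ card ?R = card (?Bad \<times> (\<Pi>\<^sub>E i\<in>?R. {..<p}))"
    by (simp add: card_cartesian_product card_PiE)
  also have "\<dots> = card ((\<lambda>(x, b). sh x b) ` (?Bad \<times> (\<Pi>\<^sub>E i\<in>?R. {..<p})))"
    using inj by (rule card_image[symmetric])
  also have "\<dots> \<le> card ?O"
    using shO by (intro card_mono finite_support_matrices) auto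
  finally show ?thesis .
qed

text \<open>
  This is the union bound over all nontrivial relations.
\<close>

lemma card_dependent_le:
  assumes p: "prime (p::nat)" and k: "0 < k" and J: "J \<subseteq> {..<n}" and \<tau>: "\<And>j. j \<in> J \<Longrightarrow> \<tau> j \<subseteq> {..<n}"
  defines "V \<equiv> mod_vecs (p ^ k) n"
  shows "real (card {x \<in> support_matrices (p ^ k) n \<tau>. \<not> indep_mod V p (powers V p (carrier V)) x J})
    \<le> real (card (support_matrices (p ^ k) n \<tau>)) *
      (\<Sum>c\<in>(\<Pi>\<^sub>E j\<in>J. {..<p}) - {\<lambda>j\<in>J. 0}. (1 / real p) ^ card (used_rows \<tau> J c))"
proof -
  let ?O = "support_matrices (p ^ k) n \<tau>" and ?P = "powers V p (carrier V)"
  let ?C = "(\<Pi>\<^sub>E j\<in>J. {..<p}) - {\<lambda>j\<in>J. 0}" and ?B = "\<lambda>c. {x \<in> ?O. word V x J c \<in> ?P}"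
  have p0: "0 < p" using p prime_gt_0_nat by auto
  have finJ: "finite J" using J finite_subset by blast
  have finC: "finite ?C" using finJ by (intro finite_Diff finite_PiE) auto
  have "{x \<in> ?O. \<not> indep_mod V p ?P x J} \<subseteq> (\<Union>c\<in>?C. ?B c)"
  proof
    fix x assume "x \<in> {x \<in> ?O. \<not> indep_mod V p ?P x J}"
    then obtain c j where c: "x \<in> ?O" "c \<in> (\<Pi>\<^sub>E j\<in>J. {..<p})" "word V x J c \<in> ?P" "j \<in> J" "c j \<noteq> 0"
      unfolding indep_mod_def by blast
    then have "c \<noteq> (\<lambda>j\<in>J. 0)" by (metis restrict_apply')
    then show "x \<in> (\<Union>c\<in>?C. ?B c)" using c by blast
  qed
  then have "card {x \<in> ?O. \<not> indep_mod V p ?P x J} \<le> card (\<Union>c\<in>?C. ?B c)"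
    using finC finite_support_matrices by (intro card_mono finite_UN_I) auto
  also have "\<dots> \<le> (\<Sum>c\<in>?C. card (?B c))" using finC by (rule card_UN_le)
  finally have "real (card {x \<in> ?O. \<not> indep_mod V p ?P x J}) \<le> (\<Sum>c\<in>?C. real (card (?B c)))"
    unfolding of_nat_sum[symmetric] of_nat_le_iff .
  also have "\<dots> \<le> (\<Sum>c\<in>?C. real (card ?O) * (1 / real p) ^ card (used_rows \<tau> J c))"
  proof (rule sum_mono)
    fix c assume c: "c \<in> ?C"
    have "used_rows \<tau> J c \<inter> {..<n} = used_rows \<tau> J c" using \<tau> by (auto simp: used_rows_def)
    then have "card (?B c) * p ^ card (used_rows \<tau> J c) \<le> card ?O"
      using card_dependency_le[OF p k J, of c \<tau>] c unfolding V_def by simp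
    then have "real (card (?B c)) * real p ^ card (used_rows \<tau> J c) \<le> real (card ?O)"
      unfolding of_nat_power[symmetric] of_nat_mult[symmetric] of_nat_le_iff .
    moreover have "0 < real p ^ card (used_rows \<tau> J c)" using p0 by simp
    ultimately have "real (card (?B c)) \<le> real (card ?O) / real p ^ card (used_rows \<tau> J c)"
      by (simp only: pos_le_divide_eq)
    then show "real (card (?B c)) \<le> real (card ?O) * (1 / real p) ^ card (used_rows \<tau> J c)"
      by (simp add: power_one_over)
  qed
  finally show ?thesis by (simp add: sum_distrib_left)
qed

lemma card_Collect_bij_betw:
  assumes "bij_betw f A B"
  shows "card {x \<in> A. P (f x)} = card {y \<in> B. P y}"
proof -
  have "bij_betw f {x \<in> A. P (f x)} {y \<in> B. P y}"
    using assms by (auto simp: bij_betw_def inj_on_def)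
  then show ?thesis by (rule bij_betw_same_card)
qed

text \<open>
  The probability that the cokernel of a square Haar-random matrix with full support, whose columns are indexed by \<open>J\<close>,
  is isomorphic to \<open>A\<close>.
\<close>

definition haar_cok_prob :: "nat \<Rightarrow> 'b set \<Rightarrow> ('a, 'c) monoid_scheme \<Rightarrow> real" where
  "haar_cok_prob p J A = real (card (gen_tuples A J)) / real (card (carrier A)) ^ card J *
     euler_prod p (card J) / real (card (auto A))"

text \<open>
  For each choice of the sparse columns that is independent modulo \<open>p\<close>, the proportion of full columns that lead to the cokernel
  \<open>A\<close> is exactly \<open>haar_cok_prob\<close>.  This number is at most \<open>1\<close>, so the error is at most the number of
  matrices whose sparse columns are dependent.
\<close>

lemma cok_count_near_haar:
  fixes A (structure)
  assumes p: "prime (p::nat)" and A: "comm_group A" "finite (carrier A)" "order A = p ^ e"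
    and Js: "Js \<inter> Jf = {}" "Js \<union> Jf = {..<n}" and full: "\<And>j. j \<in> Jf \<Longrightarrow> \<tau> j = {..<n}"
  defines "V \<equiv> mod_vecs (p ^ Suc e) n" and "Om \<equiv> support_matrices (p ^ Suc e) n \<tau>"
  shows "\<bar>real (card {x \<in> Om. V Mod generate V (x ` {..<n}) \<cong> A}) - haar_cok_prob p Jf A * real (card Om)\<bar> \<le>
     real (card {x \<in> Om. \<not> indep_mod V p (powers V p (carrier V)) x Js})"
proof -
  interpret A: comm_group A by fact
  interpret V: comm_group V unfolding V_def by (rule comm_group_mod_vecs)
  let ?N = "p ^ Suc e" and ?P = "powers V p (carrier V)" and ?q = "haar_cok_prob p Jf A"
  have p0: "0 < p" "1 < p" using p prime_gt_0_nat prime_gt_1_nat by auto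
  have N0: "0 < ?N" using p0 by simp
  have finJ: "finite Js" "finite Jf" using Js(2) by (metis finite_Un finite_lessThan)+
  have cJ: "card Js + card Jf = n" using Js finJ by (metis card_Un_disjoint card_lessThan)
  let ?S = "\<Pi>\<^sub>E j\<in>Js. supp_vecs ?N n (\<tau> j)" and ?Y = "\<Pi>\<^sub>E j\<in>Jf. carrier V"
  let ?good = "\<lambda>x. indep_mod V p ?P x Js" and ?iso = "\<lambda>x. V Mod generate V (x ` {..<n}) \<cong> A"
  have finV: "finite (carrier V)" unfolding V_def using N0 by (rule finite_mod_vecs)
  have finS: "finite ?S" using finJ by (intro finite_PiE) (auto simp: finite_supp_vecs)
  have finY: "finite ?Y" using finJ finV by (intro finite_PiE) auto
  have finO: "finite Om" unfolding Om_def by (rule finite_support_matrices)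
  have "?Y = (\<Pi>\<^sub>E j\<in>Jf. supp_vecs ?N n (\<tau> j))"
    unfolding V_def using full supp_vecs_full[OF N0] by (intro PiE_cong) auto
  then have bij: "bij_betw (\<lambda>x. (restrict x Js, restrict x Jf)) Om (?S \<times> ?Y)"
    using bij_betw_PiE_Un[OF Js(1), of "\<lambda>j. supp_vecs ?N n (\<tau> j)"] unfolding Om_def support_matrices_def Js(2) by simp
  have SV: "S \<in> Js \<rightarrow> carrier V" if "S \<in> ?S" for S
    unfolding V_def using that supp_vecs_subset[OF N0] by (fastforce simp: PiE_iff)
  have good_restrict: "?good (restrict x Js) \<longleftrightarrow> ?good x" if "x \<in> Om" for x
  proof -
    have x: "x \<in> Js \<rightarrow> carrier V" using that Js supp_vecs_subset[OF N0] unfolding Om_def V_def support_matrices_def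
      by (fastforce simp: PiE_iff)
    have "word V (restrict x Js) Js c = word V x Js c" for c
      unfolding word_def using x by (intro V.finprod_cong') auto
    then show ?thesis by (simp add: indep_mod_def)
  qed
  have iso_restrict: "?iso x \<longleftrightarrow> V Mod generate V (restrict x Js ` Js \<union> restrict x Jf ` Jf) \<cong> A" for x
  proof -
    have "x ` {..<n} = restrict x Js ` Js \<union> restrict x Jf ` Jf" using Js(2) by (simp flip: Js(2) add: image_Un)
    then show ?thesis by simp
  qed
  let ?f = "\<lambda>S. {Y \<in> ?Y. V Mod generate V (S ` Js \<union> Y ` Jf) \<cong> A}"
  have c1: "card {x \<in> Om. ?good x \<and> ?iso x} = (\<Sum>S\<in>{S \<in> ?S. ?good S}. card (?f S))"
  proof -
    have "{x \<in> Om. ?good x \<and> ?iso x} = {x \<in> Om. (\<lambda>(S, Y). ?good S \<and> Y \<in> ?f S) (restrict x Js, restrict x Jf)}"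
      using bij_betwE[OF bij] good_restrict iso_restrict by auto
    then have "card {x \<in> Om. ?good x \<and> ?iso x} = card {z \<in> ?S \<times> ?Y. (\<lambda>(S, Y). ?good S \<and> Y \<in> ?f S) z}"
      using card_Collect_bij_betw[OF bij, of "\<lambda>(S, Y). ?good S \<and> Y \<in> ?f S"] by simp
    also have "{z \<in> ?S \<times> ?Y. (\<lambda>(S, Y). ?good S \<and> Y \<in> ?f S) z} = (SIGMA S:{S \<in> ?S. ?good S}. ?f S)" by auto
    also have "card \<dots> = (\<Sum>S\<in>{S \<in> ?S. ?good S}. card (?f S))" using finS finY by (intro card_SigmaI) auto
    finally show ?thesis .
  qed
  have c2: "card {x \<in> Om. ?good x} = card {S \<in> ?S. ?good S} * card ?Y"
  proof -
    have "{x \<in> Om. ?good x} = {x \<in> Om. (\<lambda>(S, Y). ?good S) (restrict x Js, restrict x Jf)}"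
      using good_restrict by auto
    then have "card {x \<in> Om. ?good x} = card {z \<in> ?S \<times> ?Y. (\<lambda>(S, Y). ?good S) z}"
      using card_Collect_bij_betw[OF bij, of "\<lambda>(S, Y). ?good S"] by simp
    also have "{z \<in> ?S \<times> ?Y. (\<lambda>(S, Y). ?good S) z} = {S \<in> ?S. ?good S} \<times> ?Y" by auto
    finally show ?thesis by (simp add: card_cartesian_product)
  qed
  have aut0: "card (auto A) \<ge> 1" using card_auto_pos[OF A.is_group A(2)] by simp
  have cA: "card (carrier A) > 0" using A(2) A.one_closed by (auto simp: card_gt_0_iff)
  have fS: "real (card (?f S)) = ?q * real (card ?Y)" if S: "S \<in> ?S" "?good S" for S
  proof -
    have "real (card (?f S)) * real (card (auto A)) = real (card (gen_tuples A Jf)) *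
        (real (card (carrier V)) / real (card (carrier A))) ^ card Jf * euler_prod p (card Jf)"
    proof (rule V.card_extensions_with_quotient[where k = "Suc e" and n = n])
      show "\<And>x. x \<in> carrier V \<Longrightarrow> x [^]\<^bsub>V\<^esub> p ^ Suc e = \<one>\<^bsub>V\<^esub>" unfolding V_def by (rule pow_modulus_mod_vecs)
      show "card (carrier V) = (p ^ Suc e) ^ n" unfolding V_def using N0 by (rule card_mod_vecs)
      show "card (torsion V p) = p ^ n"
        unfolding V_def by (rule card_torsion_mod_vecs) (use p0 in auto)
      show "torsion V p \<subseteq> powers V (p ^ (Suc e - 1)) (carrier V)"
        unfolding V_def by (rule torsion_subset_powers_mod_vecs) (use p0 in auto)
      show "\<And>g. g \<in> carrier A \<Longrightarrow> g [^]\<^bsub>A\<^esub> p ^ (Suc e - 1) = \<one>\<^bsub>A\<^esub>"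
        using A.pow_order_eq_1 A(2,3) by simp
    qed (use p finV finJ Js(1) cJ SV S A in auto)
    then show ?thesis using aut0 cA finJ
      by (simp add: haar_cok_prob_def card_PiE field_simps power_divide)
  qed
  have q0: "0 \<le> ?q" unfolding haar_cok_prob_def using euler_prod_pos[OF p0(2), of "card Jf"] by simp
  have q1: "?q \<le> 1"
  proof -
    have "card (gen_tuples A Jf) \<le> card (\<Pi>\<^sub>E j\<in>Jf. carrier A)"
      using A(2) finJ by (intro card_mono finite_PiE) (auto simp: gen_tuples_def)
    then have "real (card (gen_tuples A Jf)) \<le> real (card (carrier A)) ^ card Jf"
      using finJ by (simp add: card_PiE flip: of_nat_power)
    then have g: "real (card (gen_tuples A Jf)) / real (card (carrier A)) ^ card Jf \<le> 1" using cA by simp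
    have eu: "euler_prod p (card Jf) \<le> 1" unfolding euler_prod_def
      using p0 by (intro prod_le_1) (auto simp: divide_le_eq_1 one_le_power simp flip: power_Suc)
    have "real (card (gen_tuples A Jf)) / real (card (carrier A)) ^ card Jf * euler_prod p (card Jf) \<le> 1 * 1"
      using g eu euler_prod_pos[OF p0(2), of "card Jf"] by (intro mult_mono) auto
    moreover have "0 < real (card (auto A))" "1 \<le> real (card (auto A))" using aut0 by auto
    ultimately show ?thesis unfolding haar_cok_prob_def by (simp only: divide_le_eq_1_pos)
  qed
  have "real (card {x \<in> Om. ?good x \<and> ?iso x}) = (\<Sum>S\<in>{S \<in> ?S. ?good S}. ?q * real (card ?Y))"
    unfolding c1 of_nat_sum using fS by (intro sum.cong refl) auto
  also have "\<dots> = ?q * real (card {x \<in> Om. ?good x})" unfolding c2 by simp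
  finally have main: "real (card {x \<in> Om. ?good x \<and> ?iso x}) = ?q * real (card {x \<in> Om. ?good x})" .
  let ?b1 = "card {x \<in> Om. \<not> ?good x \<and> ?iso x}" and ?b = "card {x \<in> Om. \<not> ?good x}"
  have "card {x \<in> Om. ?iso x} = card ({x \<in> Om. ?good x \<and> ?iso x} \<union> {x \<in> Om. \<not> ?good x \<and> ?iso x})"
    by (rule arg_cong[where f = card]) auto
  also have "\<dots> = card {x \<in> Om. ?good x \<and> ?iso x} + ?b1" using finO by (intro card_Un_disjoint) auto
  finally have s1: "card {x \<in> Om. ?iso x} = card {x \<in> Om. ?good x \<and> ?iso x} + ?b1" .
  have "card Om = card ({x \<in> Om. ?good x} \<union> {x \<in> Om. \<not> ?good x})" by (rule arg_cong[where f = card]) auto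
  also have "\<dots> = card {x \<in> Om. ?good x} + ?b" using finO by (intro card_Un_disjoint) auto
  finally have s2: "card Om = card {x \<in> Om. ?good x} + ?b" .
  have "real (card {x \<in> Om. ?iso x}) - ?q * real (card Om) = real ?b1 - ?q * real ?b"
    unfolding s1 s2 by (simp add: main algebra_simps)
  moreover have "?b1 \<le> ?b" using finO by (intro card_mono) auto
  moreover have "0 \<le> ?q * real ?b" "?q * real ?b \<le> real ?b" using q0 q1 by (auto intro: mult_left_le_one_le)
  ultimately show ?thesis by simp
qed

section \<open>Limits\<close>

text \<open>
  The factors differ from \<open>1\<close> by a summable sequence, and none of them vanishes.
\<close>

lemma euler_prod_limit:
  assumes p: "2 \<le> p"
  shows "euler_prod p \<longlonglongrightarrow> (\<Prod>i. 1 - 1 / real p ^ Suc i)" and "(\<Prod>i. 1 - 1 / real p ^ Suc i) \<noteq> 0"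
proof -
  let ?f = "\<lambda>i. 1 - 1 / real p ^ Suc i"
  have q: "1 / real p < 1" using p by simp
  have "summable (\<lambda>i. (1 / real p) * (1 / real p) ^ i)" using q p by (intro summable_mult summable_geometric) simp
  then have "summable (\<lambda>i. norm (?f i - 1))" by (simp add: power_one_over)
  then have conv: "convergent_prod ?f"
    using abs_convergent_prod_conv_summable abs_convergent_prod_imp_convergent_prod by blast
  have "(\<lambda>n. \<Prod>i\<le>n. ?f i) \<longlonglongrightarrow> prodinf ?f" using conv by (rule convergent_prod_LIMSEQ)
  then have "(\<lambda>n. euler_prod p (Suc n)) \<longlonglongrightarrow> prodinf ?f" by (simp add: euler_prod_def lessThan_Suc_atMost)
  then show "euler_prod p \<longlonglongrightarrow> prodinf ?f" by (rule LIMSEQ_imp_Suc)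
  have "?f i \<noteq> 0" for i
  proof -
    have "1 < real p ^ Suc i" using p by (intro one_less_power) auto
    then show ?thesis by simp
  qed
  then show "prodinf ?f \<noteq> 0" using conv by (intro prodinf_nonzero) auto
qed

lemma haar_cok_prob_limit:
  assumes p: "2 \<le> p" and A: "group A" "finite (carrier A)"
    and J: "\<And>n. finite (J n)" "filterlim (\<lambda>n. card (J n)) at_top sequentially"
  shows "(\<lambda>n. haar_cok_prob p (J n) A) \<longlonglongrightarrow> CL p A"
proof -
  interpret A: group A by fact
  let ?g = "\<lambda>n. real (card (gen_tuples A (J n))) / real (card (carrier A)) ^ card (J n)"
  have "(\<lambda>m. 2 ^ card (carrier A) * (1 / 2 :: real) ^ m) \<longlonglongrightarrow> 0"
    by (intro tendsto_mult_right_zero LIMSEQ_power_zero) simp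
  then have "(\<lambda>n. 2 ^ card (carrier A) * (1 / 2 :: real) ^ card (J n)) \<longlonglongrightarrow> 0"
    using J(2) by (rule filterlim_compose)
  then have "(\<lambda>n. 1 - ?g n) \<longlonglongrightarrow> 0"
    by (rule Lim_null_comparison[rotated]) (use A.gen_tuples_fraction[OF A(2) J(1)] in simp)
  then have "?g \<longlonglongrightarrow> 1" using tendsto_diff[OF tendsto_const[of 1], of "\<lambda>n. 1 - ?g n" 0] by simp
  then have "(\<lambda>n. ?g n * euler_prod p (card (J n)) / real (card (auto A))) \<longlonglongrightarrow>
      1 * (\<Prod>i. 1 - 1 / real p ^ Suc i) / real (card (auto A))"
    using filterlim_compose[OF euler_prod_limit(1)[OF p] J(2)]
    by (intro tendsto_divide tendsto_mult tendsto_const) (use card_auto_pos[OF A] in auto)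
  then show ?thesis by (simp add: haar_cok_prob_def CL_def)
qed

text \<open>
  The first column has to be nonzero, which accounts for the first factor.  Then it generates a subgroup of order \<open>p\<close>, and the
  remaining columns have to complete it.
\<close>

lemma card_generating_le:
  fixes \<tau> :: "nat \<Rightarrow> nat set"
  assumes p: "prime (p::nat)" and n: "0 < n"
  defines "V \<equiv> mod_vecs p n" and "Om \<equiv> support_matrices p n \<tau>"
  shows "real (card {x \<in> Om. generate V (x ` {..<n}) = carrier V}) \<le>
    real (card Om) * ((1 - (1 / real p) ^ card ({..<n} \<inter> \<tau> 0)) * euler_prod p (n - 1))"
proof -
  interpret V: comm_group V unfolding V_def by (rule comm_group_mod_vecs)
  let ?U = "\<lambda>j. supp_vecs p n (\<tau> j)" and ?J = "{1..<n}" and ?E = "euler_prod p (n - 1)"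
  have p0: "0 < p" "1 < p" using p prime_gt_0_nat prime_gt_1_nat by auto
  have finV: "finite (carrier V)" and cV: "card (carrier V) = p ^ n"
    unfolding V_def using p0 by (simp_all add: finite_mod_vecs card_mod_vecs)
  have U: "subgroup (?U j) V" for j unfolding V_def using p0(1) by (rule subgroup_supp_vecs)
  have Uc: "?U j \<subseteq> carrier V" for j using U by (rule subgroup.subset)
  have J: "{..<n} = insert 0 ?J" using n by auto
  have pow: "x [^]\<^bsub>V\<^esub> p = \<one>\<^bsub>V\<^esub>" for x unfolding V_def by (rule pow_modulus_mod_vecs)
  have idx: "card (carrier V) = p ^ Suc (card ?J) * card {\<one>\<^bsub>V\<^esub>}" using cV n by simp
  let ?c = "\<lambda>y. card (V.completions (carrier V) (generate V (insert y {\<one>\<^bsub>V\<^esub>})) ?U ?J)"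
  let ?P = "(\<Prod>j\<in>?J. real (card (?U j))) * ?E"
  have gen1: "generate V (insert \<one>\<^bsub>V\<^esub> (x ` {..<n})) = generate V (x ` {..<n})" if "x \<in> Om" for x
  proof
    have x: "x ` {..<n} \<subseteq> carrier V" using that Uc by (fastforce simp: Om_def support_matrices_def)
    show "generate V (insert \<one>\<^bsub>V\<^esub> (x ` {..<n})) \<subseteq> generate V (x ` {..<n})"
      using V.generate_is_subgroup[OF x] by (intro V.generate_subgroup_incl) (auto intro: generate.one generate.incl)
  qed (rule V.mono_generate, auto)
  have "{x \<in> Om. generate V (x ` {..<n}) = carrier V} = V.completions (carrier V) {\<one>\<^bsub>V\<^esub>} ?U {..<n}"
    using gen1 unfolding V.completions_def Om_def support_matrices_def by auto
  also have "card \<dots> = (\<Sum>y\<in>?U 0 - {\<one>\<^bsub>V\<^esub>}. ?c y)"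
    unfolding J by (rule V.card_completions_step[OF p finV V.subgroup_self _ _ Uc V.triv_subgroup _ _ idx])
      (auto simp: pow)
  finally have "real (card {x \<in> Om. generate V (x ` {..<n}) = carrier V}) = (\<Sum>y\<in>?U 0 - {\<one>\<^bsub>V\<^esub>}. real (?c y))"
    by simp
  also have "\<dots> \<le> (\<Sum>y\<in>?U 0 - {\<one>\<^bsub>V\<^esub>}. ?P)"
  proof (rule sum_mono)
    fix y assume y: "y \<in> ?U 0 - {\<one>\<^bsub>V\<^esub>}"
    have "real (?c y) \<le> (\<Prod>j\<in>?J. real (card (?U j))) * euler_prod p (card ?J)"
    proof (rule V.card_completions_le[OF p finV V.subgroup_self])
      show "subgroup (generate V (insert y {\<one>\<^bsub>V\<^esub>})) V" "generate V (insert y {\<one>\<^bsub>V\<^esub>}) \<subseteq> carrier V"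
        "\<And>x. x \<in> carrier V \<Longrightarrow> x [^]\<^bsub>V\<^esub> p \<in> generate V (insert y {\<one>\<^bsub>V\<^esub>})"
        "card (carrier V) = p ^ card ?J * card (generate V (insert y {\<one>\<^bsub>V\<^esub>}))"
        using V.generate_insert_index[OF p V.subgroup_self V.triv_subgroup _ _ idx, of y] y Uc by (auto simp: pow)
    qed (use U Uc in auto)
    then show "real (?c y) \<le> ?P" by simp
  qed
  also have "\<dots> = (real (card (?U 0)) - 1) * ?P"
  proof -
    have "card (?U 0 - {\<one>\<^bsub>V\<^esub>}) = card (?U 0) - 1"
      using subgroup.one_closed[OF U[of 0]] by (intro card_Diff_singleton)
    moreover have "1 \<le> card (?U 0)" using p0 by (simp add: card_supp_vecs Suc_leI)
    ultimately show ?thesis by (simp add: of_nat_diff)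
  qed
  also have "real (card (?U 0)) - 1 = real (card (?U 0)) * (1 - (1 / real p) ^ card ({..<n} \<inter> \<tau> 0))"
    using p0 by (simp add: card_supp_vecs power_one_over algebra_simps)
  also have "real (card (?U 0)) * (1 - (1 / real p) ^ card ({..<n} \<inter> \<tau> 0)) * ?P =
      (\<Prod>j\<in>insert 0 ?J. real (card (?U j))) * ((1 - (1 / real p) ^ card ({..<n} \<inter> \<tau> 0)) * ?E)"
    by simp
  also have "(\<Prod>j\<in>insert 0 ?J. real (card (?U j))) = real (card Om)"
    unfolding J[symmetric] Om_def support_matrices_def by (simp add: card_PiE)
  finally show ?thesis .
qed

lemma eq_carrier_of_trivial_quotient:
  assumes "comm_group V" and W: "subgroup W V" and iso: "V Mod W \<cong> singleton_group a"
  shows "W = carrier V"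
proof -
  interpret V: comm_group V by fact
  have "v [^]\<^bsub>V\<^esub> (1::nat) \<in> W" if "v \<in> carrier V" for v
    using iso that by (intro V.pow_mem_of_quotient_iso[OF W]) (auto simp: order_def)
  then show "W = carrier V" using subgroup.subset[OF W] V.nat_pow_eone by auto
qed

lemma prob_cok_iso:
  fixes X :: "'w \<Rightarrow> 'p :: prime_card padic_int mat" and A (structure)
  assumes M: "prob_space M" and X: "haar_matrix_supported M n \<sigma> X"
    and A: "group A" "finite (carrier A)" "order A = CARD('p) ^ e"
  defines "V \<equiv> mod_vecs (CARD('p) ^ Suc e) n" and "Om \<equiv> support_matrices (CARD('p) ^ Suc e) n (zero_based \<sigma>)"
  shows "measure M {\<omega> \<in> space M. cok (X \<omega>) \<cong> A} =
    real (card {x \<in> Om. V Mod generate V (x ` {..<n}) \<cong> A}) / real (card Om)"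
proof -
  have "{\<omega> \<in> space M. cok (X \<omega>) \<cong> A} =
      {\<omega> \<in> space M. V Mod generate V (residue_cols (Suc e) (X \<omega>) ` {..<n}) \<cong> A}"
  proof (intro Collect_cong conj_cong refl)
    fix \<omega> assume "\<omega> \<in> space M"
    then have c: "X \<omega> \<in> carrier_mat n n" using X by (auto simp: haar_matrix_supported_def)
    then have "residue_cols (Suc e) (X \<omega>) ` {..<n} = (\<lambda>j. residue_vec (Suc e) (col (X \<omega>) j)) ` {..<n}"
      by (auto simp: residue_cols_def)
    then show "cok (X \<omega>) \<cong> A \<longleftrightarrow> V Mod generate V (residue_cols (Suc e) (X \<omega>) ` {..<n}) \<cong> A"
      using cok_iso_iff_residue_quotient[OF c A] by (simp only: V_def)
  qed
  then show ?thesis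
    using prob_residue_cols[OF M X, of "\<lambda>x. V Mod generate V (x ` {..<n}) \<cong> A" "Suc e"] by (simp only: Om_def)
qed

text \<open>
  The staircase pattern for a single size \<open>n\<close>.
\<close>

definition stairs :: "nat \<Rightarrow> nat \<Rightarrow> nat \<Rightarrow> (nat \<Rightarrow> nat set) \<Rightarrow> bool" where
  "stairs d n t \<sigma> \<longleftrightarrow>
     (\<forall>i. 1 \<le> i \<longrightarrow> i \<le> t \<longrightarrow> \<sigma> i = {1..n - d * (t - i + 1)}) \<and>
     (\<forall>i. t + 1 \<le> i \<longrightarrow> i \<le> n - t \<longrightarrow> \<sigma> i = {1..n}) \<and>
     (\<forall>i. n - t + 1 \<le> i \<longrightarrow> i \<le> n \<longrightarrow> \<sigma> i = {1..n} - {1..d * (i + t - n)})"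

lemma zero_based_stairs:
  assumes S: "stairs d n t \<sigma>" and n: "d * t \<le> n" and d: "2 \<le> d"
  shows "\<And>j. j < t \<Longrightarrow> zero_based \<sigma> j = {..<(n - d * t) + d * j}"
    and "\<And>j. t \<le> j \<Longrightarrow> j < n - t \<Longrightarrow> zero_based \<sigma> j = {..<n}"
    and "\<And>j. j < t \<Longrightarrow> zero_based \<sigma> (n - Suc j) = {n - ((n - d * t) + d * j)..<n}"
proof -
  have tn: "t \<le> n" using n d by (metis le_trans mult_le_mono1 nat_mult_1 one_le_numeral order_trans)
  show "zero_based \<sigma> j = {..<(n - d * t) + d * j}" if j: "j < t" for j
  proof -
    have "\<sigma> (Suc j) = {1..n - d * (t - Suc j + 1)}" using S j by (auto simp: stairs_def)
    also have "t - Suc j + 1 = t - j" using j by simp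
    also have "n - d * (t - j) = (n - d * t) + d * j"
    proof -
      have "d * j \<le> d * t" using j by simp
      then show ?thesis using n by (simp add: diff_mult_distrib2)
    qed
    finally show ?thesis by (auto simp: zero_based_def)
  qed
  show "zero_based \<sigma> j = {..<n}" if j: "t \<le> j" "j < n - t" for j
  proof -
    have "\<sigma> (Suc j) = {1..n}" using S j by (auto simp: stairs_def)
    then show ?thesis by (auto simp: zero_based_def)
  qed
  show "zero_based \<sigma> (n - Suc j) = {n - ((n - d * t) + d * j)..<n}" if j: "j < t" for j
  proof -
    have "\<sigma> (n - j) = {1..n} - {1..d * (n - j + t - n)}" using S j tn unfolding stairs_def by auto
    also have "n - j + t - n = t - j" using j tn by simp
    also have "d * (t - j) = n - ((n - d * t) + d * j)"
    proof -
      have "d * j \<le> d * t" using j by simp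
      then show ?thesis using n by (simp add: diff_mult_distrib2)
    qed
    finally have "\<sigma> (Suc (n - Suc j)) = {1..n} - {1..n - ((n - d * t) + d * j)}" using j tn by (simp add: Suc_diff_Suc)
    then show ?thesis by (auto simp: zero_based_def)
  qed
qed

text \<open>
  The right-hand side bounds the probability that the sparse columns are dependent modulo \<open>p\<close>.
\<close>

lemma prob_cok_near_haar:
  fixes X :: "'w \<Rightarrow> 'p :: prime_card padic_int mat" and A (structure)
  assumes M: "prob_space M" and X: "haar_matrix_supported M n \<sigma> X"
    and A: "comm_group A" "finite (carrier A)" "order A = CARD('p) ^ e"
    and S: "stairs d n t \<sigma>" and n: "d * t \<le> n" and d: "2 \<le> d"
  defines "x \<equiv> (1 / real CARD('p)) ^ (n - d * t)"
  shows "\<bar>measure M {\<omega> \<in> space M. cok (X \<omega>) \<cong> A} - haar_cok_prob CARD('p) {t..<n - t} A\<bar> \<le>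
    x + (1 + 2 * real CARD('p) * x) ^ 2 - 1"
proof -
  interpret A: comm_group A by fact
  let ?p = "CARD('p)" and ?Js = "{..<t} \<union> {n - t..<n}" and ?Jf = "{t..<n - t}" and ?\<tau> = "zero_based \<sigma>"
  let ?V = "mod_vecs (?p ^ Suc e) n" and ?O = "support_matrices (?p ^ Suc e) n ?\<tau>"
  have p: "prime ?p" by (rule prime_card)
  have p2: "2 \<le> ?p" using p by (rule prime_ge_2_nat)
  have tn: "2 * t \<le> n" using n d by (meson le_trans mult_le_mono1)
  note \<tau> = zero_based_stairs[OF S n d]
  let ?iso = "real (card {x \<in> ?O. ?V Mod generate ?V (x ` {..<n}) \<cong> A})"
  let ?bad = "real (card {x \<in> ?O. \<not> indep_mod ?V ?p (powers ?V ?p (carrier ?V)) x ?Js})"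
  let ?q = "haar_cok_prob ?p ?Jf A"
  have O0: "0 < real (card ?O)" using p2 by (simp add: card_support_matrices)
  have 1: "\<bar>?iso - ?q * real (card ?O)\<bar> \<le> ?bad"
    using tn by (intro cok_count_near_haar p A \<tau>(2)) auto
  have 2: "?bad \<le> real (card ?O) *
      (\<Sum>c\<in>(\<Pi>\<^sub>E j\<in>?Js. {..<?p}) - {\<lambda>j\<in>?Js. 0}. (1 / real ?p) ^ card (used_rows ?\<tau> ?Js c))"
  proof (rule card_dependent_le[OF p])
    show "?Js \<subseteq> {..<n}" using tn by auto
    fix j assume "j \<in> ?Js"
    then consider "j < t" | j' where "j' < t" "j = n - Suc j'"
    proof (cases "j < t")
      case False
      with \<open>j \<in> ?Js\<close> have "n - Suc j < t" "j = n - Suc (n - Suc j)" using tn by auto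
      then show ?thesis using that(2) by blast
    qed auto
    then show "?\<tau> j \<subseteq> {..<n}"
    proof cases
      case 1
      then have "d * j \<le> d * t" by simp
      then have "(n - d * t) + d * j \<le> n" using n by linarith
      then show ?thesis using \<tau>(1)[OF 1] by auto
    qed (simp add: \<tau>(3), auto)
  qed simp
  have 3: "(\<Sum>c\<in>(\<Pi>\<^sub>E j\<in>?Js. {..<?p}) - {\<lambda>j\<in>?Js. 0}. (1 / real ?p) ^ card (used_rows ?\<tau> ?Js c))
      \<le> x + (1 + 2 * real ?p * x) ^ 2 - 1"
    unfolding x_def by (rule stairs_dependency_sum[OF p2 d _ \<tau>(1) \<tau>(3)]) (use n in auto)
  have "?bad \<le> real (card ?O) * (x + (1 + 2 * real ?p * x) ^ 2 - 1)"
    using 2 mult_left_mono[OF 3, of "real (card ?O)"] by linarith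
  then have "\<bar>?iso - ?q * real (card ?O)\<bar> / real (card ?O) \<le> x + (1 + 2 * real ?p * x) ^ 2 - 1"
    using 1 O0 by (simp add: divide_le_eq mult.commute)
  also have "\<bar>?iso - ?q * real (card ?O)\<bar> / real (card ?O) = \<bar>(?iso - ?q * real (card ?O)) / real (card ?O)\<bar>"
    using O0 by simp
  also have "(?iso - ?q * real (card ?O)) / real (card ?O) = ?iso / real (card ?O) - ?q"
    using O0 by (simp add: diff_divide_distrib)
  finally show ?thesis using prob_cok_iso[OF M X A.is_group A(2,3)] by simp
qed

text \<open>
  The trivial group has order \<open>p\<^sup>0\<close>, so residues modulo \<open>p\<close> suffice to recognize a trivial cokernel, and the columns of residues
  have to generate \<open>(\<int>/p)\<^sup>n\<close>.  The exponent \<open>n - d t\<close> is the number of entries of the first column.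
\<close>

lemma prob_cok_trivial_le:
  fixes X :: "'w \<Rightarrow> 'p :: prime_card padic_int mat"
  assumes M: "prob_space M" and X: "haar_matrix_supported M n \<sigma> X"
    and S: "stairs d n t \<sigma>" and n: "d * t \<le> n" and d: "2 \<le> d" and t: "0 < t"
  shows "measure M {\<omega> \<in> space M. cok (X \<omega>) \<cong> singleton_group (a :: nat)} \<le>
    (1 - (1 / real CARD('p)) ^ (n - d * t)) * euler_prod CARD('p) (n - 1)"
proof -
  let ?p = "CARD('p)" and ?\<tau> = "zero_based \<sigma>"
  let ?V = "mod_vecs ?p n" and ?O = "support_matrices ?p n ?\<tau>"
  interpret V: comm_group ?V by (rule comm_group_mod_vecs)
  have p: "prime ?p" by (rule prime_card)
  have n0: "0 < n" using n d t by (metis gr0I le_zero_eq mult_is_0 not_numeral_le_zero)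
  have p0: "0 < ?p" by simp
  have O0: "0 < real (card ?O)" using p0 by (simp add: card_support_matrices)
  have \<tau>0: "?\<tau> 0 = {..<n - d * t}" using zero_based_stairs(1)[OF S n d t] by simp
  have "{..<n - d * t} \<subseteq> {..<n}" by (simp only: lessThan_subset_iff diff_le_self)
  then have c: "card ({..<n} \<inter> ?\<tau> 0) = n - d * t" by (simp only: \<tau>0 Int_absorb1 card_lessThan)
  have sub: "subgroup (generate ?V (x ` {..<n})) ?V" if "x \<in> ?O" for x
    using that supp_vecs_subset[OF p0] by (intro V.generate_is_subgroup) (fastforce simp: support_matrices_def)
  have "measure M {\<omega> \<in> space M. cok (X \<omega>) \<cong> singleton_group a} =
      real (card {x \<in> ?O. ?V Mod generate ?V (x ` {..<n}) \<cong> singleton_group a}) / real (card ?O)"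
    using prob_cok_iso[OF M X, of "singleton_group a" 0] by (simp add: order_def)
  also have "\<dots> \<le> real (card {x \<in> ?O. generate ?V (x ` {..<n}) = carrier ?V}) / real (card ?O)"
  proof (intro divide_right_mono of_nat_mono card_mono)
    show "finite {x \<in> ?O. generate ?V (x ` {..<n}) = carrier ?V}" using finite_support_matrices by simp
    show "{x \<in> ?O. ?V Mod generate ?V (x ` {..<n}) \<cong> singleton_group a} \<subseteq>
        {x \<in> ?O. generate ?V (x ` {..<n}) = carrier ?V}"
    proof (intro subsetI CollectI conjI; elim CollectE conjE)
      fix x assume "x \<in> ?O" "?V Mod generate ?V (x ` {..<n}) \<cong> singleton_group a"
      then show "generate ?V (x ` {..<n}) = carrier ?V"
        by (intro eq_carrier_of_trivial_quotient[OF V.comm_group_axioms sub])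
    qed
  qed (rule of_nat_0_le_iff)
  also have "\<dots> \<le> real (card ?O) * ((1 - (1 / real ?p) ^ card ({..<n} \<inter> ?\<tau> 0)) * euler_prod ?p (n - 1)) / real (card ?O)"
    by (intro divide_right_mono card_generating_le p n0) auto
  finally show ?thesis unfolding c using O0 by simp
qed

lemma CL_trivial: "CL p (singleton_group a) = (\<Prod>i. 1 - 1 / real p ^ Suc i)"
proof -
  have "auto (singleton_group a) = {\<lambda>x\<in>{a}. a}"
    by (auto simp: auto_def Bij_def hom_def singleton_group_def bij_betw_def extensional_def fun_eq_iff Pi_iff)
  then show ?thesis by (simp add: CL_def)
qed

theorem theorem1p5:
  fixes d p :: nat
    and t :: "nat \<Rightarrow> nat"
    and \<sigma> :: "nat \<Rightarrow> nat \<Rightarrow> nat set"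
    and M :: "nat \<Rightarrow> 'w measure"
    and X :: "nat \<Rightarrow> 'w \<Rightarrow> 'p :: prime_card padic_int mat"
  assumes "p = CARD('p)"
    and "d \<ge> 2"
    and "\<And>n. n \<ge> 1 \<Longrightarrow> d * t n \<le> n"
    and "\<And>n i. n \<ge> 1 \<Longrightarrow> 1 \<le> i \<Longrightarrow> i \<le> t n \<Longrightarrow> \<sigma> n i = {1..n - d * (t n - i + 1)}"
    and "\<And>n i. n \<ge> 1 \<Longrightarrow> t n + 1 \<le> i \<Longrightarrow> i \<le> n - t n \<Longrightarrow> \<sigma> n i = {1..n}"
    and "\<And>n i. n \<ge> 1 \<Longrightarrow> n - t n + 1 \<le> i \<Longrightarrow> i \<le> n \<Longrightarrow>
           \<sigma> n i = {1..n} - {1..d * (i + t n - n)}"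
    and "\<And>n. n \<ge> 1 \<Longrightarrow> prob_space (M n)"
    and "\<And>n. n \<ge> 1 \<Longrightarrow> haar_matrix_supported (M n) n (\<sigma> n) (X n)"
  shows "converges_to_CL p M (\<lambda>n \<omega>. cok (X n \<omega>)) \<longleftrightarrow>
    (\<lambda>n. measure (M n) {\<omega> \<in> space (M n). Determinant.det (map_mat reduce (X n \<omega>)) \<noteq> 0})
      \<longlonglongrightarrow> (\<Prod>i. 1 - 1 / real p ^ Suc i)"
proof -
  let ?c = "\<Prod>i. 1 - 1 / real p ^ Suc i" and ?T = "singleton_group (0 :: nat)"
  define D where "D n = measure (M n) {\<omega> \<in> space (M n). Determinant.det (map_mat reduce (X n \<omega>)) \<noteq> 0}" for n
  define P where "P G n = measure (M n) {\<omega> \<in> space (M n). cok (X n \<omega>) \<cong> G}" for G :: "nat monoid" and n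
  define x where "x n = (1 / real p) ^ (n - d * t n)" for n
  have p2: "2 \<le> p" unfolding assms(1) by (intro prime_ge_2_nat prime_card)
  note ps = assms(7) and X = assms(8) and n = assms(3) and d = assms(2)
  have S: "stairs d n (t n) (\<sigma> n)" if "1 \<le> n" for n
    unfolding stairs_def using assms(4-6)[OF that] by blast
  have carrier: "X n \<omega> \<in> carrier_mat n n" if "1 \<le> n" "\<omega> \<in> space (M n)" for n \<omega>
    using X[OF that(1)] that(2) by (auto simp: haar_matrix_supported_def)
  have DP: "D n = P ?T n" if "1 \<le> n" for n
  proof -
    have "det (map_mat reduce (X n \<omega>)) \<noteq> 0 \<longleftrightarrow> cok (X n \<omega>) \<cong> ?T" if "\<omega> \<in> space (M n)" for \<omega>
      using cok_trivial_iff_det_reduce[OF carrier[OF \<open>1 \<le> n\<close> that], of 0] by (rule sym)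
    then show ?thesis unfolding D_def P_def
      by (intro arg_cong[where f = "measure (M n)"] Collect_cong conj_cong refl)
  qed
  have T: "finite_abelian_p_group p ?T"
    by (auto simp: finite_abelian_p_group_def order_def intro: exI[of _ 0])
  show ?thesis
    unfolding D_def[symmetric]
  proof
    assume "converges_to_CL p M (\<lambda>n \<omega>. cok (X n \<omega>))"
    then have "P ?T \<longlonglongrightarrow> CL p ?T" unfolding converges_to_CL_def P_def using T by blast
    moreover have "\<forall>\<^sub>F n in sequentially. P ?T n = D n"
      using DP by (intro eventually_sequentiallyI[of 1]) simp
    ultimately have "D \<longlonglongrightarrow> CL p ?T" by (rule Lim_transform_eventually)
    then show "D \<longlonglongrightarrow> ?c" by (simp only: CL_trivial)
  next
    assume D: "D \<longlonglongrightarrow> ?c"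
    have e: "(\<lambda>n. euler_prod p (n - 1)) \<longlonglongrightarrow> ?c"
      by (rule LIMSEQ_imp_Suc, unfold diff_Suc_1) (rule euler_prod_limit(1)[OF p2])
    have x0: "0 \<le> x n" for n by (simp add: x_def)
    \<comment> \<open>If there are no sparse columns, then \<open>x n\<close> is the first summand.  Otherwise the second summand bounds it.\<close>
    have xbound: "x n \<le> (1 / real p) ^ n + \<bar>1 - D n / euler_prod p (n - 1)\<bar>" if n1: "1 \<le> n" for n
    proof (cases "t n = 0")
      case True
      then show ?thesis by (simp add: x_def)
    next
      case False
      have E: "0 < euler_prod p (n - 1)" using p2 by (intro euler_prod_pos) simp
      have "D n \<le> (1 - x n) * euler_prod p (n - 1)"
        unfolding DP[OF n1] P_def x_def assms(1) using False
        by (intro prob_cok_trivial_le[OF ps[OF n1] X[OF n1] S[OF n1] n[OF n1] d]) simp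
      then have "D n / euler_prod p (n - 1) \<le> 1 - x n" using E by (simp add: divide_le_eq)
      moreover have "0 \<le> (1 / real p) ^ n" by simp
      ultimately show ?thesis by linarith
    qed
    have xlim: "x \<longlonglongrightarrow> 0"
    proof (rule tendsto_sandwich[where f = "\<lambda>_. 0"])
      have "(\<lambda>n. D n / euler_prod p (n - 1)) \<longlonglongrightarrow> ?c / ?c"
        using D e by (rule tendsto_divide) (rule euler_prod_limit(2)[OF p2])
      then have "(\<lambda>n. \<bar>1 - D n / euler_prod p (n - 1)\<bar>) \<longlonglongrightarrow> \<bar>1 - ?c / ?c\<bar>"
        by (intro tendsto_rabs tendsto_diff tendsto_const)
      moreover have "(\<lambda>n. (1 / real p) ^ n) \<longlonglongrightarrow> 0" using p2 by (intro LIMSEQ_power_zero) simp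
      ultimately have "(\<lambda>n. (1 / real p) ^ n + \<bar>1 - D n / euler_prod p (n - 1)\<bar>) \<longlonglongrightarrow> 0 + \<bar>1 - ?c / ?c\<bar>"
        by (intro tendsto_add)
      then show "(\<lambda>n. (1 / real p) ^ n + \<bar>1 - D n / euler_prod p (n - 1)\<bar>) \<longlonglongrightarrow> 0"
        using euler_prod_limit(2)[OF p2] by simp
      show "\<forall>\<^sub>F n in sequentially. x n \<le> (1 / real p) ^ n + \<bar>1 - D n / euler_prod p (n - 1)\<bar>"
        using xbound by (rule eventually_sequentiallyI)
    qed (use x0 in auto)
    have mlim: "filterlim (\<lambda>n. n - 2 * t n) at_top sequentially"
      unfolding filterlim_at_top
    proof
      fix R :: nat
      have "\<forall>\<^sub>F n in sequentially. x n < (1 / real p) ^ R"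
        using xlim p2 by (intro order_tendstoD(2)) auto
      moreover have "\<forall>\<^sub>F n in sequentially. 1 \<le> n" by (rule eventually_ge_at_top)
      ultimately show "\<forall>\<^sub>F n in sequentially. R \<le> n - 2 * t n"
      proof eventually_elim
        case (elim n)
        have "R \<le> n - d * t n"
        proof (rule ccontr)
          assume "\<not> R \<le> n - d * t n"
          then have "(1 / real p) ^ R \<le> x n" unfolding x_def using p2 by (intro power_decreasing) auto
          then show False using elim by simp
        qed
        moreover have "2 * t n \<le> d * t n" using d by simp
        ultimately show ?case by linarith
      qed
    qed
    show "converges_to_CL p M (\<lambda>n \<omega>. cok (X n \<omega>))"
      unfolding converges_to_CL_def P_def[symmetric]
    proof (intro allI impI)
      fix G :: "nat monoid" assume "finite_abelian_p_group p G"
      then obtain k where G: "comm_group G" "finite (carrier G)" "order G = CARD('p) ^ k"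
        unfolding finite_abelian_p_group_def assms(1) by blast
      have grp: "group G" using G(1) by (rule comm_group.axioms(2))
      have H: "(\<lambda>n. haar_cok_prob p {t n..<n - t n} G) \<longlonglongrightarrow> CL p G"
        using mlim by (intro haar_cok_prob_limit p2 grp G(2)) (simp_all add: mult_2)
      have "(\<lambda>n. P G n - haar_cok_prob p {t n..<n - t n} G) \<longlonglongrightarrow> 0"
      proof (rule Lim_null_comparison)
        show "\<forall>\<^sub>F n in sequentially. norm (P G n - haar_cok_prob p {t n..<n - t n} G) \<le>
            x n + (1 + 2 * real p * x n) ^ 2 - 1"
        proof (rule eventually_sequentiallyI)
          fix n :: nat assume n1: "1 \<le> n"
          show "norm (P G n - haar_cok_prob p {t n..<n - t n} G) \<le> x n + (1 + 2 * real p * x n) ^ 2 - 1"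
            using prob_cok_near_haar[OF ps[OF n1] X[OF n1] G S[OF n1] n[OF n1] d]
            unfolding P_def x_def assms(1) real_norm_def .
        qed
        have "(\<lambda>n. x n + (1 + 2 * real p * x n) ^ 2 - 1) \<longlonglongrightarrow> 0 + (1 + 2 * real p * 0) ^ 2 - 1"
          by (intro tendsto_intros xlim)
        then show "(\<lambda>n. x n + (1 + 2 * real p * x n) ^ 2 - 1) \<longlonglongrightarrow> 0" by simp
      qed
      from tendsto_add[OF this H] show "P G \<longlonglongrightarrow> CL p G" by simp
    qed
  qed
qed

end
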